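(* Let $k\ge1$, $s\in\mathbb{C}$, $\epsilon\in\{\pm1\}$, and let $f:\mathbb{R}^k\setminus\{0\}\to\mathbb{C}$ be $C^\infty$ and homogeneous of type $(-s,\epsilon)$. Assume that neither $(s,\epsilon)$ nor $(k-s,\epsilon)$ belongs to $\{(e+k,(-1)^e):e=0,1,2,\dots\}$. Let $D=\mathbb{R}^k\setminus(\mathbb{Z}^k\setminus\{0\})$. Then the function $y\mapsto F_f(0,\mathbf{e}_k(y))-\widehat f(y)$, defined for $0\neq y\in D$, extends to a $C^\infty$ function on $D$ whose value at $0$ is $\sum_{0\neq n\in\mathbb{Z}^k}f(n)$ (the algebraically defined sum described in the context).
   Context: Notation: $\mathbb{T}=\{z\in\mathbb{C}:|z|=1\}$; $z^n=z_1^{n_1}\cdots z_k^{n_k}$; $\psi(x,y)=\exp 2\pi\sqrt{-1}(x_1y_1+\dots+x_ky_k)$; $\mathbf{e}_k(y)=(\exp2\pi\sqrt{-1}y_1,\dots,\exp2\pi\sqrt{-1}y_k)\in\mathbb{T}^k$. Homogeneity: $f$ is homogeneous of type $(\sigma,\epsilon)$ if $f(tx)=t^{\sigma}f(x)$ and $f(-x)=\epsilon f(x)$ for all $t>0$, $x\neq0$. Fourier transform: $\widehat h(y)=\int_{\mathbb{R}^k}h(x)\psi(x,y)\,dx$ for $h\in L^1(\mathbb{R}^k)$, extended to tempered distributions by $\widehat u(\phi)=u(\widehat\phi)$. Since $(s,\epsilon)\notin\{(e+k,(-1)^e):e\ge0\}$, $f$ extends uniquely to a tempered distribution $u$ on $\mathbb{R}^k$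 that is homogeneous of type $(-s,\epsilon)$ (i.e. $u(\phi(\cdot/t))=t^{k-s}u(\phi)$ for $t>0$ and $u(\phi(-\,\cdot))=\epsilon u(\phi)$). Its Fourier transform is $C^\infty$ on $\mathbb{R}^k\setminus\{0\}$, and $\widehat f$ denotes the restriction of $\widehat u$ to $\mathbb{R}^k\setminus\{0\}$. t-summability: for $c:\mathbb{Z}^k\to\mathbb{C}$ finitely supported and $a:\mathbb{Z}^k\to\mathbb{C}$, $(c*a)(n)=\sum_{m}c(m)a(n-m)$. The series $\sum_n a(n)$ is t-summable if there is a finitely supported $c$ with $\sum c\neq0$ and $\sum_n|(c*a)(n)|<\infty$; its sum is then $(\sum c)^{-1}\sum_n(c*a)(n)$, independent of $c$. A series indexed by a subset of $\mathbb{Z}^k$ is extended by zero. $F_f(x,z)$, for $x\in D$ and $z\in\mathbb{T}^k\setminus\{(1,\dots,1)\}$, is the sum of the t-summable series $\sum_{0\ne n\in\mathbb{Z}^k}f(x+n)z^n$. Algebraically defined sum: if $s\neq k$, choose an integer $m>1$ with $m^{k-s}\neq1$ and put $$\sum_{0\ne n\in\mathbb{Z}^k}f(n)=-(1-m^{k-s})^{-1}\sum_{1\neq\lambda\in\mathbb{T}^k,\ \lambda^m=1}F_f(0,\lambda),$$ where $\lambda^m=1$ means $\lambda_i^m=1$ for all $i$; this is independent of $m$. If $\epsilon=-1$, the sum is $0$ (consistent with the formula when $s\neq k$). The case $(s,\epsilon)=(k,1)$ is excluded by hypothesis. *)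

theory Defs
  imports "HOL-Analysis.Analysis"
begin

section \<open>Smooth functions\<close>

definition partial :: "'k::finite \<Rightarrow> (real^'k \<Rightarrow> complex) \<Rightarrow> real^'k \<Rightarrow> complex" where
  "partial i f x = frechet_derivative f (at x) (axis i 1)"

text \<open>Multi-indices are encoded as lists of directions:
  \<open>partials [i\<^sub>1, \<dots>, i\<^sub>n] f\<close> is the iterated derivative of order \<open>n\<close>.\<close>

definition partials :: "'k::finite list \<Rightarrow> (real^'k \<Rightarrow> complex) \<Rightarrow> real^'k \<Rightarrow> complex" where
  "partials is f = foldr partial is f"

text \<open>To be used for open \<open>S\<close> only, where differentiability of all iterated partial derivatives
  (hence also their continuity) is the usual notion of being infinitely differentiable.\<close>

definition smooth_on :: "(real^'k::finite) set \<Rightarrow> (real^'k \<Rightarrow> complex) \<Rightarrow> bool" where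
  "smooth_on S f \<longleftrightarrow> (\<forall>is. partials is f differentiable_on S)"

section \<open>Tempered distributions\<close>

definition schwartz :: "(real^'k::finite \<Rightarrow> complex) set" where
  "schwartz = {\<phi>. smooth_on UNIV \<phi> \<and>
     (\<forall>is N. bounded (range (\<lambda>x. (1 + norm x) ^ N * norm (partials is \<phi> x))))}"

definition schwartz_seminorm :: "nat \<Rightarrow> (real^'k::finite \<Rightarrow> complex) \<Rightarrow> real" where
  "schwartz_seminorm N \<phi> =
     (SUP (is, x) \<in> {is. length is \<le> N} \<times> UNIV. (1 + norm x) ^ N * norm (partials is \<phi> x))"

text \<open>A distribution is a functional on all functions, of which only the values on \<^const>\<open>schwartz\<close>
  matter. Continuity is expressed as boundedness by one of the increasing defining seminorms.\<close>

definition tempered :: "((real^'k::finite \<Rightarrow> complex) \<Rightarrow> complex) \<Rightarrow> bool" where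
  "tempered u \<longleftrightarrow>
     (\<forall>\<phi>\<in>schwartz. \<forall>\<theta>\<in>schwartz. \<forall>a b. u (\<lambda>x. a * \<phi> x + b * \<theta> x) = a * u \<phi> + b * u \<theta>) \<and>
     (\<exists>N C. \<forall>\<phi>\<in>schwartz. norm (u \<phi>) \<le> C * schwartz_seminorm N \<phi>)"

definition psi :: "real^'k::finite \<Rightarrow> real^'k \<Rightarrow> complex" where
  "psi x y = exp (2 * of_real pi * \<i> * of_real (x \<bullet> y))"

definition fourier :: "(real^'k::finite \<Rightarrow> complex) \<Rightarrow> real^'k \<Rightarrow> complex" where
  "fourier h y = (LINT x|lborel. h x * psi x y)"

definition fourier_distr ::
    "((real^'k::finite \<Rightarrow> complex) \<Rightarrow> complex) \<Rightarrow> (real^'k \<Rightarrow> complex) \<Rightarrow> complex" where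
  "fourier_distr u \<phi> = u (fourier \<phi>)"

text \<open>Smooth functions with compact support contained in \<open>\<real>\<^sup>k - {0}\<close>.\<close>

definition test_off_0 :: "(real^'k::finite \<Rightarrow> complex) set" where
  "test_off_0 = {\<phi>. smooth_on UNIV \<phi> \<and> compact (closure {x. \<phi> x \<noteq> 0}) \<and> 0 \<notin> closure {x. \<phi> x \<noteq> 0}}"

definition represented_off_0 ::
    "((real^'k::finite \<Rightarrow> complex) \<Rightarrow> complex) \<Rightarrow> (real^'k \<Rightarrow> complex) \<Rightarrow> bool" where
  "represented_off_0 u g \<longleftrightarrow> (\<forall>\<phi>\<in>test_off_0. u \<phi> = (LINT x|lborel. g x * \<phi> x))"

section \<open>Homogeneous functions and their Fourier transforms\<close>

text \<open>A function on \<open>\<real>\<^sup>k - {0}\<close> is represented by a total function whose value at \<open>0\<close> is never used.\<close>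

definition homogeneous :: "complex \<Rightarrow> complex \<Rightarrow> (real^'k::finite \<Rightarrow> complex) \<Rightarrow> bool" where
  "homogeneous \<sigma> \<epsilon> f \<longleftrightarrow>
     (\<forall>x t. x \<noteq> 0 \<longrightarrow> t > 0 \<longrightarrow> f (t *\<^sub>R x) = of_real t powr \<sigma> * f x) \<and>
     (\<forall>x. x \<noteq> 0 \<longrightarrow> f (- x) = \<epsilon> * f x)"

definition homogeneous_distr ::
    "complex \<Rightarrow> complex \<Rightarrow> ((real^'k::finite \<Rightarrow> complex) \<Rightarrow> complex) \<Rightarrow> bool" where
  "homogeneous_distr \<sigma> \<epsilon> u \<longleftrightarrow>
     (\<forall>\<phi>\<in>schwartz. \<forall>t>0.
        u (\<lambda>x. \<phi> ((1 / t) *\<^sub>R x)) = of_real t powr (of_nat CARD('k) + \<sigma>) * u \<phi>) \<and>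
     (\<forall>\<phi>\<in>schwartz. u (\<lambda>x. \<phi> (- x)) = \<epsilon> * u \<phi>)"

text \<open>The homogeneous tempered extension is unique only as a functional on \<^const>\<open>schwartz\<close>, and
  the function representing its Fourier transform only on \<open>\<real>\<^sup>k - {0}\<close>; this is why both
  are chosen with \<open>SOME\<close> rather than \<open>THE\<close>.\<close>

definition homogeneous_extension ::
    "complex \<Rightarrow> complex \<Rightarrow> (real^'k::finite \<Rightarrow> complex) \<Rightarrow> (real^'k \<Rightarrow> complex) \<Rightarrow> complex" where
  "homogeneous_extension \<sigma> \<epsilon> f =
     (SOME u. tempered u \<and> homogeneous_distr \<sigma> \<epsilon> u \<and> represented_off_0 u f)"

definition fourier_homogeneous ::
    "complex \<Rightarrow> complex \<Rightarrow> (real^'k::finite \<Rightarrow> complex) \<Rightarrow> real^'k \<Rightarrow> complex" where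
  "fourier_homogeneous \<sigma> \<epsilon> f =
     (SOME g. smooth_on (- {0}) g \<and>
        represented_off_0 (fourier_distr (homogeneous_extension \<sigma> \<epsilon> f)) g)"

section \<open>T-summability\<close>

definition conv ::
    "(int^'k::finite \<Rightarrow> complex) \<Rightarrow> (int^'k \<Rightarrow> complex) \<Rightarrow> int^'k \<Rightarrow> complex" where
  "conv c a n = (\<Sum>m | c m \<noteq> 0. c m * a (n - m))"

text \<open>\<open>c\<close> witnesses the t-summability of \<open>\<Sum>n. a n\<close>.\<close>

definition t_summing :: "(int^'k::finite \<Rightarrow> complex) \<Rightarrow> (int^'k \<Rightarrow> complex) \<Rightarrow> bool" where
  "t_summing c a \<longleftrightarrow> finite {m. c m \<noteq> 0} \<and> (\<Sum>m | c m \<noteq> 0. c m) \<noteq> 0 \<and>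
     (\<lambda>n. norm (conv c a n)) summable_on UNIV"

definition t_sum :: "(int^'k::finite \<Rightarrow> complex) \<Rightarrow> complex" where
  "t_sum a = (THE S. \<exists>c. t_summing c a \<and> S = infsum (conv c a) UNIV / (\<Sum>m | c m \<noteq> 0. c m))"

section \<open>Lattice sums\<close>

definition lattice_vec :: "int^'k \<Rightarrow> real^'k::finite" where
  "lattice_vec n = (\<chi> i. of_int (n $ i))"

definition monomial :: "complex^'k::finite \<Rightarrow> int^'k \<Rightarrow> complex" where
  "monomial z n = (\<Prod>i\<in>UNIV. (z $ i) powi (n $ i))"

definition torus_exp :: "real^'k \<Rightarrow> complex^'k::finite" where
  "torus_exp y = (\<chi> i. exp (2 * of_real pi * \<i> * of_real (y $ i)))"

text \<open>\<open>\<real>\<^sup>k\<close> without the nonzero lattice points.\<close>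

definition punctured_domain :: "(real^'k::finite) set" where
  "punctured_domain = - (lattice_vec ` (- {0}))"

definition lattice_series ::
    "(real^'k::finite \<Rightarrow> complex) \<Rightarrow> real^'k \<Rightarrow> complex^'k \<Rightarrow> complex" where
  "lattice_series f x z = t_sum (\<lambda>n. if n = 0 then 0 else f (x + lattice_vec n) * monomial z n)"

text \<open>The sum \<open>\<Sum>n\<noteq>0. f n\<close> for \<open>f\<close> homogeneous of type \<open>(-s, \<epsilon>)\<close>. It is not meaningful for
  \<open>(s, \<epsilon>) = (k, 1)\<close>, where no suitable \<open>m\<close> exists. Otherwise the result does not depend on the
  choice of \<open>m\<close>.\<close>

definition algebraic_sum :: "complex \<Rightarrow> complex \<Rightarrow> (real^'k::finite \<Rightarrow> complex) \<Rightarrow> complex" where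
  "algebraic_sum s \<epsilon> f =
     (if \<epsilon> = - 1 then 0
      else let w = of_nat CARD('k) - s;
               m = SOME m::nat. 1 < m \<and> of_nat m powr w \<noteq> 1
           in - (\<Sum>z | z \<noteq> 1 \<and> (\<forall>i. z $ i ^ m = 1). lattice_series f 0 z) / (1 - of_nat m powr w))"

end

theory Submission
  imports Defs
begin

text \<open>
  Write \<open>k\<close> for the dimension, \<open>F(y)\<close> for the value of \<^const>\<open>lattice_series\<close> at \<open>e(y)\<close> and \<open>f^\<close> for
  the Fourier transform of \<open>f\<close>. Everything is done with one dyadic decomposition. For a cutoff \<open>\<omega>\<close>, equal to \<open>1\<close>
  near \<open>0\<close>, the function \<open>f\<close> is the sum over all integers \<open>i\<close> of
  \<open>g\<^sub>i(x) = f(x) (\<omega>(x/2\<^sup>i\<^sup>+\<^sup>1) - \<omega>(x/2\<^sup>i))\<close>. By homogeneity every \<open>g\<^sub>i\<close> is a multiple of a dilate of the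
  single test function \<open>g\<^sub>0\<close>, which vanishes near the origin. With \<open>S q (y)\<close> for the finite sum
  of \<open>q(n) \<psi>(n, y)\<close> over the lattice, \<open>F\<close> is the sum of the \<open>S g\<^sub>i\<close> over \<open>i \<ge> 0\<close>, and \<open>f^\<close> is the
  sum of the Fourier transforms of all \<open>g\<^sub>i\<close>. Hence
  \<open>F - f^ = (\<Sum>i\<ge>0. S g\<^sub>i - g\<^sub>i^) - (\<Sum>i<0. g\<^sub>i^)\<close>,
  and smoothness follows from geometric bounds for the terms on the right and for all their
  derivatives, which are terms of the same kind (\<open>smooth_on_suminf\<close>).

  \<^item> Away from the lattice, \<open>S g\<^sub>i\<close> is small by summation by parts (\<open>latsum_scaled_decay\<close>). This
  gives the value of the t-summable series (\<open>lattice_series_dyadic\<close>) and, when the mesh of the lattice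
  tends to \<open>0\<close>, the decay of Fourier transforms of test functions (\<open>fourier_decay\<close>).

  \<^item> Near \<open>0\<close>, \<open>S g\<^sub>i - g\<^sub>i^\<close> is small. This would follow from the Poisson summation
  formula, but a more elementary fact is enough: sums over a lattice and over the lattice of half
  the mesh differ by sums at frequencies away from the lattice (\<open>latsum_aliasing\<close>, \<open>latsum_near_0\<close>).

  \<^item> For \<open>i < 0\<close> the bounds require that \<open>g\<^sub>0^\<close> vanishes to high order at \<open>0\<close>. The
  hypothesis on \<open>(s, \<epsilon>)\<close> says that the quasi-character \<open>a \<mapsto> \<bar>a\<bar>\<^sup>s\<^sup>-\<^sup>k\<close> (times \<open>\<epsilon>\<close> for \<open>a < 0\<close>), by which dilations act on
  homogeneous distributions, is not a monomial \<open>a\<^sup>d\<close>. So some finite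
  combination of dilations annihilates all monomials of degree below \<open>n\<close> but acts as the identity on
  homogeneous distributions (\<open>exists_moments\<close>). Applied to a cutoff it produces \<open>\<omega>\<close>
  (locale \<open>moment_cutoff\<close>).

  The same combination \<open>\<phi> \<mapsto> \<phi>~\<close> extends \<open>f\<close> to the homogeneous distribution \<open>\<phi> \<mapsto> \<integral>f \<phi>~\<close>, and shows that every
  tempered homogeneous extension is the limit of integrals against partial sums of the \<open>g\<^sub>i\<close>
  (\<open>homogeneous_distr_limit\<close>). So whichever extension is chosen, its Fourier transform is
  the sum of the \<open>g\<^sub>i^\<close> off the origin.

  For the value at \<open>0\<close>, averaging over the \<open>m\<close>-torsion points \<open>\<lambda>\<close> of the torus gives
  \<open>(\<Sum>\<lambda>. F(\<lambda> e(y))) = m\<^sup>k\<^sup>-\<^sup>s F(my)\<close>, while \<open>f^(my) = m\<^sup>s\<^sup>-\<^sup>k f^(y)\<close>. For the difference \<open>G = F - f^\<close> this reads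
  \<open>(\<Sum>\<lambda>\<noteq>1. F(\<lambda> e(y))) = m\<^sup>k\<^sup>-\<^sup>s G(my) - G(y)\<close>, and \<open>y \<rightarrow> 0\<close> yields the algebraically defined sum. If \<open>\<epsilon> = -1\<close>, then
  \<open>G\<close> is odd.
\<close>

section \<open>Calculus of smooth functions\<close>

lemma partials_Nil [simp]: "partials [] f = f"
  by (simp add: partials_def)

lemma partials_Cons [simp]: "partials (i # is) f = partial i (partials is f)"
  by (simp add: partials_def)

lemma partials_append: "partials (is @ js) f = partials is (partials js f)"
  by (simp add: partials_def)

lemma partial_eqI: "(f has_derivative f') (at x) \<Longrightarrow> partial i f x = f' (axis i 1)"
  by (metis partial_def frechet_derivative_at)

lemma has_derivative_partial:
  assumes "f differentiable (at x)"
  shows "(f has_derivative (\<lambda>v. \<Sum>j\<in>UNIV. of_real (v $ j) * partial j f x)) (at x)"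
proof -
  have D: "(f has_derivative frechet_derivative f (at x)) (at x)"
    using assms frechet_derivative_works by blast
  then have lin: "linear (frechet_derivative f (at x))"
    using has_derivative_linear by blast
  have "frechet_derivative f (at x) = (\<lambda>v. \<Sum>j\<in>UNIV. of_real (v $ j) * partial j f x)"
  proof
    fix v :: "real^'a"
    have "v = (\<Sum>j\<in>UNIV. (v $ j) *\<^sub>R axis j 1)"
      using basis_expansion[of v] by (simp add: scalar_mult_eq_scaleR)
    then have "frechet_derivative f (at x) v
        = frechet_derivative f (at x) (\<Sum>j\<in>UNIV. (v $ j) *\<^sub>R axis j 1)" by simp
    also have "\<dots> = (\<Sum>j\<in>UNIV. (v $ j) *\<^sub>R frechet_derivative f (at x) (axis j 1))"
      using lin by (simp add: linear_sum linear_scale)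
    finally show "frechet_derivative f (at x) v = (\<Sum>j\<in>UNIV. of_real (v $ j) * partial j f x)"
      by (simp add: partial_def scaleR_conv_of_real)
  qed
  with D show ?thesis by simp
qed

lemma partial_cong:
  assumes "open S" "\<And>x. x \<in> S \<Longrightarrow> f x = g x" "x \<in> S"
  shows "partial i f x = partial i g x"
proof -
  have "(f has_derivative D) (at x) \<longleftrightarrow> (g has_derivative D) (at x)" for D
    using assms has_derivative_transform_within_open[of f D x UNIV S g]
      has_derivative_transform_within_open[of g D x UNIV S f] by auto
  then show ?thesis by (simp add: partial_def frechet_derivative_def)
qed

lemma partials_cong:
  assumes "open S" "\<And>x. x \<in> S \<Longrightarrow> f x = g x" "x \<in> S"
  shows "partials is f x = partials is g x"
  using assms(3)
proof (induction "is" arbitrary: x)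
  case (Cons i "is")
  then show ?case using partial_cong[OF assms(1), of "partials is f" "partials is g"] by simp
qed (use assms in auto)

lemma differentiable_onD_open: "f differentiable_on S \<Longrightarrow> open S \<Longrightarrow> x \<in> S \<Longrightarrow> f differentiable (at x)"
  by (metis differentiable_on_def at_within_open)

lemma differentiable_onI_open: "(\<And>x. x \<in> S \<Longrightarrow> f differentiable (at x)) \<Longrightarrow> f differentiable_on S"
  using differentiable_at_imp_differentiable_on by blast

lemma differentiable_on_congI:
  "f differentiable_on S \<Longrightarrow> (\<And>x. x \<in> S \<Longrightarrow> f x = g x) \<Longrightarrow> g differentiable_on S"
  unfolding differentiable_on_def differentiable_def by (metis has_derivative_transform)

text \<open>Unlike \<^const>\<open>partials\<close>, this recursion peels off the derivative taken first. The derivatives of a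
  product or a composite are then of the same shape as the original, so that closure
  properties are inductions on \<open>n\<close>.\<close>

primrec cdiff :: "nat \<Rightarrow> (real^'k::finite) set \<Rightarrow> (real^'k \<Rightarrow> complex) \<Rightarrow> bool" where
  "cdiff 0 S f \<longleftrightarrow> f differentiable_on S"
| "cdiff (Suc n) S f \<longleftrightarrow> f differentiable_on S \<and> (\<forall>i. cdiff n S (partial i f))"

lemma cdiff_iff_partials: "cdiff n S f \<longleftrightarrow> (\<forall>is. length is \<le> n \<longrightarrow> partials is f differentiable_on S)"
proof (induction n arbitrary: f)
  case (Suc n)
  have "(\<forall>is. length is \<le> Suc n \<longrightarrow> partials is f differentiable_on S) \<longleftrightarrow>
     f differentiable_on S \<and> (\<forall>is i. length is \<le> n \<longrightarrow> partials is (partial i f) differentiable_on S)"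
  proof (intro iffI conjI allI impI)
    fix "is" i assume *: "\<forall>is. length is \<le> Suc n \<longrightarrow> partials is f differentiable_on S" "length (is :: 'a list) \<le> n"
    show "partials is (partial i f) differentiable_on S"
      using *(1)[rule_format, of "is @ [i]"] *(2) by (simp add: partials_append)
  next
    assume "\<forall>is. length is \<le> Suc n \<longrightarrow> partials is f differentiable_on S"
    then show "f differentiable_on S" by (auto dest: spec[of _ "[]"])
  next
    fix "is" :: "'a list"
    assume *: "f differentiable_on S \<and> (\<forall>is i. length is \<le> n \<longrightarrow> partials is (partial i f) differentiable_on S)"
      "length is \<le> Suc n"
    then show "partials is f differentiable_on S"
      by (cases "is" rule: rev_cases) (auto simp: partials_append)
  qed
  then show ?case using Suc by auto
qed auto

lemma smooth_on_iff_cdiff: "smooth_on S f \<longleftrightarrow> (\<forall>n. cdiff n S f)"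
  unfolding smooth_on_def cdiff_iff_partials by blast

lemma cdiff_cong:
  assumes "open S" "\<And>x. x \<in> S \<Longrightarrow> f x = g x" "cdiff n S f"
  shows "cdiff n S g"
  using assms(2,3)
proof (induction n arbitrary: f g)
  case 0
  then show ?case using differentiable_on_congI[of f S g] by auto
next
  case (Suc n)
  have "cdiff n S (partial i g)" for i
    using Suc.IH[of "partial i f" "partial i g"] partial_cong[OF assms(1), of f g] Suc.prems by simp
  moreover have "g differentiable_on S" using Suc.prems differentiable_on_congI[of f S g] by auto
  ultimately show ?case by simp
qed

lemma cdiff_SucD: "cdiff (Suc n) S f \<Longrightarrow> cdiff n S f"
  by (induction n arbitrary: f) auto

lemma cdiff_SucI:
  assumes "open S" "\<And>x. x \<in> S \<Longrightarrow> (f has_derivative D x) (at x)"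
    and "\<And>i. cdiff n S (\<lambda>x. D x (axis i 1))"
  shows "cdiff (Suc n) S f"
proof -
  have "cdiff n S (partial i f)" for i
    by (rule cdiff_cong[OF assms(1) _ assms(3)[of i]]) (simp add: partial_eqI[OF assms(2)])
  moreover have "f differentiable_on S"
    using assms(2) by (meson differentiable_def differentiable_onI_open)
  ultimately show ?thesis by simp
qed

lemma cdiff_const [simp]: "cdiff n S (\<lambda>x. c)"
proof (induction n arbitrary: c)
  case (Suc n)
  have "partial i (\<lambda>x::real^'a. c) = (\<lambda>x. 0)" for i :: 'a
    by (rule ext, subst partial_eqI[OF has_derivative_const]) simp
  then show ?case using Suc by simp
qed auto

lemma cdiff_add:
  assumes "open S" "cdiff n S f" "cdiff n S g"
  shows "cdiff n S (\<lambda>x. f x + g x)"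
  using assms(2,3)
proof (induction n arbitrary: f g)
  case (Suc n)
  show ?case
  proof (rule cdiff_SucI[OF assms(1)])
    fix x assume "x \<in> S"
    with Suc.prems assms(1) show "((\<lambda>x. f x + g x) has_derivative
      (\<lambda>v. (\<Sum>j\<in>UNIV. of_real (v $ j) * partial j f x) + (\<Sum>j\<in>UNIV. of_real (v $ j) * partial j g x))) (at x)"
      by (intro has_derivative_add has_derivative_partial) (auto dest: differentiable_onD_open)
  next
    fix i
    show "cdiff n S (\<lambda>x. (\<Sum>j\<in>UNIV. of_real (axis i 1 $ j) * partial j f x) + (\<Sum>j\<in>UNIV. of_real (axis i 1 $ j) * partial j g x))"
      using Suc.IH[of "partial i f" "partial i g"] Suc.prems
      by (simp add: axis_def if_distrib[of of_real] if_distrib[of "\<lambda>z. z * _"] cong: if_cong)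
  qed
qed auto

lemma cdiff_mult:
  assumes "open S" "cdiff n S f" "cdiff n S g"
  shows "cdiff n S (\<lambda>x. f x * g x)"
  using assms(2,3)
proof (induction n arbitrary: f g)
  case (Suc n)
  show ?case
  proof (rule cdiff_SucI[OF assms(1)])
    fix x assume "x \<in> S"
    with Suc.prems assms(1) show "((\<lambda>x. f x * g x) has_derivative
      (\<lambda>v. f x * (\<Sum>j\<in>UNIV. of_real (v $ j) * partial j g x) + (\<Sum>j\<in>UNIV. of_real (v $ j) * partial j f x) * g x)) (at x)"
      by (intro has_derivative_mult has_derivative_partial) (auto dest: differentiable_onD_open)
  next
    fix i
    have "cdiff n S (\<lambda>x. f x * partial i g x + partial i f x * g x)"
      using Suc.prems cdiff_SucD[OF Suc.prems(1)] cdiff_SucD[OF Suc.prems(2)]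
      by (intro cdiff_add assms(1) Suc.IH) auto
    then show "cdiff n S (\<lambda>x. f x * (\<Sum>j\<in>UNIV. of_real (axis i 1 $ j) * partial j g x) + (\<Sum>j\<in>UNIV. of_real (axis i 1 $ j) * partial j f x) * g x)"
      by (simp add: axis_def if_distrib[of of_real] if_distrib[of "\<lambda>z. z * _"] cong: if_cong)
  qed
qed (auto intro: differentiable_on_mult)

lemma smooth_on_const [simp, intro]: "smooth_on S (\<lambda>x. c)"
  by (simp add: smooth_on_iff_cdiff)

lemma smooth_on_add: "open S \<Longrightarrow> smooth_on S f \<Longrightarrow> smooth_on S g \<Longrightarrow> smooth_on S (\<lambda>x. f x + g x)"
  by (simp add: smooth_on_iff_cdiff cdiff_add)

lemma smooth_on_mult: "open S \<Longrightarrow> smooth_on S f \<Longrightarrow> smooth_on S g \<Longrightarrow> smooth_on S (\<lambda>x. f x * g x)"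
  by (simp add: smooth_on_iff_cdiff cdiff_mult)

lemma smooth_on_cmult: "open S \<Longrightarrow> smooth_on S f \<Longrightarrow> smooth_on S (\<lambda>x. c * f x)"
  by (rule smooth_on_mult) auto

lemma smooth_on_diff: "open S \<Longrightarrow> smooth_on S f \<Longrightarrow> smooth_on S g \<Longrightarrow> smooth_on S (\<lambda>x. f x - g x)"
  using smooth_on_add[of S f "\<lambda>x. - 1 * g x"] smooth_on_cmult[of S g "- 1"] by simp

lemma smooth_on_sum:
  "open S \<Longrightarrow> (\<And>a. a \<in> A \<Longrightarrow> smooth_on S (f a)) \<Longrightarrow> smooth_on S (\<lambda>x. \<Sum>a\<in>A. f a x)"
  by (induction A rule: infinite_finite_induct) (auto intro: smooth_on_add)

lemma smooth_on_prod_list: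
  "open S \<Longrightarrow> (\<And>a. a \<in> set A \<Longrightarrow> smooth_on S (f a)) \<Longrightarrow> smooth_on S (\<lambda>x. prod_list (map (\<lambda>a. f a x) A))"
  by (induction A) (auto intro: smooth_on_mult)

lemma smooth_on_cong:
  "open S \<Longrightarrow> (\<And>x. x \<in> S \<Longrightarrow> f x = g x) \<Longrightarrow> smooth_on S f \<Longrightarrow> smooth_on S g"
  unfolding smooth_on_iff_cdiff using cdiff_cong by blast

lemma smooth_on_subset: "smooth_on S f \<Longrightarrow> T \<subseteq> S \<Longrightarrow> smooth_on T f"
  unfolding smooth_on_def using differentiable_on_subset by blast

lemma smooth_on_Un: "open S \<Longrightarrow> open T \<Longrightarrow> smooth_on S f \<Longrightarrow> smooth_on T f \<Longrightarrow> smooth_on (S \<union> T) f"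
  unfolding smooth_on_def
  by (metis Un_iff differentiable_onD_open differentiable_onI_open)

lemma smooth_on_partials: "smooth_on S f \<Longrightarrow> smooth_on S (partials is f)"
  unfolding smooth_on_def by (metis partials_append)

lemma smooth_on_partial: "smooth_on S f \<Longrightarrow> smooth_on S (partial i f)"
  using smooth_on_partials[of S f "[i]"] by simp

lemma smooth_onD: "smooth_on S f \<Longrightarrow> open S \<Longrightarrow> x \<in> S \<Longrightarrow> partials is f differentiable (at x)"
  unfolding smooth_on_def using differentiable_onD_open by blast

lemma smooth_on_differentiable: "smooth_on S f \<Longrightarrow> open S \<Longrightarrow> x \<in> S \<Longrightarrow> f differentiable (at x)"
  using smooth_onD[of S f x "[]"] by simp

lemma smooth_on_imp_continuous_on: "smooth_on S f \<Longrightarrow> continuous_on S f"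
  unfolding smooth_on_def by (metis differentiable_imp_continuous_on partials_Nil)

lemma partial_add:
  assumes "f differentiable (at x)" "g differentiable (at x)"
  shows "partial i (\<lambda>x. f x + g x) x = partial i f x + partial i g x"
  by (subst partial_eqI[OF has_derivative_add[OF assms[unfolded frechet_derivative_works]]])
    (simp add: partial_def)

lemma partial_mult:
  assumes "f differentiable (at x)" "g differentiable (at x)"
  shows "partial i (\<lambda>x. f x * g x) x = f x * partial i g x + partial i f x * g x"
  by (subst partial_eqI[OF has_derivative_mult[OF assms[unfolded frechet_derivative_works]]])
    (simp add: partial_def)

lemma partials_add:
  assumes "open S" "smooth_on S f" "smooth_on S g" "x \<in> S"
  shows "partials is (\<lambda>x. f x + g x) x = partials is f x + partials is g x"
  using assms(4)
proof (induction "is" arbitrary: x)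
  case (Cons i "is")
  have "partial i (partials is (\<lambda>x. f x + g x)) x = partial i (\<lambda>x. partials is f x + partials is g x) x"
    using partial_cong[OF assms(1) Cons.IH Cons.prems] by simp
  also have "\<dots> = partial i (partials is f) x + partial i (partials is g) x"
    using assms Cons.prems by (intro partial_add smooth_onD)
  finally show ?case by simp
qed simp

lemma partials_cmult:
  assumes "open S" "smooth_on S f" "x \<in> S"
  shows "partials is (\<lambda>x. c * f x) x = c * partials is f x"
  using assms(3)
proof (induction "is" arbitrary: x)
  case (Cons i "is")
  have "partial i (partials is (\<lambda>x. c * f x)) x = partial i (\<lambda>x. c * partials is f x) x"
    using partial_cong[OF assms(1) Cons.IH Cons.prems] by simp
  also have "\<dots> = c * partial i (partials is f) x"
    using assms Cons.prems
    by (subst partial_mult) (auto intro: smooth_onD simp: partial_eqI[OF has_derivative_const])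
  finally show ?case by simp
qed simp

lemma partials_diff:
  assumes "open S" "smooth_on S f" "smooth_on S g" "x \<in> S"
  shows "partials is (\<lambda>x. f x - g x) x = partials is f x - partials is g x"
  using partials_add[of S f "\<lambda>x. -1 * g x"] partials_cmult[of S g x "is" "-1"] smooth_on_cmult[of S g "-1"] assms
  by simp

lemma partials_zero [simp]: "partials is (\<lambda>x. 0) = (\<lambda>x. 0)"
proof (induction "is")
  case (Cons a "is")
  show ?case by (rule ext) (simp add: Cons.IH partial_eqI[OF has_derivative_const])
qed simp

lemma partials_const: "partials is (\<lambda>x. c) x = (if is = [] then c else 0)"
  by (cases "is" rule: rev_cases) (auto simp: partials_append partial_eqI[OF has_derivative_const, abs_def])

lemma partials_sum:
  assumes "open S" "\<And>a. a \<in> A \<Longrightarrow> smooth_on S (f a)" "x \<in> S"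
  shows "partials is (\<lambda>x. \<Sum>a\<in>A. f a x) x = (\<Sum>a\<in>A. partials is (f a) x)"
  using assms(2)
proof (induction A rule: infinite_finite_induct)
  case (insert a A)
  then show ?case
    by (simp add: partials_add[OF assms(1) _ _ assms(3)] smooth_on_sum[OF assms(1)])
qed auto

lemma has_derivative_affine:
  assumes "(f has_derivative D) (at (a *\<^sub>R x + b))"
  shows "((\<lambda>x. f (a *\<^sub>R x + b)) has_derivative (\<lambda>v. D (a *\<^sub>R v))) (at x)"
  by (rule has_derivative_compose[where g = f and f = "\<lambda>x. a *\<^sub>R x + b", OF _ assms]) (auto intro!: derivative_eq_intros)

lemma smooth_on_affine:
  fixes f :: "real^'k::finite \<Rightarrow> complex"
  assumes "smooth_on UNIV f"
  shows "smooth_on UNIV (\<lambda>x. f (a *\<^sub>R x + b))"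
proof -
  have "cdiff n UNIV (\<lambda>x. f (a *\<^sub>R x + b))" if "smooth_on UNIV f" for n and f :: "real^'k \<Rightarrow> complex"
    using that
  proof (induction n arbitrary: f)
    case 0
    have "(\<lambda>x. f (a *\<^sub>R x + b)) differentiable (at x)" for x
      using has_derivative_affine[OF has_derivative_partial[OF smooth_on_differentiable[OF 0]]]
        differentiable_def by blast
    then show ?case by (simp add: differentiable_onI_open)
  next
    case (Suc n)
    show ?case
    proof (rule cdiff_SucI)
      fix x
      show "((\<lambda>x. f (a *\<^sub>R x + b)) has_derivative
        (\<lambda>v. \<Sum>j\<in>UNIV. of_real ((a *\<^sub>R v) $ j) * partial j f (a *\<^sub>R x + b))) (at x)"
        by (rule has_derivative_affine[OF has_derivative_partial[OF smooth_on_differentiable[OF Suc.prems]]]) auto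
    next
      fix i
      have "cdiff n UNIV (\<lambda>x. of_real a * partial i f (a *\<^sub>R x + b))"
        by (intro cdiff_mult cdiff_const open_UNIV Suc.IH smooth_on_partial Suc.prems)
      then show "cdiff n UNIV (\<lambda>x. \<Sum>j\<in>UNIV. of_real ((a *\<^sub>R axis i 1) $ j) * partial j f (a *\<^sub>R x + b))"
        by (simp add: axis_def if_distrib[of of_real] if_distrib[of "(*) a"] if_distrib[of "\<lambda>z. z * _"] cong: if_cong)
    qed auto
  qed
  with assms show ?thesis by (simp add: smooth_on_iff_cdiff)
qed

lemma partial_affine:
  assumes "f differentiable (at (a *\<^sub>R x + b))"
  shows "partial i (\<lambda>x. f (a *\<^sub>R x + b)) x = of_real a * partial i f (a *\<^sub>R x + b)"
  by (subst partial_eqI[OF has_derivative_affine[OF has_derivative_partial[OF assms]]])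
    (simp add: axis_def if_distrib[of of_real] if_distrib[of "(*) a"] if_distrib[of "\<lambda>z. z * _"] cong: if_cong)

lemma partials_affine:
  fixes f :: "real^'k::finite \<Rightarrow> complex"
  assumes "smooth_on UNIV f"
  shows "partials is (\<lambda>x. f (a *\<^sub>R x + b)) x = of_real a ^ length is * partials is f (a *\<^sub>R x + b)"
proof (induction "is" arbitrary: x)
  case (Cons i "is")
  have sm: "smooth_on UNIV (\<lambda>x. partials is f (a *\<^sub>R x + b))"
    by (intro smooth_on_affine smooth_on_partials assms)
  have "partial i (partials is (\<lambda>x. f (a *\<^sub>R x + b))) x
      = partial i (\<lambda>x. of_real a ^ length is * partials is f (a *\<^sub>R x + b)) x"
    by (rule arg_cong[where f = "\<lambda>h. partial i h x"]) (rule ext, rule Cons.IH)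
  also have "\<dots> = of_real a ^ length is * partial i (\<lambda>x. partials is f (a *\<^sub>R x + b)) x"
    using partials_cmult[OF open_UNIV sm, of x "[i]"] by simp
  also have "partial i (\<lambda>x. partials is f (a *\<^sub>R x + b)) x = of_real a * partial i (partials is f) (a *\<^sub>R x + b)"
    by (intro partial_affine smooth_onD[OF assms]) auto
  finally show ?case by simp
qed simp

lemma smooth_on_scaleR: "smooth_on UNIV f \<Longrightarrow> smooth_on UNIV (\<lambda>x. f (a *\<^sub>R x))"
  using smooth_on_affine[of f a 0] by simp

lemma partials_scaleR:
  "smooth_on UNIV f \<Longrightarrow> partials is (\<lambda>x. f (a *\<^sub>R x)) x = of_real a ^ length is * partials is f (a *\<^sub>R x)"
  using partials_affine[of f "is" a 0] by simp

lemma smooth_on_coord: "smooth_on S (\<lambda>x. of_real (x $ j))"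
  if S: "open S" for S :: "(real^'k::finite) set"
proof -
  have "cdiff n S (\<lambda>x. of_real (x $ j))" for n
  proof (rule cdiff_SucD, rule cdiff_SucI[OF S])
    show "((\<lambda>x. of_real (x $ j)) has_derivative (\<lambda>v. of_real (v $ j))) (at x)" for x :: "real^'k"
      by (intro has_derivative_of_real bounded_linear.has_derivative[OF bounded_linear_vec_nth] has_derivative_ident)
  qed simp
  then show ?thesis by (simp add: smooth_on_iff_cdiff)
qed

lemma smooth_on_inverse:
  assumes S: "open S" and f: "smooth_on S f" and nz: "\<And>x. x \<in> S \<Longrightarrow> f x \<noteq> 0"
  shows "smooth_on S (\<lambda>x. inverse (f x))"
proof -
  have "cdiff n S (\<lambda>x. inverse (f x))" for n
  proof (induction n)
    case 0
    then show ?case using f nz S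
      by (auto intro!: differentiable_onI_open differentiable_inverse smooth_on_differentiable)
  next
    case (Suc n)
    show ?case
    proof (rule cdiff_SucI[OF S])
      fix x assume "x \<in> S"
      with f nz S show "((\<lambda>x. inverse (f x)) has_derivative
        (\<lambda>v. - (inverse (f x) * (\<Sum>j\<in>UNIV. of_real (v $ j) * partial j f x) * inverse (f x)))) (at x)"
        by (intro Deriv.has_derivative_inverse has_derivative_partial smooth_on_differentiable)
    next
      fix i
      have "cdiff n S (\<lambda>x. -1 * (inverse (f x) * partial i f x * inverse (f x)))"
        using f smooth_on_iff_cdiff smooth_on_partial
        by (intro cdiff_mult S Suc.IH cdiff_const) blast
      then show "cdiff n S (\<lambda>x. - (inverse (f x) * (\<Sum>j\<in>UNIV. of_real (axis i 1 $ j) * partial j f x) * inverse (f x)))"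
        by (simp add: axis_def if_distrib[of of_real] if_distrib[of "\<lambda>z. z * _"] cong: if_cong)
    qed
  qed
  then show ?thesis by (simp add: smooth_on_iff_cdiff)
qed

text \<open>Each derivative doubles the number of terms in the Leibniz rule; the single bound for all
  derivatives of lower order keeps the multi-indices out of the estimate.\<close>

lemma norm_partials_mult_le:
  assumes "smooth_on UNIV f" "smooth_on UNIV g"
    and "\<And>js. length js \<le> length is \<Longrightarrow> norm (partials js f x) \<le> A"
    and "\<And>js. length js \<le> length is \<Longrightarrow> norm (partials js g x) \<le> B"
  shows "norm (partials is (\<lambda>x. f x * g x) x) \<le> 2 ^ length is * (A * B)"
  using assms
proof (induction "is" arbitrary: f g rule: rev_induct)
  case Nil
  from Nil(3,4)[of "[]"] show ?case by (simp add: norm_mult mult_mono')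
next
  case (snoc i "is")
  have pm: "partial i (\<lambda>x. f x * g x) = (\<lambda>x. f x * partial i g x + partial i f x * g x)"
    using snoc.prems by (intro ext partial_mult smooth_on_differentiable) auto
  have sm: "smooth_on UNIV (partial i f)" "smooth_on UNIV (partial i g)"
    using snoc.prems smooth_on_partial by auto
  have *: "norm (partials js (partial i f) x) \<le> A" "norm (partials js (partial i g) x) \<le> B"
    if "length js \<le> length is" for js
    using snoc.prems(3)[of "js @ [i]"] snoc.prems(4)[of "js @ [i]"] that by (auto simp: partials_append)
  have "norm (partials is (\<lambda>x. f x * partial i g x) x) \<le> 2 ^ length is * (A * B)"
    by (rule snoc.IH) (use snoc.prems sm * in auto)
  moreover have "norm (partials is (\<lambda>x. partial i f x * g x) x) \<le> 2 ^ length is * (A * B)"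
    by (rule snoc.IH) (use snoc.prems sm * in auto)
  moreover have "partials (is @ [i]) (\<lambda>x. f x * g x) x
     = partials is (\<lambda>x. f x * partial i g x) x + partials is (\<lambda>x. partial i f x * g x) x"
    using snoc.prems sm
    by (simp add: partials_append pm partials_add[OF open_UNIV] smooth_on_mult)
  ultimately show ?case
    using norm_triangle_ineq[of "partials is (\<lambda>x. f x * partial i g x) x" "partials is (\<lambda>x. partial i f x * g x) x"]
    by simp
qed

section \<open>The characters and their derivatives\<close>

lemma psi_0_left [simp]: "psi 0 y = 1"
  and psi_0_right [simp]: "psi x 0 = 1"
  by (simp_all add: psi_def)

lemma psi_commute: "psi x y = psi y x"
  by (simp add: psi_def inner_commute)

lemma norm_psi [simp]: "norm (psi x y) = 1"
  by (simp add: psi_def norm_exp_eq_Re)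

lemma psi_add_right: "psi x (y + z) = psi x y * psi x z"
  by (simp add: psi_def inner_add_right algebra_simps flip: exp_add)

lemma psi_add_left: "psi (x + y) z = psi x z * psi y z"
  by (simp add: psi_def inner_add_left algebra_simps flip: exp_add)

lemma psi_scaleR_left: "psi (a *\<^sub>R x) y = psi x (a *\<^sub>R y)"
  by (simp add: psi_def)

lemma psi_minus: "psi (- x) y = psi x (- y)"
  by (simp add: psi_def)

lemma continuous_on_psi [continuous_intros]:
  "continuous_on S f \<Longrightarrow> continuous_on S g \<Longrightarrow> continuous_on S (\<lambda>x. psi (f x) (g x))"
  unfolding psi_def by (intro continuous_intros)

lemma norm_psi_increment_le:
  "norm (psi x (y + v) - psi x y - 2 * of_real pi * \<i> * of_real (x \<bullet> v) * psi x y)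
     \<le> (2 * pi)\<^sup>2 * (norm x)\<^sup>2 * (norm v)\<^sup>2"
proof -
  let ?z = "2 * of_real pi * \<i> * of_real (x \<bullet> v) :: complex"
  have "norm (exp ?z - (1 + ?z)) \<le> norm ?z ^ 2"
    using Taylor_exp[of ?z 1] by (simp add: power2_eq_square)
  also have "norm ?z = 2 * pi * \<bar>x \<bullet> v\<bar>" by (simp add: norm_mult)
  also have "\<dots> ^ 2 \<le> (2 * pi * (norm x * norm v)) ^ 2"
    by (intro power_mono mult_left_mono Cauchy_Schwarz_ineq2) auto
  finally have *: "norm (exp ?z - (1 + ?z)) \<le> (2 * pi)\<^sup>2 * (norm x)\<^sup>2 * (norm v)\<^sup>2"
    by (simp add: power_mult_distrib)
  have "psi x (y + v) - psi x y - ?z * psi x y = psi x y * (exp ?z - (1 + ?z))"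
    unfolding psi_add_right by (simp add: psi_def[of x v] algebra_simps)
  then show ?thesis using * by (simp add: norm_mult)
qed

text \<open>Characters have an explicit quadratic remainder that is uniform in \<open>y\<close>. Integrating it
  differentiates Fourier transforms, so no theorem on differentiation under the integral is needed.\<close>

lemma has_derivative_if_quadratic:
  fixes F :: "'a::real_normed_vector \<Rightarrow> 'b::real_normed_vector"
  assumes L: "bounded_linear L" and C: "\<And>v. norm (F (y + v) - F y - L v) \<le> C * (norm v)\<^sup>2"
  shows "(F has_derivative L) (at y)"
proof -
  have C0: "0 \<le> C" if "v \<noteq> 0" for v :: 'a
  proof -
    have "0 \<le> C * (norm v)\<^sup>2" using C[of v] norm_ge_zero order_trans by blast
    with that show ?thesis by (simp add: zero_le_mult_iff)
  qed
  have lim: "((\<lambda>v. C * norm v) \<longlongrightarrow> 0) (at 0)"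
    by (auto intro!: tendsto_eq_intros)
  have "((\<lambda>v. norm (F (y + v) - F y - L v) / norm v) \<longlongrightarrow> 0) (at 0)"
  proof (rule tendsto_sandwich[OF _ _ tendsto_const lim])
    show "\<forall>\<^sub>F v in at 0. norm (F (y + v) - F y - L v) / norm v \<le> C * norm v"
    proof (intro always_eventually allI)
      fix v show "norm (F (y + v) - F y - L v) / norm v \<le> C * norm v"
        using C[of v] C0[of v] by (cases "v = 0") (simp_all add: divide_le_eq power2_eq_square mult.assoc)
    qed
  qed (auto intro!: always_eventually)
  then show ?thesis using L by (simp add: has_derivative_at)
qed

text \<open>The factor produced by differentiating a character; multiplication by it is what
  differentiation becomes for Fourier transforms and for lattice sums alike.\<close>

definition weight :: "'k::finite list \<Rightarrow> real^'k \<Rightarrow> complex" where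
  "weight is x = prod_list (map (\<lambda>j. 2 * of_real pi * \<i> * of_real (x $ j)) is)"

lemma weight_Nil [simp]: "weight [] x = 1"
  and weight_Cons: "weight (j # is) x = 2 * of_real pi * \<i> * of_real (x $ j) * weight is x"
  by (simp_all add: weight_def)

lemma weight_scaleR: "weight is (a *\<^sub>R x) = of_real a ^ length is * weight is x"
  by (induction "is") (simp_all add: weight_Cons)

lemma smooth_on_weight: "open S \<Longrightarrow> smooth_on S (weight is)"
  unfolding weight_def[abs_def]
  by (intro smooth_on_prod_list smooth_on_mult smooth_on_coord) auto

lemma has_derivative_psi:
  "((\<lambda>y. psi x y) has_derivative (\<lambda>v. 2 * of_real pi * \<i> * of_real (x \<bullet> v) * psi x y)) (at y)"
  by (rule has_derivative_if_quadratic[OF _ norm_psi_increment_le])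
    (intro bounded_linear_mult_const bounded_linear_const_mult bounded_linear_of_real[THEN bounded_linear_compose] bounded_linear_inner_right)

lemma partial_psi: "partial j (psi x) y = 2 * of_real pi * \<i> * of_real (x $ j) * psi x y"
  by (subst partial_eqI[OF has_derivative_psi]) (simp add: inner_axis)

lemma smooth_on_psi: "smooth_on UNIV (psi x)"
proof -
  have "cdiff n UNIV (psi x)" for n
  proof (induction n)
    case 0
    then show ?case by simp (meson differentiable_def differentiable_onI_open has_derivative_psi)
  next
    case (Suc n)
    show ?case
    proof (rule cdiff_SucI[OF open_UNIV has_derivative_psi])
      fix i show "cdiff n UNIV (\<lambda>y. 2 * of_real pi * \<i> * of_real (x \<bullet> axis i 1) * psi x y)"
        by (rule cdiff_mult[OF open_UNIV cdiff_const Suc.IH])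
    qed
  qed
  then show ?thesis by (simp add: smooth_on_iff_cdiff)
qed

lemma partials_psi: "partials is (psi x) y = weight is x * psi x y"
proof (induction "is" arbitrary: y)
  case (Cons i "is")
  have "partials is (psi x) = (\<lambda>y. weight is x * psi x y)" using Cons by blast
  then show ?case
    using partials_cmult[OF open_UNIV smooth_on_psi, of y "[i]" "weight is x" x]
    by (simp add: weight_Cons partial_psi)
qed simp

section \<open>Series of smooth functions\<close>

text \<open>Termwise differentiation, by induction on the multi-index: the Weierstrass bounds for the next
  order of derivatives make the differentiated series converge uniformly near \<open>x\<close>.\<close>

lemma series_partials:
  fixes f :: "nat \<Rightarrow> real^'k::finite \<Rightarrow> complex"
  assumes S: "open S" and sm: "\<And>i. smooth_on S (f i)"
    and bd: "\<And>is x. x \<in> S \<Longrightarrow> \<exists>e>0. \<exists>B. summable B \<and> (\<forall>i. \<forall>y\<in>ball x e \<inter> S. norm (partials is (f i) y) \<le> B i)"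
    and x: "x \<in> S"
  shows "partials is (\<lambda>y. \<Sum>i. f i y) x = (\<Sum>i. partials is (f i) x)
     \<and> partials is (\<lambda>y. \<Sum>i. f i y) differentiable (at x)"
  using x
proof (induction "is" arbitrary: x)
  have deriv: "((\<lambda>y. \<Sum>i. partials is (f i) y) has_derivative
      (\<lambda>v. \<Sum>j\<in>UNIV. of_real (v $ j) * (\<Sum>i. partials (j # is) (f i) x))) (at x)" if x: "x \<in> S" for "is" x
  proof -
    have "\<exists>e B. e > 0 \<and> summable B \<and> (\<forall>i. \<forall>y\<in>ball x e \<inter> S. norm (partials js (f i) y) \<le> B i)" for js
      using bd[OF x, of js] by blast
    then obtain e B where eB: "\<And>js. e js > 0" "\<And>js. summable (B js)"
      "\<And>js i y. y \<in> ball x (e js) \<inter> S \<Longrightarrow> norm (partials js (f i) y) \<le> B js i" by metis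
    obtain e0 where e0: "e0 > 0" "ball x e0 \<subseteq> S" using S x openE by blast
    define d where "d = Min (insert e0 (insert (e is) ((\<lambda>j. e (j # is)) ` UNIV)))"
    have d: "d > 0" unfolding d_def using eB(1) e0 by (auto simp: Min_gr_iff)
    have d: "d > 0" "d \<le> e0" "d \<le> e is" "\<And>j. d \<le> e (j # is)"
      by (fact d, (unfold d_def, (rule Min_le; simp)+))
    have bdis: "norm (partials is (f i) y) \<le> B is i" "\<And>j. norm (partials (j # is) (f i) y) \<le> B (j # is) i"
      and yS: "y \<in> S" if "y \<in> ball x d" for i y
    proof -
      have dy: "dist x y < d" using that by simp
      then have "y \<in> ball x e0" using d(2) by simp
      with e0(2) show y: "y \<in> S" by blast
      show "norm (partials is (f i) y) \<le> B is i"
        by (rule eB(3)) (use dy d(3) y in auto)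
      show "norm (partials (j # is) (f i) y) \<le> B (j # is) i" for j
        by (rule eB(3)) (use dy d(4)[of j] y in auto)
    qed
    have summ: "summable (\<lambda>i. partials js (f i) y)" if "y \<in> ball x d" "js = is \<or> (\<exists>j. js = j # is)" for js y
    proof (rule summable_comparison_test'[OF eB(2)])
      show "norm (partials js (f i) y) \<le> B js i" for i
        using that(2) bdis(1)[OF that(1), of i] bdis(2)[OF that(1), of _ i] by metis
    qed
    define g' where "g' = (\<lambda>y v. \<Sum>j\<in>UNIV. of_real (v $ j) * (\<Sum>i. partials (j # is) (f i) y))"
    define f' where "f' = (\<lambda>i y v. \<Sum>j\<in>UNIV. of_real (v $ j) * partials (j # is) (f i) y)"
    have "\<exists>g. \<forall>y\<in>ball x d. (\<lambda>n. partials is (f n) y) sums (g y) \<and> (g has_derivative g' y) (at y within ball x d)"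
    proof (rule has_derivative_series)
      show "convex (ball x d)" by simp
      show "x \<in> ball x d" using d by simp
      show "(\<lambda>n. partials is (f n) x) sums (\<Sum>n. partials is (f n) x)"
        using summ d by (simp add: summable_sums)
      show "((partials is (f n)) has_derivative f' n y) (at y within ball x d)" if "y \<in> ball x d" for n y
        unfolding f'_def
        using has_derivative_partial[OF smooth_onD[OF sm[of n] S yS[OF that]]]
        by (simp add: has_derivative_at_withinI)
    next
      fix r :: real assume r: "r > 0"
      define K where "K = real CARD('k)"
      have K: "K > 0" by (simp add: K_def)
      have "(\<lambda>n. \<Sum>i. B (j # is) (i + n)) \<longlonglongrightarrow> 0" for j
        by (rule suminf_exist_split2[OF eB(2)])
      then have "\<forall>\<^sub>F n in sequentially. norm (\<Sum>i. B (j # is) (i + n)) < r / K" for j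
        using r K by (auto simp: tendsto_iff dist_norm)
      then have "\<forall>\<^sub>F n in sequentially. \<forall>j. norm (\<Sum>i. B (j # is) (i + n)) < r / K"
        by (simp add: eventually_all_finite)
      then show "\<forall>\<^sub>F n in sequentially. \<forall>y\<in>ball x d. \<forall>h. norm ((\<Sum>i<n. f' i y h) - g' y h) \<le> r * norm h"
      proof eventually_elim
        case (elim n)
        show ?case
        proof (intro ballI allI)
          fix y h assume y: "y \<in> ball x d"
          have tail: "norm ((\<Sum>i<n. partials (j # is) (f i) y) - (\<Sum>i. partials (j # is) (f i) y)) \<le> r / K" for j
          proof -
            have s1: "summable (\<lambda>i. B (j # is) (i + n))" using eB(2) by (simp add: summable_iff_shift)
            have "(\<Sum>i<n. partials (j # is) (f i) y) - (\<Sum>i. partials (j # is) (f i) y)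
               = - (\<Sum>i. partials (j # is) (f (i + n)) y)"
              using suminf_split_initial_segment[OF summ[OF y], of "j # is" n] by simp
            also have "norm \<dots> \<le> (\<Sum>i. B (j # is) (i + n))"
              unfolding norm_minus_cancel using bdis[OF y] by (intro norm_suminf_le[OF _ s1]) auto
            also have "\<dots> \<le> r / K" using elim[rule_format, of j] by simp
            finally show ?thesis .
          qed
          have "(\<Sum>i<n. f' i y h) - g' y h
             = (\<Sum>j\<in>UNIV. of_real (h $ j) * ((\<Sum>i<n. partials (j # is) (f i) y) - (\<Sum>i. partials (j # is) (f i) y)))"
            unfolding f'_def g'_def
            by (subst sum.swap) (simp add: sum_subtractf right_diff_distrib sum_distrib_left)
          also have "norm \<dots> \<le> (\<Sum>j\<in>(UNIV::'k set). norm h * (r / K))"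
          proof (rule sum_norm_le)
            fix j show "norm (of_real (h $ j) * ((\<Sum>i<n. partials (j # is) (f i) y) - (\<Sum>i. partials (j # is) (f i) y))) \<le> norm h * (r / K)"
              unfolding norm_mult norm_of_real
              by (intro mult_mono tail) (auto simp: component_le_norm_cart)
          qed
          also have "\<dots> = r * norm h" using K by (simp add: K_def)
          finally show "norm ((\<Sum>i<n. f' i y h) - g' y h) \<le> r * norm h" .
        qed
      qed
    qed
    then obtain g where g: "\<And>y. y \<in> ball x d \<Longrightarrow> (\<lambda>n. partials is (f n) y) sums (g y)"
      "\<And>y. y \<in> ball x d \<Longrightarrow> (g has_derivative g' y) (at y within ball x d)" by blast
    have "(g has_derivative g' x) (at x)"
      using g(2)[of x] d at_within_open[of x "ball x d"] by simp
    then have "((\<lambda>y. \<Sum>i. partials is (f i) y) has_derivative g' x) (at x)"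
      by (rule has_derivative_transform_within_open[where s = "ball x d"])
        (use d g(1) in \<open>auto simp: sums_iff\<close>)
    then show ?thesis by (simp add: g'_def)
  qed
  case Nil
  then show ?case using deriv[OF Nil, of "[]"] by (auto simp: differentiable_def)
  case (Cons i "is")
  have eq: "\<And>y. y \<in> S \<Longrightarrow> partials is (\<lambda>y. \<Sum>i. f i y) y = (\<Sum>i. partials is (f i) y)"
    using Cons.IH by blast
  have part: "partials (i # is) (\<lambda>y. \<Sum>i. f i y) y = (\<Sum>n. partials (i # is) (f n) y)" if "y \<in> S" for y
  proof -
    have "partials (i # is) (\<lambda>y. \<Sum>i. f i y) y = partial i (\<lambda>y. \<Sum>i. partials is (f i) y) y"
      using partial_cong[OF S eq that] by simp
    also have "\<dots> = (\<Sum>n. partials (i # is) (f n) y)"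
      by (subst partial_eqI[OF deriv[OF that]])
        (simp add: axis_def if_distrib[of of_real] if_distrib[of "\<lambda>z. z * _"] cong: if_cong)
    finally show ?thesis .
  qed
  obtain D where "((\<lambda>y. \<Sum>n. partials (i # is) (f n) y) has_derivative D) (at x)"
    using deriv[OF Cons.prems] by blast
  then have "(partials (i # is) (\<lambda>y. \<Sum>i. f i y) has_derivative D) (at x)"
    by (rule has_derivative_transform_within_open[OF _ S Cons.prems]) (simp only: part)
  then have "partials (i # is) (\<lambda>y. \<Sum>i. f i y) differentiable (at x)"
    unfolding differentiable_def by blast
  with part Cons.prems show ?case by blast
qed

lemma smooth_on_suminf:
  fixes f :: "nat \<Rightarrow> real^'k::finite \<Rightarrow> complex"
  assumes "open S" "\<And>i. smooth_on S (f i)"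
    and "\<And>is x. x \<in> S \<Longrightarrow> \<exists>e>0. \<exists>B. summable B \<and> (\<forall>i. \<forall>y\<in>ball x e \<inter> S. norm (partials is (f i) y) \<le> B i)"
  shows "smooth_on S (\<lambda>x. \<Sum>i. f i x)"
  unfolding smooth_on_def using series_partials[OF assms] differentiable_onI_open by blast

section \<open>Cutoff functions\<close>

text \<open>The functions \<open>t\<^sup>-\<^sup>p exp(-1/t)\<close>, continued by \<open>0\<close>. All \<open>p\<close> are needed at once because
  the derivative of one member of the family is a combination of two others.\<close>

definition flat :: "nat \<Rightarrow> real \<Rightarrow> real" where
  "flat p t = (if t > 0 then exp (- inverse t) * inverse t ^ p else 0)"

text \<open>Near \<open>0\<close> the exponential series gives \<open>exp(1/t) \<ge> t\<^sup>-\<^sup>(\<^sup>p\<^sup>+\<^sup>2\<^sup>) / (p+2)!\<close>.\<close>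

lemma flat_le: "\<bar>flat p t\<bar> \<le> fact (p + 2) * t\<^sup>2"
proof (cases "t > 0")
  case True
  let ?u = "inverse t"
  have u: "?u > 0" using True by simp
  have "?u ^ n /\<^sub>R fact n \<le> exp ?u" for n
    unfolding exp_def using u sum_le_suminf[OF summable_exp_generic, of "{n}" ?u] by auto
  moreover have "a \<le> b * c" if "a /\<^sub>R b \<le> c" "b > 0" for a b c :: real
    using that by (simp add: field_simps)
  ultimately have "?u ^ (p + 2) \<le> fact (p + 2) * exp ?u"
    using fact_gt_zero by blast
  then have "?u ^ p * ?u\<^sup>2 \<le> fact (p + 2) * exp ?u" by (simp only: power_add)
  then have "(?u ^ p * ?u\<^sup>2) * (t\<^sup>2 * exp (- ?u)) \<le> (fact (p + 2) * exp ?u) * (t\<^sup>2 * exp (- ?u))"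
    by (intro mult_right_mono) auto
  moreover have "(?u ^ p * ?u\<^sup>2) * (t\<^sup>2 * exp (- ?u)) = exp (- ?u) * ?u ^ p * (?u\<^sup>2 * t\<^sup>2)"
    by (simp only: mult_ac)
  moreover have "(fact (p + 2) * exp ?u) * (t\<^sup>2 * exp (- ?u)) = fact (p + 2) * t\<^sup>2 * (exp ?u * exp (- ?u))"
    by (simp only: mult_ac)
  moreover have "exp ?u * exp (- ?u) = 1" by (simp flip: exp_add)
  moreover have "?u\<^sup>2 * t\<^sup>2 = 1" using True by (simp flip: power_mult_distrib)
  ultimately have "exp (- ?u) * ?u ^ p \<le> fact (p + 2) * t\<^sup>2" by (simp only: mult_1_right)
  then show ?thesis using True by (simp add: flat_def)
qed (simp add: flat_def)

lemma flat_deriv: "(flat p has_real_derivative (flat (p + 2) t - real p * flat (p + 1) t)) (at t)"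
proof (rule linorder_cases[of t 0])
  assume t: "t < 0"
  have "((\<lambda>t. 0) has_real_derivative 0) (at t)" by simp
  then have "(flat p has_real_derivative 0) (at t)"
    by (rule has_field_derivative_transform_within_open[where S = "{..<0}"]) (use t in \<open>auto simp: flat_def\<close>)
  then show ?thesis using t by (simp add: flat_def)
next
  assume t: "t = 0"
  have "(flat p has_derivative (\<lambda>v. 0)) (at 0)"
    by (rule has_derivative_if_quadratic[of _ _ _ "fact (p + 2)"])
      (use flat_le[of p] in \<open>auto simp: flat_def[of p 0] power2_eq_square\<close>)
  then show ?thesis using t by (simp add: has_field_derivative_def flat_def lambda_zero)
next
  assume t: "t > 0"
  have "((\<lambda>t. exp (- inverse t) * inverse t ^ p) has_real_derivative
     (flat (p + 2) t - real p * flat (p + 1) t)) (at t)"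
    using t by (auto intro!: derivative_eq_intros simp: flat_def power2_eq_square algebra_simps)
      (cases p; simp add: algebra_simps)
  then show ?thesis
    by (rule has_field_derivative_transform_within_open[where S = "{0<..}"]) (use t in \<open>auto simp: flat_def\<close>)
qed

lemma flat_nonneg: "flat p t \<ge> 0" and flat_pos_iff: "flat p t > 0 \<longleftrightarrow> t > 0"
  by (auto simp: flat_def)

lemma smooth_on_flat:
  fixes x0 :: "real^'k::finite"
  shows "smooth_on UNIV (\<lambda>x. of_real (flat 0 (c + d * (norm (x - x0))\<^sup>2)))"
proof -
  define q where "q = (\<lambda>x. c + d * (norm (x - x0))\<^sup>2)"
  have q: "(q has_derivative (\<lambda>v. 2 * d * ((x - x0) \<bullet> v))) (at x)" for x
    unfolding q_def power2_norm_eq_inner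
    by (auto intro!: derivative_eq_intros simp: inner_commute algebra_simps)
  have "\<forall>p. cdiff n UNIV (\<lambda>x. of_real (flat p (q x)))" for n
  proof (induction n)
    have D: "((\<lambda>x. of_real (flat p (q x)) :: complex) has_derivative
       (\<lambda>v. of_real ((flat (p + 2) (q x) - real p * flat (p + 1) (q x)) * (2 * d * ((x - x0) \<bullet> v))))) (at x)" for p x
      using has_derivative_of_real[OF has_derivative_compose[OF q flat_deriv[THEN has_field_derivative_imp_has_derivative]]]
      by simp
    {
      case 0
      then show ?case using D by (simp, meson differentiable_def differentiable_onI_open)
    next
      case (Suc n)
      show ?case
      proof (intro allI, rule cdiff_SucI[OF open_UNIV D])
        fix p and i :: 'k
        have "cdiff n UNIV (\<lambda>x::real^'k. of_real (x $ i))" using smooth_on_coord[OF open_UNIV] smooth_on_iff_cdiff by blast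
        then have "cdiff n UNIV (\<lambda>x. (of_real (flat (p + 2) (q x)) + of_real (- real p) * of_real (flat (p + 1) (q x)))
            * (of_real (2 * d) * (of_real (x $ i) + of_real (- x0 $ i))))"
          using Suc.IH by (intro cdiff_mult cdiff_add cdiff_const open_UNIV) auto
        then show "cdiff n UNIV (\<lambda>x. of_real ((flat (p + 2) (q x) - real p * flat (p + 1) (q x)) * (2 * d * ((x - x0) \<bullet> axis i 1))))"
          by (simp add: inner_axis algebra_simps)
      qed
    }
  qed
  then show ?thesis by (simp add: smooth_on_iff_cdiff q_def)
qed

text \<open>The quotient \<open>N\<^sub>1 / (N\<^sub>1 + N\<^sub>2)\<close> of two bumps, one supported in a ball and the other outside
  a smaller ball, whose sum vanishes nowhere.\<close>

lemma exists_cutoff: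
  obtains \<eta> :: "real^'k::finite \<Rightarrow> complex"
  where "smooth_on UNIV \<eta>" "\<And>x. norm x \<le> 1/4 \<Longrightarrow> \<eta> x = 1" "\<And>x. norm x \<ge> 1/2 \<Longrightarrow> \<eta> x = 0"
    and "\<And>x. \<eta> (- x) = \<eta> x"
proof -
  define N1 where "N1 = (\<lambda>x::real^'k. flat 0 (1/4 + (-1) * (norm (x - 0))\<^sup>2))"
  define N2 where "N2 = (\<lambda>x::real^'k. flat 0 (-1/16 + 1 * (norm (x - 0))\<^sup>2))"
  have N1z: "N1 x = 0" if "norm x \<ge> 1/2" for x
    using power_mono[OF that, of 2] by (auto simp: N1_def flat_def power2_eq_square)
  have N2z: "N2 x = 0" if "norm x \<le> 1/4" for x
    using power_mono[OF that, of 2] by (auto simp: N2_def flat_def power2_eq_square)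
  have N1p: "N1 x > 0" if "norm x < 1/2" for x
    using power_strict_mono[OF that, of 2] by (auto simp: N1_def flat_pos_iff power2_eq_square)
  have N2p: "N2 x > 0" if "norm x > 1/4" for x
    using power_strict_mono[OF that, of 2] by (auto simp: N2_def flat_pos_iff power2_eq_square)
  have nn: "N1 x \<ge> 0" "N2 x \<ge> 0" for x by (auto simp: N1_def N2_def flat_nonneg)
  have pos: "N1 x + N2 x > 0" for x
    using N1p[of x] N2p[of x] nn[of x] by (cases "norm x < 1/2") (auto intro: add_pos_nonneg add_nonneg_pos)
  define \<eta> where "\<eta> = (\<lambda>x. of_real (N1 x) * inverse (of_real (N1 x) + of_real (N2 x)) :: complex)"
  have sm: "smooth_on UNIV (\<lambda>x. of_real (N1 x) :: complex)" "smooth_on UNIV (\<lambda>x. of_real (N2 x) :: complex)"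
    unfolding N1_def N2_def by (rule smooth_on_flat)+
  show ?thesis
  proof
    show "smooth_on UNIV \<eta>" unfolding \<eta>_def
    proof (intro smooth_on_mult smooth_on_inverse smooth_on_add open_UNIV sm)
      show "of_real (N1 x) + of_real (N2 x) \<noteq> (0::complex)" for x
        using pos[of x] by (simp flip: of_real_add)
    qed
    show "\<eta> x = 1" if "norm x \<le> 1/4" for x
      using N2z[OF that] N1p[of x] that by (simp add: \<eta>_def)
    show "\<eta> x = 0" if "norm x \<ge> 1/2" for x
      using N1z[OF that] by (simp add: \<eta>_def)
    show "\<eta> (- x) = \<eta> x" for x
      by (simp add: \<eta>_def N1_def N2_def)
  qed
qed

section \<open>Test functions\<close>

definition test_fns :: "(real^'k::finite \<Rightarrow> complex) set" where
  "test_fns = {q. smooth_on UNIV q \<and> bounded {x. q x \<noteq> 0}}"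

lemma test_fns_smooth: "q \<in> test_fns \<Longrightarrow> smooth_on UNIV q"
  by (simp add: test_fns_def)

lemma test_fnsI: "smooth_on UNIV q \<Longrightarrow> (\<And>x. norm x > R \<Longrightarrow> q x = 0) \<Longrightarrow> q \<in> test_fns"
  unfolding test_fns_def bounded_iff by (auto intro!: exI[of _ R] simp: not_le[symmetric])

lemma test_fns_support:
  assumes "q \<in> test_fns"
  shows "\<exists>R>0. \<forall>x. R < norm x \<longrightarrow> q x = 0"
proof -
  obtain R where "\<forall>x\<in>{x. q x \<noteq> 0}. norm x \<le> R" using assms unfolding test_fns_def bounded_iff by blast
  then show ?thesis by (intro exI[of _ "max R 1"]) (force simp: not_le)
qed

lemma test_fns_partials:
  assumes "q \<in> test_fns" shows "partials is q \<in> test_fns"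
proof -
  obtain R where R: "R > 0" "\<And>x. norm x > R \<Longrightarrow> q x = 0" using test_fns_support[OF assms] by blast
  have "open {x::real^'a. norm x > R}" by (intro open_Collect_less continuous_intros)
  then have "partials is q x = 0" if "norm x > R" for x
    using partials_cong[of "{x. norm x > R}" q "\<lambda>x. 0" x "is"] R(2) that by simp
  then show ?thesis
    by (intro test_fnsI[of _ R] smooth_on_partials test_fns_smooth[OF assms]) auto
qed

lemma test_fns_mult: "q \<in> test_fns \<Longrightarrow> smooth_on UNIV g \<Longrightarrow> (\<lambda>x. g x * q x) \<in> test_fns"
proof -
  assume q: "q \<in> test_fns" and g: "smooth_on UNIV g"
  obtain R where "\<And>x. norm x > R \<Longrightarrow> q x = 0" using test_fns_support[OF q] by blast
  then show ?thesis
    by (intro test_fnsI[of _ R] smooth_on_mult g test_fns_smooth[OF q]) auto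
qed

lemma test_fns_cmult: "q \<in> test_fns \<Longrightarrow> (\<lambda>x. c * q x) \<in> test_fns"
  by (rule test_fns_mult) auto

lemma test_fns_add:
  assumes "p \<in> test_fns" "q \<in> test_fns" shows "(\<lambda>x. p x + q x) \<in> test_fns"
proof -
  obtain R R' where "\<And>x. norm x > R \<Longrightarrow> p x = 0" "\<And>x. norm x > R' \<Longrightarrow> q x = 0"
    using test_fns_support[OF assms(1)] test_fns_support[OF assms(2)] by blast
  then show ?thesis
    by (intro test_fnsI[of _ "max R R'"] smooth_on_add test_fns_smooth[OF assms(1)] test_fns_smooth[OF assms(2)]) auto
qed

lemma test_fns_diff: "p \<in> test_fns \<Longrightarrow> q \<in> test_fns \<Longrightarrow> (\<lambda>x. p x - q x) \<in> test_fns"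
  using test_fns_add[of p "\<lambda>x. -1 * q x"] test_fns_cmult[of q "-1"] by simp

lemma test_fns_sum: "(\<And>a. a \<in> A \<Longrightarrow> f a \<in> test_fns) \<Longrightarrow> (\<lambda>x. \<Sum>a\<in>A. f a x) \<in> test_fns"
proof (induction A rule: infinite_finite_induct)
  case (insert a A)
  then show ?case by (simp add: test_fns_add)
qed (auto intro: test_fnsI[of _ 0])

lemma test_fns_scaleR:
  assumes "q \<in> test_fns" "a \<noteq> 0" shows "(\<lambda>x. q (a *\<^sub>R x)) \<in> test_fns"
proof -
  obtain R where R: "R > 0" "\<And>x. norm x > R \<Longrightarrow> q x = 0" using test_fns_support[OF assms(1)] by blast
  show ?thesis
  proof (rule test_fnsI[of _ "R / \<bar>a\<bar>"])
    show "q (a *\<^sub>R x) = 0" if "norm x > R / \<bar>a\<bar>" for x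
      using that assms(2) by (intro R(2)) (simp add: field_simps)
  qed (intro smooth_on_scaleR test_fns_smooth[OF assms(1)])
qed

lemma test_fns_weight: "q \<in> test_fns \<Longrightarrow> (\<lambda>x. weight is x * q x) \<in> test_fns"
  by (rule test_fns_mult) (auto intro: smooth_on_weight)

lemma test_fns_continuous: "q \<in> test_fns \<Longrightarrow> continuous_on UNIV q"
  by (rule smooth_on_imp_continuous_on[OF test_fns_smooth])

lemma bounded_if_continuous_support:
  fixes q :: "real^'k::finite \<Rightarrow> complex"
  assumes "continuous_on (cball 0 R) q" "\<And>x. norm x > R \<Longrightarrow> q x = 0"
  obtains B where "B > 0" "\<And>x. norm (q x) \<le> B"
proof -
  have "bounded (q ` cball 0 R)"
    by (intro compact_imp_bounded compact_continuous_image assms compact_cball)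
  then obtain B where B: "B > 0" "\<And>x. x \<in> cball 0 R \<Longrightarrow> norm (q x) \<le> B"
    unfolding bounded_pos by blast
  then have "norm (q x) \<le> B" for x using assms(2)[of x] by (cases "norm x \<le> R") auto
  with B(1) that show ?thesis by blast
qed

lemma test_fns_bounded:
  assumes "q \<in> test_fns" obtains B where "B > 0" "\<And>x. norm (q x) \<le> B"
proof -
  obtain R where R: "\<And>x. norm x > R \<Longrightarrow> q x = 0" using test_fns_support[OF assms] by blast
  show ?thesis
    by (rule bounded_if_continuous_support[of R q])
      (use R that continuous_on_subset[OF test_fns_continuous[OF assms]] in auto)
qed

lemma integrable_if_continuous_support:
  fixes h :: "real^'k::finite \<Rightarrow> complex"
  assumes "continuous_on UNIV h" "\<And>x. norm x > R \<Longrightarrow> h x = 0"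
  shows "integrable lborel h"
proof -
  have "integrable lborel (\<lambda>x. indicator (cball 0 R) x *\<^sub>R h x)"
    by (intro borel_integrable_compact compact_cball continuous_on_subset[OF assms(1)]) auto
  also have "(\<lambda>x. indicator (cball 0 R) x *\<^sub>R h x) = h"
    using assms(2) by (auto simp: indicator_def fun_eq_iff not_le[symmetric])
  finally show ?thesis .
qed

lemma test_fns_integrable:
  assumes "q \<in> test_fns" "continuous_on UNIV g"
  shows "integrable lborel (\<lambda>x. q x * g x)"
proof -
  obtain R where R: "R > 0" "\<And>x. norm x > R \<Longrightarrow> q x = 0" using test_fns_support[OF assms(1)] by blast
  then show ?thesis
    by (intro integrable_if_continuous_support[of _ R] continuous_on_mult test_fns_continuous assms) auto
qed

lemma test_off_0_iff: "q \<in> test_off_0 \<longleftrightarrow> q \<in> test_fns \<and> (\<exists>d>0. \<forall>x. norm x < d \<longrightarrow> q x = 0)"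
proof -
  have "0 \<notin> closure {x. q x \<noteq> 0} \<longleftrightarrow> (\<exists>d>0. \<forall>x. norm x < d \<longrightarrow> q x = 0)"
    by (force simp: closure_approachable)
  then show ?thesis
    unfolding test_off_0_def test_fns_def by (auto simp: compact_closure)
qed

lemma test_off_0_mult:
  assumes f: "smooth_on (- {0}) f" and \<mu>: "\<mu> \<in> test_off_0"
  shows "(\<lambda>x. f x * \<mu> x) \<in> test_off_0"
proof -
  obtain d where d: "d > 0" "\<And>x. norm x < d \<Longrightarrow> \<mu> x = 0" and T: "\<mu> \<in> test_fns"
    using \<mu> unfolding test_off_0_iff by blast
  obtain R where R: "R > 0" "\<And>x. norm x > R \<Longrightarrow> \<mu> x = 0" using test_fns_support[OF T] by blast
  have 1: "smooth_on (- {0}) (\<lambda>x. f x * \<mu> x)"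
    by (intro smooth_on_mult f open_Compl closed_singleton smooth_on_subset[OF test_fns_smooth[OF T]]) auto
  have 2: "smooth_on (ball 0 d) (\<lambda>x. f x * \<mu> x)"
    by (rule smooth_on_cong[of _ "\<lambda>x. 0"]) (use d in auto)
  have "smooth_on (- {0} \<union> ball 0 d) (\<lambda>x. f x * \<mu> x)"
    by (intro smooth_on_Un 1 2) auto
  moreover have "- {0} \<union> ball (0::real^'a) d = UNIV" using d by auto
  ultimately have "(\<lambda>x. f x * \<mu> x) \<in> test_fns"
    using R by (intro test_fnsI[of _ R]) auto
  moreover have "\<forall>x. norm x < d \<longrightarrow> f x * \<mu> x = 0" using d by simp
  ultimately show ?thesis using d(1) unfolding test_off_0_iff by blast
qed

section \<open>Fourier transforms of test functions\<close>

lemma continuous_on_psi_UNIV: "continuous_on UNIV (\<lambda>x. psi x y)"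
  by (intro continuous_intros)

lemma test_fns_integrable_psi: "q \<in> test_fns \<Longrightarrow> integrable lborel (\<lambda>x. q x * psi x y)"
  by (rule test_fns_integrable) (auto intro: continuous_on_psi_UNIV)

lemma fourier_cmult: "fourier (\<lambda>x. c * q x) y = c * fourier q y"
  by (simp add: fourier_def mult.assoc)

lemma fourier_sum:
  assumes "\<And>a. a \<in> A \<Longrightarrow> f a \<in> test_fns"
  shows "fourier (\<lambda>x. \<Sum>a\<in>A. f a x) y = (\<Sum>a\<in>A. fourier (f a) y)"
proof -
  have "fourier (\<lambda>x. \<Sum>a\<in>A. f a x) y = (LINT x|lborel. (\<Sum>a\<in>A. f a x * psi x y))"
    by (simp add: fourier_def sum_distrib_right)
  also have "\<dots> = (\<Sum>a\<in>A. fourier (f a) y)"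
    unfolding fourier_def by (rule Bochner_Integration.integral_sum) (use assms test_fns_integrable_psi in auto)
  finally show ?thesis .
qed

lemma inner_eq_sum_coords: "(x::real^'k::finite) \<bullet> v = (\<Sum>j\<in>UNIV. x $ j * v $ j)"
  by (simp add: inner_vec_def)

lemma has_derivative_fourier:
  fixes q :: "real^'k::finite \<Rightarrow> complex"
  assumes q: "q \<in> test_fns"
  shows "(fourier q has_derivative (\<lambda>v. \<Sum>j\<in>UNIV. of_real (v $ j) * fourier (\<lambda>x. weight [j] x * q x) y)) (at y)"
proof (rule has_derivative_if_quadratic)
  show "bounded_linear (\<lambda>v. \<Sum>j\<in>UNIV. of_real (v $ j) * fourier (\<lambda>x. weight [j] x * q x) y)"
    by (intro bounded_linear_sum bounded_linear_mult_const
        bounded_linear_of_real[THEN bounded_linear_compose] bounded_linear_vec_nth)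
  fix v :: "real^'k"
  have int1: "integrable lborel (\<lambda>x. (2 * of_real pi * \<i> * of_real (x \<bullet> v)) * psi x y * q x)"
    using test_fns_integrable[OF q, of "\<lambda>x. 2 * of_real pi * \<i> * of_real (x \<bullet> v) * psi x y"]
    by (simp add: mult_ac continuous_intros)
  have L: "(\<Sum>j\<in>UNIV. of_real (v $ j) * fourier (\<lambda>x. weight [j] x * q x) y)
     = (LINT x|lborel. (2 * of_real pi * \<i> * of_real (x \<bullet> v)) * psi x y * q x)"
  proof -
    have "(\<Sum>j\<in>UNIV. of_real (v $ j) * fourier (\<lambda>x. weight [j] x * q x) y)
       = fourier (\<lambda>x. \<Sum>j\<in>UNIV. of_real (v $ j) * (weight [j] x * q x)) y"
      by (subst fourier_sum) (auto intro!: test_fns_cmult test_fns_weight q simp: fourier_cmult)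
    also have "(\<lambda>x. \<Sum>j\<in>UNIV. of_real (v $ j) * (weight [j] x * q x))
       = (\<lambda>x. 2 * of_real pi * \<i> * of_real (x \<bullet> v) * q x)"
      by (simp add: weight_Cons inner_eq_sum_coords sum_distrib_left sum_distrib_right mult_ac)
    finally show ?thesis by (simp add: fourier_def mult_ac)
  qed
  have int2: "integrable lborel (\<lambda>x. q x * of_real ((norm x)\<^sup>2) :: complex)"
    by (intro test_fns_integrable q continuous_intros)
  have "fourier q (y + v) - fourier q y - (\<Sum>j\<in>UNIV. of_real (v $ j) * fourier (\<lambda>x. weight [j] x * q x) y)
     = (LINT x|lborel. q x * psi x (y + v) - q x * psi x y - (2 * of_real pi * \<i> * of_real (x \<bullet> v)) * psi x y * q x)"
    unfolding L unfolding fourier_def using test_fns_integrable_psi[OF q] int1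
    by (simp add: Bochner_Integration.integral_diff)
  also have "\<dots> = (LINT x|lborel. q x * (psi x (y + v) - psi x y - (2 * of_real pi * \<i> * of_real (x \<bullet> v)) * psi x y))"
    by (simp add: algebra_simps)
  also have "norm \<dots> \<le> (LINT x|lborel. norm (q x * of_real ((norm x)\<^sup>2)) * ((2 * pi)\<^sup>2 * (norm v)\<^sup>2))"
  proof (rule Bochner_Integration.integral_norm_bound_integral)
    show "integrable lborel (\<lambda>x. q x * (psi x (y + v) - psi x y - (2 * of_real pi * \<i> * of_real (x \<bullet> v)) * psi x y))"
      by (intro test_fns_integrable q continuous_intros)
    show "integrable lborel (\<lambda>x. norm (q x * of_real ((norm x)\<^sup>2)) * ((2 * pi)\<^sup>2 * (norm v)\<^sup>2))"
      using int2 by (intro integrable_mult_left integrable_norm) auto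
    fix x
    show "norm (q x * (psi x (y + v) - psi x y - (2 * of_real pi * \<i> * of_real (x \<bullet> v)) * psi x y))
       \<le> norm (q x * of_real ((norm x)\<^sup>2)) * ((2 * pi)\<^sup>2 * (norm v)\<^sup>2)"
      using mult_left_mono[OF norm_psi_increment_le[of x y v] norm_ge_zero[of "q x"]]
      by (simp add: norm_mult norm_power mult_ac)
  qed
  also have "\<dots> = (LINT x|lborel. norm (q x * of_real ((norm x)\<^sup>2))) * (2 * pi)\<^sup>2 * (norm v)\<^sup>2"
    by simp
  finally show "norm (fourier q (y + v) - fourier q y - (\<Sum>j\<in>UNIV. of_real (v $ j) * fourier (\<lambda>x. weight [j] x * q x) y))
     \<le> (LINT x|lborel. norm (q x * of_real ((norm x)\<^sup>2))) * (2 * pi)\<^sup>2 * (norm v)\<^sup>2" .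
qed

lemma partial_fourier: "q \<in> test_fns \<Longrightarrow> partial j (fourier q) y = fourier (\<lambda>x. weight [j] x * q x) y"
  by (subst partial_eqI[OF has_derivative_fourier])
    (simp_all add: axis_def if_distrib[of of_real] if_distrib[of "\<lambda>z. z * _"] cong: if_cong)

lemma smooth_on_fourier:
  assumes "q \<in> test_fns" shows "smooth_on UNIV (fourier q)"
proof -
  have "cdiff n UNIV (fourier q)" if "q \<in> test_fns" for n and q :: "real^'a \<Rightarrow> complex"
    using that
  proof (induction n arbitrary: q)
    case 0
    then show ?case
      using has_derivative_fourier differentiable_def by (fastforce intro: differentiable_onI_open)
  next
    case (Suc n)
    have "cdiff n UNIV (partial j (fourier q))" for j
      unfolding partial_fourier[OF Suc.prems, THEN ext] eta_contract_eq
      using Suc.IH[OF test_fns_weight[OF Suc.prems]] .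
    moreover have "fourier q differentiable_on UNIV"
      using has_derivative_fourier[OF Suc.prems] differentiable_def by (fastforce intro: differentiable_onI_open)
    ultimately show ?case by simp
  qed
  with assms show ?thesis by (simp add: smooth_on_iff_cdiff)
qed

lemma partials_fourier:
  assumes q: "q \<in> test_fns"
  shows "partials is (fourier q) y = fourier (\<lambda>x. weight is x * q x) y"
proof (induction "is" arbitrary: y)
  case (Cons i "is")
  have "partials is (fourier q) = fourier (\<lambda>x. weight is x * q x)" using Cons.IH by blast
  then have "partials (i # is) (fourier q) y = partial i (fourier (\<lambda>x. weight is x * q x)) y" by simp
  also have "\<dots> = fourier (\<lambda>x. weight (i # is) x * q x) y"
    by (subst partial_fourier[OF test_fns_weight[OF q]]) (simp add: weight_Cons mult_ac)
  finally show ?case .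
qed simp

lemma continuous_on_fourier: "q \<in> test_fns \<Longrightarrow> continuous_on UNIV (fourier q)"
  by (rule smooth_on_imp_continuous_on[OF smooth_on_fourier])

lemma integral_scaleR:
  fixes F :: "real^'k::finite \<Rightarrow> complex"
  assumes a: "a \<noteq> 0" and F: "F \<in> borel_measurable borel"
  shows "(LINT x|lborel. F x) = of_real \<bar>a\<bar> ^ CARD('k) * (LINT x|lborel. F (a *\<^sub>R x))"
proof -
  have [measurable]: "F \<in> borel_measurable borel" by fact
  have "(LINT x|lborel. F x) = (LINT x|density (distr lborel borel (\<lambda>x. 0 + a *\<^sub>R x)) (\<lambda>_. \<bar>a\<bar> ^ DIM(real^'k)). F x)"
    by (subst lborel_affine[OF a, of 0]) simp
  also have "\<dots> = \<bar>a\<bar> ^ CARD('k) *\<^sub>R (LINT x|lborel. F (a *\<^sub>R x))"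
    by (subst integral_density) (auto simp: integral_distr)
  also have "\<dots> = of_real \<bar>a\<bar> ^ CARD('k) * (LINT x|lborel. F (a *\<^sub>R x))"
    by (simp only: scaleR_conv_of_real[where 'a = complex] of_real_power)
  finally show ?thesis .
qed

lemma test_fns_borel: "q \<in> test_fns \<Longrightarrow> q \<in> borel_measurable borel"
  by (intro borel_measurable_continuous_onI test_fns_continuous)

lemma fourier_scaleR:
  fixes q :: "real^'k::finite \<Rightarrow> complex"
  assumes "q \<in> test_fns" "a \<noteq> 0"
  shows "fourier q (a *\<^sub>R y) = of_real (\<bar>1 / a\<bar>) ^ CARD('k) * fourier (\<lambda>x. q ((1 / a) *\<^sub>R x)) y"
proof -
  have "continuous_on UNIV (\<lambda>x. q x * psi x (a *\<^sub>R y))"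
    by (intro continuous_intros test_fns_continuous assms)
  then have "fourier q (a *\<^sub>R y) = of_real (\<bar>1 / a\<bar>) ^ CARD('k) *
      (LINT x|lborel. q ((1 / a) *\<^sub>R x) * psi ((1 / a) *\<^sub>R x) (a *\<^sub>R y))"
    unfolding fourier_def using assms by (intro integral_scaleR borel_measurable_continuous_onI) auto
  then show ?thesis using assms by (simp add: fourier_def psi_scaleR_left)
qed

lemma fourier_swap:
  fixes g \<phi> :: "real^'k::finite \<Rightarrow> complex"
  assumes g: "g \<in> test_fns" and \<phi>: "\<phi> \<in> test_fns"
  shows "(LINT x|lborel. g x * fourier \<phi> x) = (LINT y|lborel. fourier g y * \<phi> y)"
proof -
  obtain R where R: "\<And>x. norm x > R \<Longrightarrow> g x = 0" using test_fns_support[OF g] by blast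
  obtain R' where R': "\<And>x. norm x > R' \<Longrightarrow> \<phi> x = 0" using test_fns_support[OF \<phi>] by blast
  let ?h = "\<lambda>x y. g x * \<phi> y * psi x y"
  let ?K = "cball (0::real^'k) R \<times> cball (0::real^'k) R'"
  have "integrable lborel (\<lambda>p. indicator ?K p *\<^sub>R case_prod ?h p)"
  proof (rule borel_integrable_compact)
    show "compact ?K" by (intro compact_Times compact_cball)
    have "continuous_on UNIV (\<lambda>p. g (fst p) * \<phi> (snd p) * psi (fst p) (snd p))"
      by (intro continuous_intros continuous_on_compose2[OF test_fns_continuous[OF g]]
          continuous_on_compose2[OF test_fns_continuous[OF \<phi>]]) auto
    then show "continuous_on ?K (case_prod ?h)"
      by (simp add: case_prod_unfold) (blast intro: continuous_on_subset)
  qed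
  also have "(\<lambda>p. indicator ?K p *\<^sub>R case_prod ?h p) = case_prod ?h"
    using R R' by (auto simp: indicator_def fun_eq_iff not_le[symmetric])
  finally have "integrable (lborel \<Otimes>\<^sub>M lborel) (case_prod ?h)" by (simp add: lborel_prod)
  from lborel_pair.Fubini_integral[OF this]
  have "(LINT y|lborel. LINT x|lborel. ?h x y) = (LINT x|lborel. LINT y|lborel. ?h x y)" .
  moreover have "(LINT y|lborel. ?h x y) = g x * fourier \<phi> x" for x
    by (simp add: fourier_def mult.assoc psi_commute[of x])
  moreover have "(LINT x|lborel. ?h x y) = fourier g y * \<phi> y" for y
  proof -
    have "(LINT x|lborel. ?h x y) = (LINT x|lborel. (g x * psi x y) * \<phi> y)" by (simp add: mult_ac)
    then show ?thesis by (simp add: fourier_def)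
  qed
  ultimately show ?thesis by simp
qed

section \<open>Lattice sums\<close>

lemma lattice_vec_0 [simp]: "lattice_vec 0 = 0"
  and lattice_vec_minus: "lattice_vec (- n) = - lattice_vec n"
  and lattice_vec_diff: "lattice_vec (m - n) = lattice_vec m - lattice_vec n"
  and lattice_vec_nth [simp]: "lattice_vec n $ i = of_int (n $ i)"
  by (simp_all add: lattice_vec_def vec_eq_iff)

lemma lattice_vec_eq_iff: "lattice_vec m = lattice_vec n \<longleftrightarrow> m = n"
  by (simp add: vec_eq_iff)

lemma lattice_vec_axis: "lattice_vec (axis c 1) = axis c 1"
  by (simp add: vec_eq_iff axis_def)

lemma psi_lattice [simp]: "psi (lattice_vec m) (lattice_vec n) = 1"
proof -
  have "lattice_vec m \<bullet> lattice_vec n = of_int (\<Sum>i\<in>UNIV. m $ i * n $ i)"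
    by (simp add: inner_eq_sum_coords)
  then obtain N :: int where "lattice_vec m \<bullet> lattice_vec n = of_int N" by blast
  then show ?thesis
    using exp_integer_2pi[of "of_int N"] by (simp add: psi_def mult_ac)
qed

lemma norm_lattice_vec_ge_1: "n \<noteq> 0 \<Longrightarrow> norm (lattice_vec n) \<ge> 1"
proof -
  assume "n \<noteq> 0"
  then obtain i where "n $ i \<noteq> 0" by (auto simp: vec_eq_iff)
  then have "1 \<le> \<bar>lattice_vec n $ i\<bar>" by simp
  also have "\<dots> \<le> norm (lattice_vec n)" by (rule component_le_norm_cart)
  finally show ?thesis .
qed

lemma lattice_ball:
  assumes "R \<ge> 0"
  shows finite_lattice_ball: "finite {n::int^'k::finite. norm (lattice_vec n) \<le> R}" (is "finite ?A")
    and card_lattice_ball: "real (card {n::int^'k. norm (lattice_vec n) \<le> R}) \<le> (2 * R + 1) ^ CARD('k)"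
proof -
  let ?B = "PiE (UNIV::'k set) (\<lambda>_. {-\<lfloor>R\<rfloor>..\<lfloor>R\<rfloor>})"
  have sub: "vec_nth ` ?A \<subseteq> ?B"
  proof (rule image_subsetI)
    fix n :: "int^'k" assume n: "n \<in> ?A"
    have "\<bar>n $ i\<bar> \<le> \<lfloor>R\<rfloor>" for i
    proof -
      have "\<bar>real_of_int (n $ i)\<bar> \<le> R"
        using n component_le_norm_cart[of "lattice_vec n" i] by simp
      then show ?thesis by (simp add: le_floor_iff)
    qed
    then show "vec_nth n \<in> ?B" by (simp add: PiE_iff abs_le_iff minus_le_iff)
  qed
  have inj: "inj_on vec_nth ?A" by (simp add: inj_on_def vec_nth_inject)
  have finB: "finite ?B" by (intro finite_PiE) auto
  then show fin: "finite ?A" using sub inj finite_subset inj_on_finite by blast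
  have "real (card ?A) = real (card (vec_nth ` ?A))" by (simp add: card_image[OF inj])
  also have "\<dots> \<le> real (card ?B)" using card_mono[OF finB sub] by simp
  also have "\<dots> = real (nat (2 * \<lfloor>R\<rfloor> + 1)) ^ CARD('k)"
    by (simp add: card_PiE)
  also have "\<dots> \<le> (2 * R + 1) ^ CARD('k)"
    using assms by (intro power_mono) auto
  finally show "real (card ?A) \<le> (2 * R + 1) ^ CARD('k)" .
qed

text \<open>Used for compactly supported \<open>Q\<close> only. An unordered infinite sum is more convenient than a finite one
  because translations and reindexing do not change its domain.\<close>

definition latsum :: "(real^'k::finite \<Rightarrow> complex) \<Rightarrow> real^'k \<Rightarrow> complex" where
  "latsum Q z = (\<Sum>\<^sub>\<infinity>n. Q (lattice_vec n) * psi (lattice_vec n) z)"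

lemma infsum_lattice:
  fixes g :: "int^'k::finite \<Rightarrow> 'b::{comm_monoid_add,t2_space}"
  assumes "\<And>n. norm (lattice_vec n) > R \<Longrightarrow> g n = 0" "R \<ge> 0"
  shows "infsum g UNIV = (\<Sum>n | norm (lattice_vec n) \<le> R. g n)"
proof -
  have "infsum g UNIV = infsum g {n. norm (lattice_vec n) \<le> R}"
    by (rule infsum_cong_neutral) (use assms in auto)
  then show ?thesis by (simp add: infsum_finite finite_lattice_ball[OF assms(2)])
qed

lemma summable_lattice:
  fixes g :: "int^'k::finite \<Rightarrow> 'b::{comm_monoid_add,t2_space}"
  assumes "\<And>n. norm (lattice_vec n) > R \<Longrightarrow> g n = 0" "R \<ge> 0"
  shows "g summable_on UNIV"
proof -
  have "{n. g n \<noteq> 0} \<subseteq> {n. norm (lattice_vec n) \<le> R}" using assms by (auto simp: not_less[symmetric])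
  then have "finite {n. g n \<noteq> 0}" using finite_lattice_ball[OF assms(2)] finite_subset by blast
  then show ?thesis by (intro finite_nonzero_values_imp_summable_on) simp
qed

lemma latsum_eq_sum:
  assumes "\<And>x. norm x > R \<Longrightarrow> Q x = 0" "R \<ge> 0"
  shows "latsum Q z = (\<Sum>n | norm (lattice_vec n) \<le> R. Q (lattice_vec n) * psi (lattice_vec n) z)"
  unfolding latsum_def by (rule infsum_lattice) (use assms in auto)

lemma latsum_cmult: "latsum (\<lambda>x. c * Q x) z = c * latsum Q z"
  unfolding latsum_def by (simp add: mult.assoc infsum_cmult_right')

lemma smooth_on_latsum:
  assumes "q \<in> test_fns" shows "smooth_on UNIV (latsum q)"
    and partials_latsum: "partials is (latsum q) z = latsum (\<lambda>x. weight is x * q x) z"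
proof -
  obtain R where R: "R > 0" "\<And>x. norm x > R \<Longrightarrow> q x = 0" using test_fns_support[OF assms] by blast
  let ?A = "{n::int^'a. norm (lattice_vec n) \<le> R}"
  have eq: "latsum q = (\<lambda>z. \<Sum>n\<in>?A. q (lattice_vec n) * psi (lattice_vec n) z)"
    using R by (intro ext latsum_eq_sum) auto
  show "smooth_on UNIV (latsum q)"
    unfolding eq by (intro smooth_on_sum smooth_on_cmult smooth_on_psi open_UNIV)
  have "partials is (latsum q) z = (\<Sum>n\<in>?A. q (lattice_vec n) * (weight is (lattice_vec n) * psi (lattice_vec n) z))"
    unfolding eq
    by (simp add: partials_sum[OF open_UNIV] partials_cmult[OF open_UNIV] smooth_on_cmult smooth_on_psi partials_psi)
  also have "\<dots> = latsum (\<lambda>x. weight is x * q x) z"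
    using R by (subst latsum_eq_sum[of R]) (auto simp: mult_ac)
  finally show "partials is (latsum q) z = latsum (\<lambda>x. weight is x * q x) z" .
qed

section \<open>Riemann sums\<close>

text \<open>A half-open cell is squeezed between an open and a closed box of the same volume.\<close>

lemma measure_lattice_cell:
  fixes n :: "int^'k::finite"
  assumes M: "(M::real) > 0"
  defines "cell \<equiv> {x::real^'k. \<forall>i. \<lfloor>M * x $ i\<rfloor> = n $ i}"
  shows "cell \<in> sets lborel" "emeasure lborel cell < \<infinity>" "measure lborel cell = (1 / M) ^ CARD('k)"
proof -
  let ?a = "(1 / M) *\<^sub>R lattice_vec n" and ?b = "(1 / M) *\<^sub>R (lattice_vec n + 1)"
  have cell: "cell = (\<Inter>i. {x. of_int (n $ i) \<le> M * x $ i} \<inter> {x. M * x $ i < of_int (n $ i) + 1})"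
    unfolding cell_def by (auto simp: floor_eq_iff)
  have "{x::real^'k. of_int (n $ i) \<le> M * x $ i} \<in> sets borel" "{x::real^'k. M * x $ i < of_int (n $ i) + 1} \<in> sets borel" for i
    by (intro borel_closed closed_Collect_le borel_open open_Collect_less continuous_intros)+
  then show sets: "cell \<in> sets lborel" unfolding cell by auto
  have sub: "box ?a ?b \<subseteq> cell" "cell \<subseteq> cbox ?a ?b"
  proof -
    have "of_int (n $ i) \<le> M * x $ i \<and> M * x $ i < of_int (n $ i) + 1" if "x \<in> box ?a ?b" for x i
    proof -
      have "?a $ i < x $ i" "x $ i < ?b $ i" using that by (auto simp: mem_box_cart)
      then show ?thesis using M by (simp add: field_simps)
    qed
    then show "box ?a ?b \<subseteq> cell" unfolding cell by blast
    have "?a $ i \<le> x $ i \<and> x $ i \<le> ?b $ i" if "x \<in> cell" for x i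
    proof -
      have "of_int (n $ i) \<le> M * x $ i" "M * x $ i < of_int (n $ i) + 1" using that unfolding cell by auto
      then show ?thesis using M by (simp add: field_simps)
    qed
    then show "cell \<subseteq> cbox ?a ?b" by (auto simp: mem_box_cart)
  qed
  have ne: "cbox ?a ?b \<noteq> {}" using M by (auto simp: interval_ne_empty_cart divide_right_mono)
  have "measure lborel (cbox ?a ?b) = (1 / M) ^ CARD('k)"
    by (subst content_cbox_cart[OF ne]) (simp add: diff_divide_distrib[symmetric])
  then have c: "emeasure lborel (cbox ?a ?b) = ennreal ((1 / M) ^ CARD('k))"
    using emeasure_eq_ennreal_measure[of lborel "cbox ?a ?b"] emeasure_lborel_cbox_finite[of ?a ?b] by simp
  then have "emeasure lborel (box ?a ?b) = ennreal ((1 / M) ^ CARD('k))"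
    by (simp add: emeasure_lborel_box_eq emeasure_lborel_cbox_eq)
  with c sub sets have e: "emeasure lborel cell = ennreal ((1 / M) ^ CARD('k))"
    by (intro antisym) (metis emeasure_mono sets_lborel borel_closed closed_cbox, metis emeasure_mono)
  then show "emeasure lborel cell < \<infinity>" by simp
  show "measure lborel cell = (1 / M) ^ CARD('k)" using e M by (simp add: measure_def)
qed

text \<open>The Riemann sum is the integral of the step function obtained by rounding \<open>x\<close> down to the
  mesh, so dominated convergence applies.\<close>

lemma latsum_tendsto_fourier:
  fixes q :: "real^'k::finite \<Rightarrow> complex"
  assumes q: "q \<in> test_fns"
  shows "(\<lambda>i. (1 / 2 ^ i) ^ CARD('k) * latsum (\<lambda>x. q ((1 / 2 ^ i) *\<^sub>R x)) ((1 / 2 ^ i) *\<^sub>R y)) \<longlonglongrightarrow> fourier q y"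
proof -
  obtain R where R: "R > 0" "\<And>x. norm x > R \<Longrightarrow> q x = 0" using test_fns_support[OF q] by blast
  define h where "h = (\<lambda>x. q x * psi x y)"
  have hcont: "continuous_on UNIV h" unfolding h_def by (intro continuous_intros test_fns_continuous q)
  have h0: "h x = 0" if "norm x > R" for x using R(2)[OF that] by (simp add: h_def)
  obtain B where B: "B > 0" "\<And>x. norm (h x) \<le> B"
    using test_fns_bounded[OF q] by (metis h_def norm_mult norm_psi mult.right_neutral)
  define fl where "fl = (\<lambda>i (x::real^'k). (\<chi> c. \<lfloor>2 ^ i * x $ c\<rfloor>) :: int^'k)"
  define s where "s = (\<lambda>i x. h ((1 / 2 ^ i) *\<^sub>R lattice_vec (fl i x)))"
  define cell where "cell = (\<lambda>i (n::int^'k). {x::real^'k. \<forall>c. \<lfloor>2 ^ i * x $ c\<rfloor> = n $ c})"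
  define A where "A = (\<lambda>i. {n::int^'k. norm (lattice_vec n) \<le> 2 ^ i * R})"
  have cellm: "cell i n \<in> sets lborel" "emeasure lborel (cell i n) < \<infinity>" "measure lborel (cell i n) = (1 / 2 ^ i) ^ CARD('k)" for i n
    unfolding cell_def by (rule measure_lattice_cell; simp)+
  have finA: "finite (A i)" for i unfolding A_def using R by (intro finite_lattice_ball) auto
  have near: "norm ((1 / 2 ^ i) *\<^sub>R lattice_vec (fl i x) - x) \<le> real CARD('k) * (1 / 2 ^ i)" for i x
  proof -
    have "norm ((1 / 2 ^ i) *\<^sub>R lattice_vec (fl i x) - x) \<le> (\<Sum>c\<in>UNIV. \<bar>((1 / 2 ^ i) *\<^sub>R lattice_vec (fl i x) - x) $ c\<bar>)"
      by (rule norm_le_l1_cart)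
    also have "\<dots> \<le> (\<Sum>c\<in>(UNIV::'k set). 1 / 2 ^ i)"
    proof (rule sum_mono)
      fix c
      have "\<bar>((1 / 2 ^ i) *\<^sub>R lattice_vec (fl i x) - x) $ c\<bar> = (1 / 2 ^ i) * \<bar>of_int \<lfloor>2 ^ i * x $ c\<rfloor> - 2 ^ i * x $ c\<bar>"
        by (subst abs_of_pos[of "1 / 2 ^ i :: real", symmetric], simp) (simp add: fl_def abs_mult[symmetric] field_simps)
      also have "\<dots> \<le> (1 / 2 ^ i) * 1" by (intro mult_left_mono) (auto, linarith)
      finally show "\<bar>((1 / 2 ^ i) *\<^sub>R lattice_vec (fl i x) - x) $ c\<bar> \<le> 1 / 2 ^ i" by simp
    qed
    finally show ?thesis by simp
  qed
  have s_sum: "s i x = (\<Sum>n\<in>A i. h ((1 / 2 ^ i) *\<^sub>R lattice_vec n) * of_real (indicator (cell i n) x))" for i x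
  proof -
    have "(\<Sum>n\<in>A i. h ((1 / 2 ^ i) *\<^sub>R lattice_vec n) * of_real (indicator (cell i n) x))
       = (\<Sum>n\<in>A i. if n = fl i x then h ((1 / 2 ^ i) *\<^sub>R lattice_vec n) else 0)"
      by (intro sum.cong refl) (auto simp: cell_def fl_def indicator_def vec_eq_iff)
    also have "\<dots> = s i x"
    proof (cases "fl i x \<in> A i")
      case False
      then have "norm ((1 / 2 ^ i) *\<^sub>R lattice_vec (fl i x)) > R" by (simp add: A_def field_simps)
      with h0 False finA show ?thesis by (simp add: s_def)
    qed (use finA in \<open>simp add: s_def\<close>)
    finally show ?thesis by simp
  qed
  have ind_int: "integrable lborel (\<lambda>x. of_real (indicator (cell i n) x) :: complex)" for i n
    using cellm[of i n] by (intro integrable_of_real) (simp add: integrable_indicator_iff)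
  have s_meas: "s i \<in> borel_measurable lborel" for i
    unfolding s_sum[abs_def] using cellm(1) by (intro borel_measurable_sum borel_measurable_times) auto
  have s_int: "(LINT x|lborel. s i x) = (1 / 2 ^ i) ^ CARD('k) * latsum (\<lambda>x. q ((1 / 2 ^ i) *\<^sub>R x)) ((1 / 2 ^ i) *\<^sub>R y)" for i
  proof -
    have "(LINT x|lborel. s i x) = (\<Sum>n\<in>A i. LINT x|lborel. h ((1 / 2 ^ i) *\<^sub>R lattice_vec n) * of_real (indicator (cell i n) x))"
      unfolding s_sum by (intro Bochner_Integration.integral_sum integrable_mult_right ind_int)
    also have "\<dots> = (\<Sum>n\<in>A i. h ((1 / 2 ^ i) *\<^sub>R lattice_vec n) * (1 / 2 ^ i) ^ CARD('k))"
    proof (rule sum.cong[OF refl])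
      fix n
      have "(LINT x|lborel. of_real (indicator (cell i n) x)) = (of_real (measure lborel (cell i n)) :: complex)"
        using cellm(1,2)[of i n] by simp
      then show "(LINT x|lborel. h ((1 / 2 ^ i) *\<^sub>R lattice_vec n) * of_real (indicator (cell i n) x))
         = h ((1 / 2 ^ i) *\<^sub>R lattice_vec n) * (1 / 2 ^ i) ^ CARD('k)"
        by (simp add: cellm(3))
    qed
    also have "\<dots> = (1 / 2 ^ i) ^ CARD('k) * latsum (\<lambda>x. q ((1 / 2 ^ i) *\<^sub>R x)) ((1 / 2 ^ i) *\<^sub>R y)"
      using R by (subst latsum_eq_sum[of "2 ^ i * R"])
        (auto simp: A_def h_def sum_distrib_left field_simps psi_scaleR_left intro!: sum.cong R(2))
    finally show ?thesis .
  qed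
  have "(\<lambda>i. LINT x|lborel. s i x) \<longlonglongrightarrow> (LINT x|lborel. h x)"
  proof (rule integral_dominated_convergence[where w = "\<lambda>x. B * indicator (cball 0 (R + real CARD('k))) x"])
    show "h \<in> borel_measurable lborel" using hcont by (simp add: borel_measurable_continuous_onI)
    show "integrable lborel (\<lambda>x::real^'k. B * indicator (cball 0 (R + real CARD('k))) x)"
      using emeasure_lborel_cball_finite[of "0::real^'k"]
      by (intro integrable_mult_right) (simp add: integrable_indicator_iff)
    show "AE x in lborel. norm (s i x) \<le> B * indicator (cball 0 (R + real CARD('k))) x" for i
    proof (intro AE_I2)
      fix x
      show "norm (s i x) \<le> B * indicator (cball 0 (R + real CARD('k))) x"
      proof (cases "norm x \<le> R + real CARD('k)")
        case True
        then show ?thesis using B by (simp add: s_def)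
      next
        case False
        have "real CARD('k) * (1 / 2 ^ i) \<le> real CARD('k) * 1" by (intro mult_left_mono) auto
        then have "norm ((1 / 2 ^ i) *\<^sub>R lattice_vec (fl i x)) > R"
          using False near[of i x] norm_triangle_sub[of x "(1 / 2 ^ i) *\<^sub>R lattice_vec (fl i x)"]
          by (simp add: norm_minus_commute)
        with h0 B(1) show ?thesis by (simp add: s_def indicator_def)
      qed
    qed
    show "AE x in lborel. (\<lambda>i. s i x) \<longlonglongrightarrow> h x"
    proof (intro AE_I2)
      fix x
      have "(\<lambda>i. real CARD('k) * (1 / 2) ^ i) \<longlonglongrightarrow> real CARD('k) * 0"
        by (intro tendsto_mult tendsto_const LIMSEQ_realpow_zero) auto
      then have "(\<lambda>i. real CARD('k) * (1 / 2 ^ i)) \<longlonglongrightarrow> 0" by (simp add: power_divide)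
      then have "(\<lambda>i. (1 / 2 ^ i) *\<^sub>R lattice_vec (fl i x) - x) \<longlonglongrightarrow> 0"
        by (rule Lim_null_comparison[rotated]) (use near in auto)
      then have "(\<lambda>i. (1 / 2 ^ i) *\<^sub>R lattice_vec (fl i x)) \<longlonglongrightarrow> x" by (simp add: LIM_zero_iff)
      with hcont show "(\<lambda>i. s i x) \<longlonglongrightarrow> h x"
        unfolding s_def by (intro continuous_on_tendsto_compose[of UNIV h]) auto
    qed
  qed (rule s_meas)
  then show ?thesis by (simp add: s_int h_def fourier_def)
qed

section \<open>Summation by parts\<close>

definition diffop :: "'k::finite \<Rightarrow> (real^'k \<Rightarrow> complex) \<Rightarrow> real^'k \<Rightarrow> complex" where
  "diffop c Q x = Q x - Q (x - axis c 1)"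

text \<open>The mean value inequality along the segment from \<open>x\<close> to \<open>x + v\<close>.\<close>

lemma norm_increment_le:
  fixes Q :: "real^'k::finite \<Rightarrow> complex"
  assumes Q: "smooth_on UNIV Q"
    and B: "\<And>t. 0 \<le> t \<Longrightarrow> t \<le> 1 \<Longrightarrow> norm (\<Sum>j\<in>UNIV. of_real (v $ j) * partial j Q (t *\<^sub>R v + x)) \<le> B"
  shows "norm (Q (v + x) - Q x) \<le> B"
proof -
  have "norm ((\<lambda>t. Q (t *\<^sub>R v + x)) 1 - (\<lambda>t. Q (t *\<^sub>R v + x)) 0) \<le> B * norm (1 - 0 :: real)"
  proof (rule differentiable_bound[of "{0..1}" _
      "\<lambda>t h. of_real h * (\<Sum>j\<in>UNIV. of_real (v $ j) * partial j Q (t *\<^sub>R v + x))"])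
    fix t :: real assume t: "t \<in> {0..1}"
    have "((\<lambda>t. Q (t *\<^sub>R v + x)) has_derivative
      (\<lambda>h. \<Sum>j\<in>UNIV. of_real ((h *\<^sub>R v) $ j) * partial j Q (t *\<^sub>R v + x))) (at t within {0..1})"
      by (rule has_derivative_compose[where g = Q and f = "\<lambda>t. t *\<^sub>R v + x",
            OF _ has_derivative_partial[OF smooth_on_differentiable[OF Q]]])
        (auto intro!: derivative_eq_intros)
    then show "((\<lambda>t. Q (t *\<^sub>R v + x)) has_derivative
      (\<lambda>h. of_real h * (\<Sum>j\<in>UNIV. of_real (v $ j) * partial j Q (t *\<^sub>R v + x)))) (at t within {0..1})"
      by (simp add: sum_distrib_left mult.assoc)
    show "onorm (\<lambda>h. complex_of_real h * (\<Sum>j\<in>UNIV. of_real (v $ j) * partial j Q (t *\<^sub>R v + x))) \<le> B"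
    proof (rule onorm_le)
      fix h :: real
      show "norm (complex_of_real h * (\<Sum>j\<in>UNIV. of_real (v $ j) * partial j Q (t *\<^sub>R v + x))) \<le> B * norm h"
        using mult_left_mono[OF B[of t], of "\<bar>h\<bar>"] t by (simp add: norm_mult mult.commute)
    qed
  qed auto
  then show ?thesis by simp
qed

lemma norm_diffop_le:
  assumes Q: "smooth_on UNIV Q" and B: "\<And>x. norm (partial c Q x) \<le> B"
  shows "norm (diffop c Q x) \<le> B"
proof -
  have "norm (Q (- axis c 1 + x) - Q x) \<le> B"
    using B by (intro norm_increment_le Q)
      (simp add: axis_def if_distrib[of of_real] if_distrib[of uminus] if_distrib[of "\<lambda>z. z * _"] cong: if_cong)
  then show ?thesis by (simp add: diffop_def norm_minus_commute)
qed

lemma norm_diffop_pow_le: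
  assumes "smooth_on UNIV Q" "\<And>x. norm (partials (replicate N c) Q x) \<le> B"
  shows "norm ((diffop c ^^ N) Q x) \<le> B"
  using assms
proof (induction N arbitrary: Q)
  case (Suc N)
  have tr: "smooth_on UNIV (\<lambda>x. Q (x - axis c 1))"
    using smooth_on_affine[OF Suc.prems(1), of 1 "- axis c 1"] by simp
  have "norm ((diffop c ^^ N) (diffop c Q) x) \<le> B"
  proof (rule Suc.IH)
    show "smooth_on UNIV (diffop c Q)"
      unfolding diffop_def[abs_def] by (intro smooth_on_diff open_UNIV Suc.prems(1) tr)
    fix x
    let ?P = "partials (replicate N c) Q"
    have "partials (replicate N c) (diffop c Q) x = ?P x - partials (replicate N c) (\<lambda>x. Q (x - axis c 1)) x"
      unfolding diffop_def[abs_def] by (rule partials_diff[OF open_UNIV Suc.prems(1) tr]) simp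
    also have "\<dots> = diffop c ?P x"
      using partials_affine[OF Suc.prems(1), of "replicate N c" 1 "- axis c 1" x] by (simp add: diffop_def)
    finally show "norm (partials (replicate N c) (diffop c Q) x) \<le> B"
      using norm_diffop_le[OF smooth_on_partials[OF Suc.prems(1)], of c "replicate N c" B x] Suc.prems(2) by simp
  qed
  then show ?case by (simp add: funpow_swap1)
qed simp

lemma diffop_pow_support:
  assumes "\<And>x. norm x > R \<Longrightarrow> Q x = 0" "norm x > R + real N"
  shows "(diffop c ^^ N) Q x = 0"
  using assms(2)
proof (induction N arbitrary: x)
  case (Suc N)
  have "norm x \<le> norm (x - axis c 1) + norm (axis c 1 :: real^'a)"
    by (metis diff_add_cancel norm_triangle_ineq)
  then show ?case using Suc by (simp add: diffop_def)
qed (use assms in simp)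

lemma infsum_shift:
  fixes g :: "int^'k::finite \<Rightarrow> 'b::{comm_monoid_add,t2_space}"
  shows "(\<Sum>\<^sub>\<infinity>n. g (n - d)) = (\<Sum>\<^sub>\<infinity>n. g n)"
  by (rule infsum_reindex_bij_betw) (rule bij_betwI[of _ _ _ "\<lambda>n. n + d"], auto)

lemma latsum_shift: "latsum (\<lambda>x. Q (x - axis c 1)) z = psi (axis c 1) z * latsum Q z"
proof -
  have "latsum (\<lambda>x. Q (x - axis c 1)) z
      = (\<Sum>\<^sub>\<infinity>n. (\<lambda>m. psi (axis c 1) z * (Q (lattice_vec m) * psi (lattice_vec m) z)) (n - axis c 1))"
    unfolding latsum_def
  proof (rule infsum_cong)
    fix n :: "int^'a"
    have "psi (lattice_vec n) z = psi (lattice_vec (n - axis c 1)) z * psi (axis c 1) z"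
      by (simp add: lattice_vec_diff lattice_vec_axis flip: psi_add_left)
    then show "Q (lattice_vec n - axis c 1) * psi (lattice_vec n) z = psi (axis c 1) z *
         (Q (lattice_vec (n - axis c 1)) * psi (lattice_vec (n - axis c 1)) z)"
      by (simp add: lattice_vec_diff lattice_vec_axis)
  qed
  also have "\<dots> = (\<Sum>\<^sub>\<infinity>n. psi (axis c 1) z * (Q (lattice_vec n) * psi (lattice_vec n) z))"
    by (rule infsum_shift)
  also have "\<dots> = psi (axis c 1) z * latsum Q z" by (simp add: infsum_cmult_right' latsum_def)
  finally show ?thesis .
qed

lemma latsum_diff:
  assumes "\<And>x. norm x > R \<Longrightarrow> P x = 0" "\<And>x. norm x > R \<Longrightarrow> Q x = 0" "R \<ge> 0"
  shows "latsum (\<lambda>x. P x - Q x) z = latsum P z - latsum Q z"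
  using assms by (simp add: latsum_eq_sum[of R] left_diff_distrib sum_subtractf)

lemma latsum_diffop_pow:
  fixes Q :: "real^'k::finite \<Rightarrow> complex"
  assumes "\<And>x. norm x > R \<Longrightarrow> Q x = 0" "R \<ge> 0"
  shows "latsum ((diffop c ^^ N) Q) z = (1 - psi (axis c 1) z) ^ N * latsum Q z"
proof (induction N)
  case (Suc N)
  let ?P = "(diffop c ^^ N) Q"
  have P: "?P x = 0" if "norm x > R + real N" for x
    by (rule diffop_pow_support[OF assms(1) that])
  have dP: "diffop c ?P = (\<lambda>x. ?P x - ?P (x - axis c 1))" by (simp add: diffop_def fun_eq_iff)
  have "latsum (diffop c ?P) z = latsum ?P z - latsum (\<lambda>x. ?P (x - axis c 1)) z"
    unfolding dP
  proof (rule latsum_diff[of "R + real N + 1"])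
    fix x :: "real^'k" assume "norm x > R + real N + 1"
    moreover have "norm x \<le> norm (x - axis c 1) + norm (axis c 1 :: real^'k)"
      by (metis diff_add_cancel norm_triangle_ineq)
    ultimately show "?P x = 0" "?P (x - axis c 1) = 0" by (auto intro!: P)
  qed (use assms in auto)
  then show ?case using Suc by (simp add: latsum_shift algebra_simps)
qed simp

text \<open>The dilates of a test function by \<open>2\<^sup>i\<close> have \<open>O(2\<^sup>i\<^sup>k)\<close> lattice points in their support,
  and each difference gains a factor \<open>2\<^sup>-\<^sup>i\<close>.\<close>

lemma diffop_pow_scaled_bound:
  fixes q :: "real^'k::finite \<Rightarrow> complex"
  assumes q: "q \<in> test_fns"
  shows "\<exists>C\<ge>0. \<forall>i c. (\<lambda>n. norm ((diffop c ^^ N) (\<lambda>x. q ((1 / 2 ^ i) *\<^sub>R x)) (lattice_vec n))) summable_on UNIV \<and>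
    (\<Sum>\<^sub>\<infinity>n. norm ((diffop c ^^ N) (\<lambda>x. q ((1 / 2 ^ i) *\<^sub>R x)) (lattice_vec n)))
      \<le> C * (2 ^ i) ^ CARD('k) / (2 ^ i) ^ N"
proof -
  obtain R where R: "R > 0" "\<And>x. norm x > R \<Longrightarrow> q x = 0" using test_fns_support[OF q] by blast
  have "\<exists>B. \<forall>x. norm (partials (replicate N c) q x) \<le> B" for c
    using test_fns_bounded[OF test_fns_partials[OF q]] by metis
  then obtain B where B: "\<And>c x. norm (partials (replicate N c) q x) \<le> B c" by metis
  have B0: "B c \<ge> 0" for c using order_trans[OF norm_ge_zero B] .
  define C where "C = (2 * (R + real N) + 1) ^ CARD('k) * (\<Sum>c\<in>UNIV. B c)"
  have "C \<ge> 0" unfolding C_def using R B0 by (intro mult_nonneg_nonneg sum_nonneg) auto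
  moreover have "(\<lambda>n. norm ((diffop c ^^ N) (\<lambda>x. q ((1 / 2 ^ i) *\<^sub>R x)) (lattice_vec n))) summable_on UNIV \<and>
    (\<Sum>\<^sub>\<infinity>n. norm ((diffop c ^^ N) (\<lambda>x. q ((1 / 2 ^ i) *\<^sub>R x)) (lattice_vec n)))
      \<le> C * (2 ^ i) ^ CARD('k) / (2 ^ i) ^ N" for i c
  proof -
    let ?Q = "\<lambda>x. q ((1 / 2 ^ i) *\<^sub>R x)"
    define M where "M = (2::real) ^ i"
    have M: "M \<ge> 1" by (simp add: M_def)
    let ?R = "M * R + real N"
    have supp: "(diffop c ^^ N) ?Q x = 0" if "norm x > ?R" for x
      by (rule diffop_pow_support[of "M * R"], rule R(2))
        (use that M in \<open>simp_all add: M_def field_simps\<close>)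
    have bd: "norm ((diffop c ^^ N) ?Q x) \<le> B c / M ^ N" for x
    proof (rule norm_diffop_pow_le)
      show "smooth_on UNIV ?Q" by (intro smooth_on_scaleR test_fns_smooth q)
      fix x
      have "norm (partials (replicate N c) ?Q x) = (1 / M) ^ N * norm (partials (replicate N c) q ((1 / 2 ^ i) *\<^sub>R x))"
        by (simp add: partials_scaleR[OF test_fns_smooth[OF q]] norm_mult norm_power M_def norm_divide)
      also have "\<dots> \<le> (1 / M) ^ N * B c" using B M by (intro mult_left_mono) auto
      finally show "norm (partials (replicate N c) ?Q x) \<le> B c / M ^ N" by (simp add: power_divide)
    qed
    have R0: "?R \<ge> 0" using M R by simp
    have "(\<Sum>\<^sub>\<infinity>n. norm ((diffop c ^^ N) ?Q (lattice_vec n)))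
        = (\<Sum>n | norm (lattice_vec n) \<le> ?R. norm ((diffop c ^^ N) ?Q (lattice_vec n)))"
      by (rule infsum_lattice) (use supp R0 in auto)
    also have "\<dots> \<le> real (card {n::int^'k. norm (lattice_vec n) \<le> ?R}) * (B c / M ^ N)"
      by (rule sum_bounded_above) (rule bd)
    also have "\<dots> \<le> (2 * ?R + 1) ^ CARD('k) * (B c / M ^ N)"
      using B0 M by (intro mult_right_mono card_lattice_ball R0) auto
    also have "\<dots> \<le> ((2 * (R + real N) + 1) * M) ^ CARD('k) * ((\<Sum>c\<in>UNIV. B c) / M ^ N)"
    proof (intro mult_mono power_mono divide_right_mono)
      have "real N * 1 \<le> real N * M" using M by (intro mult_left_mono) auto
      with M show "2 * ?R + 1 \<le> (2 * (R + real N) + 1) * M" by (simp add: algebra_simps)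
      show "B c \<le> sum B UNIV" by (intro member_le_sum) (auto simp: B0)
    qed (use M R R0 B0 in auto)
    also have "\<dots> = C * M ^ CARD('k) / M ^ N" by (simp add: C_def power_mult_distrib)
    finally have "(\<Sum>\<^sub>\<infinity>n. norm ((diffop c ^^ N) ?Q (lattice_vec n))) \<le> C * M ^ CARD('k) / M ^ N" .
    moreover have "(\<lambda>n. norm ((diffop c ^^ N) ?Q (lattice_vec n))) summable_on UNIV"
      by (rule summable_lattice[of ?R]) (use supp R0 in auto)
    ultimately show ?thesis by (simp add: M_def)
  qed
  ultimately show ?thesis by blast
qed

text \<open>Summation by parts: the factor \<open>1 - \<psi>(e\<^sub>c, z)\<close>, which vanishes only for integral \<open>z\<^sub>c\<close>, can be traded
  for a difference.\<close>

lemma latsum_scaled_decay: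
  fixes q :: "real^'k::finite \<Rightarrow> complex"
  assumes q: "q \<in> test_fns"
  shows "\<exists>C\<ge>0. \<forall>i z c. norm (1 - psi (axis c 1) z) ^ N * norm (latsum (\<lambda>x. q ((1 / 2 ^ i) *\<^sub>R x)) z)
      \<le> C * (2 ^ i) ^ CARD('k) / (2 ^ i) ^ N"
proof -
  obtain R where R: "R > 0" "\<And>x. norm x > R \<Longrightarrow> q x = 0" using test_fns_support[OF q] by blast
  obtain C where C: "C \<ge> 0" "\<And>i c. (\<lambda>n. norm ((diffop c ^^ N) (\<lambda>x. q ((1 / 2 ^ i) *\<^sub>R x)) (lattice_vec n))) summable_on UNIV"
    "\<And>i c. (\<Sum>\<^sub>\<infinity>n. norm ((diffop c ^^ N) (\<lambda>x. q ((1 / 2 ^ i) *\<^sub>R x)) (lattice_vec n))) \<le> C * (2 ^ i) ^ CARD('k) / (2 ^ i) ^ N"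
    using diffop_pow_scaled_bound[OF q, of N] by metis
  have "norm (1 - psi (axis c 1) z) ^ N * norm (latsum (\<lambda>x. q ((1 / 2 ^ i) *\<^sub>R x)) z)
      \<le> C * (2 ^ i) ^ CARD('k) / (2 ^ i) ^ N" for i z c
  proof -
    have "norm (1 - psi (axis c 1) z) ^ N * norm (latsum (\<lambda>x. q ((1 / 2 ^ i) *\<^sub>R x)) z)
       = norm (latsum ((diffop c ^^ N) (\<lambda>x. q ((1 / 2 ^ i) *\<^sub>R x))) z)"
    proof (subst latsum_diffop_pow[of "2 ^ i * R"])
      show "q ((1 / 2 ^ i) *\<^sub>R x) = 0" if "norm x > 2 ^ i * R" for x :: "real^'k"
        using that by (intro R(2)) (simp add: field_simps)
    qed (use R in \<open>auto simp: norm_mult norm_power\<close>)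
    also have "\<dots> \<le> (\<Sum>\<^sub>\<infinity>n. norm ((diffop c ^^ N) (\<lambda>x. q ((1 / 2 ^ i) *\<^sub>R x)) (lattice_vec n) * psi (lattice_vec n) z))"
      unfolding latsum_def by (rule norm_infsum_bound) (use C(2) in \<open>simp add: norm_mult\<close>)
    also have "\<dots> \<le> C * (2 ^ i) ^ CARD('k) / (2 ^ i) ^ N" using C(3) by (simp add: norm_mult)
    finally show ?thesis .
  qed
  with C(1) show ?thesis by blast
qed

text \<open>Letting the mesh tend to \<open>0\<close> turns summation by parts into the decay of Fourier transforms.\<close>

lemma fourier_coord_decay:
  fixes q :: "real^'k::finite \<Rightarrow> complex"
  assumes q: "q \<in> test_fns"
  shows "\<exists>C\<ge>0. \<forall>y c. \<bar>y $ c\<bar> ^ N * norm (fourier q y) \<le> C"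
proof -
  obtain C where C: "C \<ge> 0" "\<And>i z c. norm (1 - psi (axis c 1) z) ^ N * norm (latsum (\<lambda>x. q ((1 / 2 ^ i) *\<^sub>R x)) z)
      \<le> C * (2 ^ i) ^ CARD('k) / (2 ^ i) ^ N"
    using latsum_scaled_decay[OF q, of N] by metis
  have "\<bar>y $ c\<bar> ^ N * norm (fourier q y) \<le> C" for y c
  proof -
    let ?z = "\<lambda>i::nat. (1 / 2 ^ i) *\<^sub>R y"
    let ?w = "2 * of_real pi * \<i> * of_real (y $ c) :: complex"
    have pw: "(\<lambda>i. (1 / 2::real) ^ i) \<longlonglongrightarrow> 0" by (intro LIMSEQ_realpow_zero) auto
    have "(\<lambda>i. 2 ^ i * (psi (axis c 1) (?z i) - 1) - ?w) \<longlonglongrightarrow> 0"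
    proof (rule Lim_null_comparison)
      show "\<forall>\<^sub>F i in sequentially. norm (2 ^ i * (psi (axis c 1) (?z i) - 1) - ?w) \<le> (2 * pi)\<^sup>2 * (norm y)\<^sup>2 * (1 / 2) ^ i"
      proof (intro always_eventually allI)
        fix i :: nat
        have "2 ^ i * (psi (axis c 1) (?z i) - 1) - ?w
           = 2 ^ i * (psi (axis c 1) (?z i) - 1 - 2 * of_real pi * \<i> * of_real (axis c 1 \<bullet> ?z i))"
          by (simp add: inner_axis' right_diff_distrib)
        also have "norm \<dots> \<le> 2 ^ i * ((2 * pi)\<^sup>2 * (norm (?z i))\<^sup>2)"
          using norm_psi_increment_le[of "axis c 1" 0 "?z i"] by (simp add: norm_mult norm_power)
        also have "\<dots> = (2 * pi)\<^sup>2 * (norm y)\<^sup>2 * (1 / 2) ^ i"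
          by (simp add: power_divide power2_eq_square)
        finally show "norm (2 ^ i * (psi (axis c 1) (?z i) - 1) - ?w) \<le> (2 * pi)\<^sup>2 * (norm y)\<^sup>2 * (1 / 2) ^ i" .
      qed
      show "(\<lambda>i. (2 * pi)\<^sup>2 * (norm y)\<^sup>2 * (1 / 2) ^ i) \<longlonglongrightarrow> 0"
        using tendsto_mult[OF tendsto_const pw] by simp
    qed
    then have "(\<lambda>i. norm (2 ^ i * (psi (axis c 1) (?z i) - 1))) \<longlonglongrightarrow> norm ?w"
      by (intro tendsto_norm) (simp add: LIM_zero_iff)
    then have lim1: "(\<lambda>i. 2 ^ i * norm (1 - psi (axis c 1) (?z i))) \<longlonglongrightarrow> 2 * pi * \<bar>y $ c\<bar>"
      by (simp add: norm_mult norm_power norm_minus_commute)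
    have lim: "(\<lambda>i. (2 ^ i * norm (1 - psi (axis c 1) (?z i))) ^ N *
        norm ((1 / 2 ^ i) ^ CARD('k) * latsum (\<lambda>x. q ((1 / 2 ^ i) *\<^sub>R x)) (?z i)))
      \<longlonglongrightarrow> (2 * pi * \<bar>y $ c\<bar>) ^ N * norm (fourier q y)"
      by (intro tendsto_mult tendsto_power tendsto_norm lim1 latsum_tendsto_fourier q)
    have "(2 * pi * \<bar>y $ c\<bar>) ^ N * norm (fourier q y) \<le> C"
    proof (rule LIMSEQ_le_const2[OF lim], intro exI allI impI)
      fix i :: nat
      have "(2 ^ i * norm (1 - psi (axis c 1) (?z i))) ^ N *
        norm ((1 / 2 ^ i) ^ CARD('k) * latsum (\<lambda>x. q ((1 / 2 ^ i) *\<^sub>R x)) (?z i))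
        = (2 ^ i) ^ N * (1 / 2 ^ i) ^ CARD('k) * (norm (1 - psi (axis c 1) (?z i)) ^ N * norm (latsum (\<lambda>x. q ((1 / 2 ^ i) *\<^sub>R x)) (?z i)))"
        by (simp add: norm_mult norm_power norm_divide power_mult_distrib)
      also have "\<dots> \<le> (2 ^ i) ^ N * (1 / 2 ^ i) ^ CARD('k) * (C * (2 ^ i) ^ CARD('k) / (2 ^ i) ^ N)"
        by (intro mult_left_mono C) auto
      also have "\<dots> = C" by (simp add: power_divide)
      finally show "(2 ^ i * norm (1 - psi (axis c 1) (?z i))) ^ N *
        norm ((1 / 2 ^ i) ^ CARD('k) * latsum (\<lambda>x. q ((1 / 2 ^ i) *\<^sub>R x)) (?z i)) \<le> C" .
    qed
    moreover have "\<bar>y $ c\<bar> ^ N \<le> (2 * pi * \<bar>y $ c\<bar>) ^ N"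
      using pi_gt3 mult_right_mono[of 1 "2 * pi" "\<bar>y $ c\<bar>"] by (intro power_mono) auto
    ultimately show ?thesis using mult_right_mono[OF _ norm_ge_zero[of "fourier q y"]] order_trans by blast
  qed
  with C(1) show ?thesis by blast
qed

text \<open>At each \<open>y\<close> the largest coordinate controls the norm up to a factor \<open>k\<close>, so decay in every single coordinate suffices.\<close>

lemma fourier_decay:
  fixes q :: "real^'k::finite \<Rightarrow> complex"
  assumes q: "q \<in> test_fns"
  shows "\<exists>C\<ge>0. \<forall>y. (1 + norm y) ^ N * norm (fourier q y) \<le> C"
proof -
  obtain C0 CN where C: "C0 \<ge> 0" "CN \<ge> 0" "\<And>y c. \<bar>y $ c\<bar> ^ 0 * norm (fourier q y) \<le> C0"
    "\<And>y c. \<bar>y $ c\<bar> ^ N * norm (fourier q y) \<le> CN"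
    using fourier_coord_decay[OF q, of 0] fourier_coord_decay[OF q, of N] by metis
  define K where "K = 1 + real CARD('k)"
  have "(1 + norm y) ^ N * norm (fourier q y) \<le> K ^ N * (C0 + CN)" for y
  proof -
    have "Max (range (\<lambda>c. \<bar>y $ c\<bar>)) \<in> range (\<lambda>c. \<bar>y $ c\<bar>)" by (rule Max_in) auto
    then obtain c where c: "Max (range (\<lambda>c. \<bar>y $ c\<bar>)) = \<bar>y $ c\<bar>" by blast
    then have le: "\<bar>y $ d\<bar> \<le> \<bar>y $ c\<bar>" for d
      using Max_ge[of "range (\<lambda>c. \<bar>y $ c\<bar>)" "\<bar>y $ d\<bar>"] by simp
    have "norm y \<le> (\<Sum>d\<in>UNIV. \<bar>y $ d\<bar>)" by (rule norm_le_l1_cart)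
    also have "\<dots> \<le> real CARD('k) * \<bar>y $ c\<bar>" by (rule sum_bounded_above) (rule le)
    finally have n: "norm y \<le> real CARD('k) * \<bar>y $ c\<bar>" .
    let ?m = "max 1 \<bar>y $ c\<bar>"
    have "real CARD('k) * \<bar>y $ c\<bar> \<le> real CARD('k) * ?m" by (intro mult_left_mono) auto
    then have "1 + norm y \<le> ?m + real CARD('k) * ?m" using n by linarith
    then have "1 + norm y \<le> K * ?m" by (simp add: K_def distrib_right)
    then have "(1 + norm y) ^ N \<le> (K * ?m) ^ N" by (intro power_mono) auto
    also have "\<dots> \<le> K ^ N * (1 + \<bar>y $ c\<bar> ^ N)"
      unfolding power_mult_distrib by (intro mult_left_mono) (auto simp: max_def K_def)
    finally have "(1 + norm y) ^ N * norm (fourier q y) \<le> K ^ N * (1 + \<bar>y $ c\<bar> ^ N) * norm (fourier q y)"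
      by (intro mult_right_mono) auto
    also have "\<dots> = K ^ N * (norm (fourier q y) + \<bar>y $ c\<bar> ^ N * norm (fourier q y))"
      by (simp add: algebra_simps)
    also have "\<dots> \<le> K ^ N * (C0 + CN)"
      using C(3)[of y c] C(4)[of y c] by (intro mult_left_mono add_mono) (auto simp: K_def)
    finally show ?thesis .
  qed
  moreover have "K ^ N * (C0 + CN) \<ge> 0" using C(1,2) by (simp add: K_def)
  ultimately show ?thesis by blast
qed

lemma fourier_schwartz: "q \<in> test_fns \<Longrightarrow> fourier q \<in> schwartz"
proof -
  assume q: "q \<in> test_fns"
  have "bounded (range (\<lambda>x. (1 + norm x) ^ N * norm (partials is (fourier q) x)))" for "is" N
  proof -
    obtain C where "\<And>y. (1 + norm y) ^ N * norm (fourier (\<lambda>x. weight is x * q x) y) \<le> C"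
      using fourier_decay[OF test_fns_weight[OF q], of N "is"] by blast
    then show ?thesis
      unfolding partials_fourier[OF q] bounded_iff by (intro exI[of _ C]) auto
  qed
  then show ?thesis unfolding schwartz_def using smooth_on_fourier[OF q] by blast
qed

section \<open>Aliasing\<close>

definition residue_box :: "nat \<Rightarrow> (int^'k::finite) set" where
  "residue_box m = {j. \<forall>i. 0 \<le> j $ i \<and> j $ i < int m}"

lemma sum_residue_box:
  fixes F :: "'k::finite \<Rightarrow> int \<Rightarrow> complex"
  shows "(\<Sum>j\<in>residue_box m. \<Prod>i\<in>UNIV. F i (j $ i)) = (\<Prod>i\<in>UNIV. \<Sum>a\<in>{0..<int m}. F i a)"
proof -
  have "(\<Prod>i\<in>UNIV. \<Sum>a\<in>{0..<int m}. F i a) = (\<Sum>g\<in>PiE UNIV (\<lambda>_. {0..<int m}). \<Prod>i\<in>UNIV. F i (g i))"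
    by (rule prod_sum_PiE) auto
  also have "\<dots> = (\<Sum>j\<in>residue_box m. \<Prod>i\<in>UNIV. F i (j $ i))"
    by (rule sum.reindex_bij_witness[of _ "\<lambda>j. vec_nth j" "\<lambda>g. \<chi> i. g i"])
      (auto simp: residue_box_def PiE_iff)
  finally show ?thesis by simp
qed

lemma finite_residue_box: "finite (residue_box m :: (int^'k::finite) set)"
  and card_residue_box: "card (residue_box m :: (int^'k::finite) set) = m ^ CARD('k)"
proof -
  have b: "bij_betw vec_nth (residue_box m :: (int^'k) set) (PiE UNIV (\<lambda>_. {0..<int m}))"
    by (rule bij_betwI[of _ _ _ "\<lambda>g. \<chi> i. g i"]) (auto simp: residue_box_def PiE_iff)
  then show "card (residue_box m :: (int^'k) set) = m ^ CARD('k)"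
    by (simp add: bij_betw_same_card card_PiE)
  have "finite (PiE (UNIV::'k set) (\<lambda>_. {0..<int m}))" by (intro finite_PiE) auto
  then show "finite (residue_box m :: (int^'k) set)" using b bij_betw_finite by blast
qed

lemma sum_root_of_unity:
  assumes m: "m > 0"
  shows "(\<Sum>a\<in>{0..<int m}. exp (2 * of_real pi * \<i> * of_real (of_int n * (of_int a / of_nat m))))
     = (if int m dvd n then of_nat m else (0::complex))"
proof -
  define w where "w = exp (2 * of_real pi * \<i> * of_real (of_int n / of_nat m))"
  have pw: "exp (2 * of_real pi * \<i> * of_real (of_int n * (of_int (int a) / of_nat m))) = w ^ a" for a
    unfolding w_def exp_of_nat_mult[symmetric] by (simp add: algebra_simps)
  have "w ^ m = exp (of_nat m * (2 * of_real pi * \<i> * of_real (of_int n / of_nat m)))"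
    unfolding w_def by (rule exp_of_nat_mult[symmetric])
  also have "\<dots> = 1" using m exp_integer_2pi[of "of_int n"] by (simp add: mult_ac)
  finally have wm: "w ^ m = 1" .
  have w1: "w = 1 \<longleftrightarrow> int m dvd n"
  proof
    assume "w = 1"
    then obtain l :: int where "2 * pi * (of_int n / of_nat m) = of_int (2 * l) * pi"
      unfolding w_def exp_eq_1 by auto
    then have "real_of_int n = of_int (int m * l)" using m by (simp add: field_simps)
    then show "int m dvd n" by (metis of_int_eq_iff dvd_triv_left)
  next
    assume "int m dvd n"
    then obtain l where "n = int m * l" by blast
    then show "w = 1" using m exp_integer_2pi[of "of_int l"] by (simp add: w_def mult_ac)
  qed
  have "(\<Sum>a\<in>{0..<int m}. exp (2 * of_real pi * \<i> * of_real (of_int n * (of_int a / of_nat m)))) = (\<Sum>a<m. w ^ a)"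
    by (rule sum.reindex_bij_witness[of _ int nat]) (auto simp: pw[symmetric])
  also have "\<dots> = (if int m dvd n then of_nat m else 0)"
    using w1 wm by (auto simp: geometric_sum)
  finally show ?thesis .
qed

lemma sum_psi_residue_box:
  fixes n :: "int^'k::finite"
  assumes m: "m > 0"
  shows "(\<Sum>j\<in>residue_box m. psi (lattice_vec n) ((1 / real m) *\<^sub>R lattice_vec j))
     = (if \<forall>i. int m dvd n $ i then of_nat m ^ CARD('k) else 0)"
proof -
  have "psi (lattice_vec n) ((1 / real m) *\<^sub>R lattice_vec j)
     = (\<Prod>i\<in>UNIV. exp (2 * of_real pi * \<i> * of_real (of_int (n $ i) * (of_int (j $ i) / of_nat m))))" for j
    by (simp add: psi_def inner_eq_sum_coords flip: exp_sum) (simp add: sum_distrib_left mult_ac)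
  then have "(\<Sum>j\<in>residue_box m. psi (lattice_vec n) ((1 / real m) *\<^sub>R lattice_vec j))
     = (\<Prod>i\<in>UNIV. if int m dvd n $ i then of_nat m else 0)"
    by (simp only: sum_residue_box[where F = "\<lambda>i a. exp (2 * of_real pi * \<i> * of_real (of_int (n $ i) * (of_int a / of_nat m)))"] sum_root_of_unity[OF m])
  also have "\<dots> = (if \<forall>i. int m dvd n $ i then of_nat m ^ CARD('k) else 0)"
    by (auto simp: prod_constant)
  finally show ?thesis .
qed

text \<open>By orthogonality of characters, averaging over the shifts of the frequency by \<open>j/m\<close> leaves
  only the lattice points divisible by \<open>m\<close>.\<close>

lemma latsum_aliasing:
  fixes Q :: "real^'k::finite \<Rightarrow> complex"
  assumes m: "m > 0" and R: "\<And>x. norm x > R \<Longrightarrow> Q x = 0" "R \<ge> 0"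
  shows "(\<Sum>j\<in>residue_box m. latsum Q ((1 / real m) *\<^sub>R (z + lattice_vec j)))
     = of_nat m ^ CARD('k) * latsum (\<lambda>x. Q (real m *\<^sub>R x)) z"
proof -
  let ?A = "{n::int^'k. norm (lattice_vec n) \<le> R}"
  let ?G = "\<lambda>n. Q (lattice_vec n) * psi (lattice_vec n) ((1 / real m) *\<^sub>R z)"
  let ?D = "\<lambda>n::int^'k. \<forall>i. int m dvd n $ i"
  let ?s = "\<lambda>n::int^'k. (\<chi> i. int m * n $ i) :: int^'k"
  have "(\<Sum>j\<in>residue_box m. latsum Q ((1 / real m) *\<^sub>R (z + lattice_vec j)))
     = (\<Sum>j\<in>residue_box m. \<Sum>n\<in>?A. ?G n * psi (lattice_vec n) ((1 / real m) *\<^sub>R lattice_vec j))"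
    by (simp add: latsum_eq_sum[OF R] scaleR_right_distrib psi_add_right mult.assoc)
  also have "\<dots> = (\<Sum>n\<in>?A. ?G n * (\<Sum>j\<in>residue_box m. psi (lattice_vec n) ((1 / real m) *\<^sub>R lattice_vec j)))"
    by (subst sum.swap) (simp add: sum_distrib_left)
  also have "\<dots> = (\<Sum>n\<in>?A. ?G n * (if ?D n then of_nat m ^ CARD('k) else 0))"
    by (simp only: sum_psi_residue_box[OF m])
  also have "\<dots> = infsum (\<lambda>n. ?G n * (if ?D n then of_nat m ^ CARD('k) else 0)) ?A"
    by (simp add: finite_lattice_ball[OF R(2)])
  also have "\<dots> = infsum (\<lambda>n. of_nat m ^ CARD('k) * ?G n) (range ?s)"
  proof (rule infsum_cong_neutral)
    fix n assume "n \<in> range ?s - ?A"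
    then show "of_nat m ^ CARD('k) * ?G n = 0" using R by auto
  next
    fix n assume "n \<in> ?A - range ?s"
    have "\<not> ?D n"
    proof
      assume "?D n"
      then have "n = ?s (\<chi> i. n $ i div int m)" by (simp add: vec_eq_iff)
      then show False using \<open>n \<in> ?A - range ?s\<close> by blast
    qed
    then show "?G n * (if ?D n then of_nat m ^ CARD('k) else 0) = 0" by (simp only: if_False mult_zero_right)
  qed auto
  also have "\<dots> = infsum ((\<lambda>n. of_nat m ^ CARD('k) * ?G n) \<circ> ?s) UNIV"
    by (rule infsum_reindex) (use m in \<open>auto simp: inj_on_def vec_eq_iff\<close>)
  also have "\<dots> = of_nat m ^ CARD('k) * latsum (\<lambda>x. Q (real m *\<^sub>R x)) z"
  proof -
    have "lattice_vec (?s n) = real m *\<^sub>R lattice_vec n" for n by (simp add: vec_eq_iff)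
    then show ?thesis
      using m by (simp add: latsum_def o_def infsum_cmult_right' psi_scaleR_left)
  qed
  finally show ?thesis .
qed

text \<open>Applied with \<open>m = 2\<close> along the dyadic scales, aliasing does the work of the Poisson
  summation formula: the sum over a mesh and the sum over the mesh twice as fine differ only by
  sums at frequencies away from the lattice, which are negligible.\<close>

lemma latsum_near_0:
  fixes q :: "real^'k::finite \<Rightarrow> complex"
  assumes q: "q \<in> test_fns"
  shows "\<exists>C\<ge>0. \<forall>i y. (\<forall>c. \<bar>y $ c\<bar> \<le> 1/2) \<longrightarrow>
    norm (latsum (\<lambda>x. q ((1 / 2 ^ i) *\<^sub>R x)) y - (2 ^ i) ^ CARD('k) * fourier q (2 ^ i *\<^sub>R y)) \<le> C / (2 ^ i) ^ N"
proof -
  obtain R where R: "R > 0" "\<And>x. norm x > R \<Longrightarrow> q x = 0" using test_fns_support[OF q] by blast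
  define S where "S = (\<lambda>i::nat. latsum (\<lambda>x. q ((1 / 2 ^ i) *\<^sub>R x)))"
  obtain C where C: "C \<ge> 0" "\<And>i z c. norm (1 - psi (axis c 1) z) ^ (N + CARD('k)) * norm (S i z)
      \<le> C * (2 ^ i) ^ CARD('k) / (2 ^ i) ^ (N + CARD('k))"
    unfolding S_def using latsum_scaled_decay[OF q, of "N + CARD('k)"] by metis
  have step: "norm (S i y - (1 / 2) ^ CARD('k) * S (Suc i) ((1 / 2) *\<^sub>R y)) \<le> C / (2 ^ i) ^ N"
    if y: "\<forall>c. \<bar>y $ c\<bar> \<le> 1/2" for i y
  proof -
    have "(\<Sum>j\<in>residue_box 2. S (Suc i) ((1 / real 2) *\<^sub>R (y + lattice_vec j))) = of_nat 2 ^ CARD('k) * S i y"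
    proof -
      have "(\<Sum>j\<in>residue_box 2. S (Suc i) ((1 / real 2) *\<^sub>R (y + lattice_vec j)))
        = of_nat 2 ^ CARD('k) * latsum (\<lambda>x. q ((1 / 2 ^ Suc i) *\<^sub>R (real 2 *\<^sub>R x))) y"
        unfolding S_def
      proof (rule latsum_aliasing[of _ "2 ^ Suc i * R"])
        show "q ((1 / 2 ^ Suc i) *\<^sub>R x) = 0" if "norm x > 2 ^ Suc i * R" for x :: "real^'k"
          using that by (intro R(2)) (simp add: field_simps)
      qed (use R in auto)
      then show ?thesis by (simp add: S_def)
    qed
    moreover have "(0::int^'k) \<in> residue_box 2" by (simp add: residue_box_def)
    ultimately have "S (Suc i) ((1 / 2) *\<^sub>R y) + (\<Sum>j\<in>residue_box 2 - {0}. S (Suc i) ((1 / 2) *\<^sub>R (y + lattice_vec j)))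
        = 2 ^ CARD('k) * S i y"
      using sum.remove[OF finite_residue_box, of "0::int^'k" 2 "\<lambda>j. S (Suc i) ((1 / 2) *\<^sub>R (y + lattice_vec j))"] by simp
    then have "S i y - (1 / 2) ^ CARD('k) * S (Suc i) ((1 / 2) *\<^sub>R y)
       = (1 / 2) ^ CARD('k) * (\<Sum>j\<in>residue_box 2 - {0}. S (Suc i) ((1 / 2) *\<^sub>R (y + lattice_vec j)))"
      by (simp add: power_divide field_simps)
    also have "norm \<dots> \<le> (1 / 2) ^ CARD('k) * (real (card (residue_box 2 - {0::int^'k})) * (C / (2 ^ i) ^ N))"
      unfolding norm_mult
    proof (intro mult_mono sum_norm_bound)
      fix j :: "int^'k" assume j: "j \<in> residue_box 2 - {0}"
      \<comment> \<open>In a coordinate \<open>c\<close> with \<open>j\<^sub>c = 1\<close> the frequency is \<open>(y\<^sub>c + 1)/2\<close>, at distance at least \<open>1/4\<close> from the integers.\<close>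
      then obtain c where "j $ c \<noteq> 0" by (auto simp: vec_eq_iff)
      moreover have "0 \<le> j $ c \<and> j $ c < 2" using j by (auto simp: residue_box_def)
      ultimately have jc: "j $ c = 1" by linarith
      let ?z = "(1 / 2) *\<^sub>R (y + lattice_vec j)"
      have "psi (axis c 1) ?z = exp (\<i> * of_real (pi * (y $ c)) + \<i> * of_real pi)"
      proof -
        have "2 * of_real pi * \<i> * of_real ((y $ c + 1) / 2) = \<i> * of_real (pi * (y $ c)) + \<i> * of_real pi"
          by (simp add: complex_eq_iff algebra_simps)
        then show ?thesis using jc by (simp add: psi_def inner_axis')
      qed
      also have "\<dots> = - exp (\<i> * of_real (pi * (y $ c)))"
        by (simp only: exp_add exp_pi_i') simp
      finally have p: "1 - psi (axis c 1) ?z = 1 + exp (\<i> * of_real (pi * (y $ c)))" by simp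
      have "\<bar>pi * (y $ c)\<bar> \<le> pi / 2"
        using y[rule_format, of c] mult_left_mono[of "\<bar>y $ c\<bar>" "1/2" pi] by (simp add: abs_mult)
      then have "cos (pi * (y $ c)) \<ge> 0" unfolding abs_le_iff by (intro cos_ge_zero) linarith+
      then have "1 \<le> Re (1 - psi (axis c 1) ?z)" unfolding p by (simp add: Re_exp)
      also have "\<dots> \<le> norm (1 - psi (axis c 1) ?z)" by (rule complex_Re_le_cmod)
      finally have "1 \<le> norm (1 - psi (axis c 1) ?z) ^ (N + CARD('k))" by (rule one_le_power)
      then have "norm (S (Suc i) ?z) \<le> norm (1 - psi (axis c 1) ?z) ^ (N + CARD('k)) * norm (S (Suc i) ?z)"
        using mult_right_mono[of 1 _ "norm (S (Suc i) ?z)"] by simp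
      also have "\<dots> \<le> C * (2 ^ Suc i) ^ CARD('k) / (2 ^ Suc i) ^ (N + CARD('k))" by (rule C(2))
      also have "\<dots> = C / (2 ^ Suc i) ^ N" by (simp add: power_add)
      also have "\<dots> \<le> C / (2 ^ i) ^ N"
        using C(1) by (intro divide_left_mono power_mono) auto
      finally show "norm (S (Suc i) ?z) \<le> C / (2 ^ i) ^ N" .
    qed (use C(1) in \<open>auto simp: norm_power norm_divide\<close>)
    also have "\<dots> \<le> (1 / 2) ^ CARD('k) * (2 ^ CARD('k) * (C / (2 ^ i) ^ N))"
    proof (intro mult_left_mono mult_right_mono)
      have "card (residue_box 2 - {0::int^'k}) \<le> 2 ^ CARD('k)"
        using card_mono[OF finite_residue_box, of "residue_box 2 - {0::int^'k}" 2] by (simp add: card_residue_box)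
      then show "real (card (residue_box 2 - {0::int^'k})) \<le> 2 ^ CARD('k)"
        by (metis of_nat_le_iff of_nat_numeral of_nat_power)
    qed (use C(1) in auto)
    also have "\<dots> = C / (2 ^ i) ^ N" by (simp add: power_divide)
    finally show ?thesis .
  qed
  have "norm (S i y - (2 ^ i) ^ CARD('k) * fourier q (2 ^ i *\<^sub>R y)) \<le> 2 * C / (2 ^ i) ^ N"
    if y: "\<forall>c. \<bar>y $ c\<bar> \<le> 1/2" for i y
  proof -
    \<comment> \<open>Refining the mesh \<open>p\<close> times: \<open>T 0\<close> is the lattice sum, the limit is the Fourier transform, and consecutive terms are close by the previous step.\<close>
    define T where "T = (\<lambda>p::nat. (1 / 2 ^ p) ^ CARD('k) * S (i + p) ((1 / 2 ^ p) *\<^sub>R y))"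
    define K where "K = C / (2 ^ i) ^ N"
    have K: "K \<ge> 0" using C(1) by (simp add: K_def)
    have Tstep: "norm (T p - T (Suc p)) \<le> K * (1 / 2) ^ p" for p
    proof -
      have "T p - T (Suc p) = (1 / 2 ^ p) ^ CARD('k) *
          (S (i + p) ((1 / 2 ^ p) *\<^sub>R y) - (1 / 2) ^ CARD('k) * S (Suc (i + p)) ((1 / 2) *\<^sub>R ((1 / 2 ^ p) *\<^sub>R y)))"
        by (simp add: T_def power_divide power_mult_distrib field_simps)
      also have "norm \<dots> \<le> (1 / 2) ^ p * K"
        unfolding norm_mult
      proof (intro mult_mono)
        have "(1 / 2 ^ p :: real) ^ CARD('k) \<le> (1 / 2 ^ p) ^ 1"
          by (rule power_decreasing) (auto simp: Suc_leI)
        then show "norm ((1 / 2 ^ p) ^ CARD('k) :: complex) \<le> (1 / 2) ^ p"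
          by (simp add: norm_power norm_divide power_divide)
        have "\<bar>((1 / 2 ^ p) *\<^sub>R y) $ c\<bar> \<le> 1/2" for c
        proof -
          have "\<bar>y $ c\<bar> / 2 ^ p \<le> \<bar>y $ c\<bar> / 1" by (intro divide_left_mono) auto
          moreover have "\<bar>((1 / 2 ^ p) *\<^sub>R y) $ c\<bar> = \<bar>y $ c\<bar> / 2 ^ p" by (simp add: abs_mult)
          ultimately show ?thesis using y[rule_format, of c] by linarith
        qed
        then have "norm (S (i + p) ((1 / 2 ^ p) *\<^sub>R y) - (1 / 2) ^ CARD('k) * S (Suc (i + p)) ((1 / 2) *\<^sub>R ((1 / 2 ^ p) *\<^sub>R y)))
          \<le> C / (2 ^ (i + p)) ^ N" by (intro step) auto
        also have "\<dots> \<le> K" unfolding K_def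
          using C(1) by (intro divide_left_mono power_mono power_increasing) auto
        finally show "norm (S (i + p) ((1 / 2 ^ p) *\<^sub>R y) - (1 / 2) ^ CARD('k) * S (Suc (i + p)) ((1 / 2) *\<^sub>R ((1 / 2 ^ p) *\<^sub>R y))) \<le> K" .
      qed auto
      finally show ?thesis by (simp add: mult.commute)
    qed
    have Tsum: "norm (T 0 - T p) \<le> K * (2 - 2 * (1 / 2) ^ p)" for p
    proof (induction p)
      case (Suc p)
      have "norm (T 0 - T (Suc p)) \<le> norm (T 0 - T p) + norm (T p - T (Suc p))"
        using norm_triangle_ineq[of "T 0 - T p" "T p - T (Suc p)"] by simp
      also have "\<dots> \<le> K * (2 - 2 * (1 / 2) ^ p) + K * (1 / 2) ^ p"
        using Suc Tstep by (intro add_mono) auto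
      also have "\<dots> = K * (2 - 2 * (1 / 2) ^ Suc p)" by (simp add: algebra_simps)
      finally show ?case .
    qed simp
    have bd: "norm (T 0 - T p) \<le> 2 * K" for p
      using Tsum[of p] K mult_left_mono[of "2 - 2 * (1 / 2) ^ p" 2 K] by (simp add: mult.commute)
    have "(\<lambda>p. (2 ^ i) ^ CARD('k) * ((1 / 2 ^ (p + i)) ^ CARD('k) * S (p + i) ((1 / 2 ^ (p + i)) *\<^sub>R (2 ^ i *\<^sub>R y))))
        \<longlonglongrightarrow> (2 ^ i) ^ CARD('k) * fourier q (2 ^ i *\<^sub>R y)"
      unfolding S_def
      by (intro tendsto_mult tendsto_const LIMSEQ_ignore_initial_segment[OF latsum_tendsto_fourier[OF q]])
    moreover have "(2 ^ i) ^ CARD('k) * ((1 / 2 ^ (p + i)) ^ CARD('k) * S (p + i) ((1 / 2 ^ (p + i)) *\<^sub>R (2 ^ i *\<^sub>R y))) = T p" for p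
      by (simp add: T_def power_add power_divide power_mult_distrib add.commute)
    ultimately have "T \<longlonglongrightarrow> (2 ^ i) ^ CARD('k) * fourier q (2 ^ i *\<^sub>R y)" by (simp only:)
    then have "(\<lambda>p. norm (T 0 - T p)) \<longlonglongrightarrow> norm (T 0 - (2 ^ i) ^ CARD('k) * fourier q (2 ^ i *\<^sub>R y))"
      by (intro tendsto_norm tendsto_diff tendsto_const)
    then have "norm (T 0 - (2 ^ i) ^ CARD('k) * fourier q (2 ^ i *\<^sub>R y)) \<le> 2 * K"
      by (rule LIMSEQ_le_const2) (use bd in auto)
    then show ?thesis by (simp add: T_def K_def)
  qed
  then show ?thesis
    unfolding S_def using C(1) by (intro exI[of _ "2 * C"]) auto
qed

section \<open>The complement of the lattice\<close>

lemma off_lattice_coord: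
  fixes y :: "real^'k::finite"
  assumes "y \<notin> range lattice_vec"
  obtains c where "psi (axis c 1) y \<noteq> 1"
proof -
  have "\<exists>c. y $ c \<notin> \<int>"
  proof (rule ccontr)
    assume "\<nexists>c. y $ c \<notin> \<int>"
    then have "y = lattice_vec (\<chi> c. \<lfloor>y $ c\<rfloor>)" by (simp add: vec_eq_iff)
    with assms show False by blast
  qed
  then obtain c where c: "y $ c \<notin> \<int>" by blast
  have "psi (axis c 1) y \<noteq> 1"
  proof
    assume "psi (axis c 1) y = 1"
    then obtain l :: int where "2 * pi * (y $ c) = of_int (2 * l) * pi"
      unfolding psi_def exp_eq_1 by (auto simp: inner_axis')
    then have "y $ c = of_int l" by simp
    with c show False by simp
  qed
  then show ?thesis using that by blast
qed

lemma open_off_lattice: "open (- range (lattice_vec :: int^'k::finite \<Rightarrow> _))"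
proof -
  have "- range (lattice_vec :: int^'k \<Rightarrow> _) = (\<Union>c. {y. psi (axis c 1) y \<noteq> 1})"
  proof (intro equalityI subsetI)
    fix y :: "real^'k" assume "y \<in> (\<Union>c. {y. psi (axis c 1) y \<noteq> 1})"
    then obtain c where "psi (axis c 1) y \<noteq> 1" by blast
    moreover have "psi (axis c 1) (lattice_vec n) = 1" for n
      using psi_lattice[of "axis c 1" n] by (simp add: lattice_vec_axis)
    ultimately show "y \<in> - range lattice_vec" by auto
  next
    fix y :: "real^'k" assume "y \<in> - range lattice_vec"
    then obtain c where "psi (axis c 1) y \<noteq> 1" using off_lattice_coord[of y] by auto
    then show "y \<in> (\<Union>c. {y. psi (axis c 1) y \<noteq> 1})" by blast
  qed
  moreover have "open {y::real^'k. psi (axis c 1) y \<noteq> 1}" for c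
    by (intro open_Collect_neq continuous_intros)
  ultimately show ?thesis by auto
qed

text \<open>A neighbourhood of \<open>0\<close> on which \<open>latsum_near_0\<close> applies and which meets the lattice in \<open>0\<close> only.\<close>

abbreviation half_box :: "(real^'k::finite) set" where
  "half_box \<equiv> {y. \<forall>c. \<bar>y $ c\<bar> < 1/2}"

lemma open_half_box: "open (half_box :: (real^'k::finite) set)"
proof -
  have "(half_box :: (real^'k) set) = (\<Inter>c. {y. \<bar>y $ c\<bar> < 1/2})" by auto
  moreover have "open {y::real^'k. \<bar>y $ c\<bar> < 1/2}" for c
    by (intro open_Collect_less continuous_intros)
  ultimately show ?thesis by (simp add: open_INT)
qed

lemma half_box_lattice: "y \<in> half_box \<Longrightarrow> y \<in> range lattice_vec \<Longrightarrow> y = 0"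
proof -
  assume y: "y \<in> half_box" "y \<in> range lattice_vec"
  then obtain n where n: "y = lattice_vec n" by blast
  have "n $ c = 0" for c
  proof -
    have "\<bar>real_of_int (n $ c)\<bar> < 1/2" using y(1) n by auto
    then show ?thesis by linarith
  qed
  then show "y = 0" using n by (simp add: vec_eq_iff)
qed

lemma punctured_domain_eq: "(punctured_domain :: (real^'k::finite) set) = - range lattice_vec \<union> half_box"
proof (intro equalityI subsetI)
  fix y :: "real^'k" assume y: "y \<in> punctured_domain"
  show "y \<in> - range lattice_vec \<union> half_box"
  proof (cases "y \<in> range lattice_vec")
    case True
    then obtain n where n: "y = lattice_vec n" by blast
    with y have "n = 0" by (auto simp: punctured_domain_def)
    then show ?thesis using n by simp
  qed simp
next
  fix y :: "real^'k" assume y: "y \<in> - range lattice_vec \<union> half_box"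
  show "y \<in> punctured_domain"
    unfolding punctured_domain_def
  proof
    assume "y \<in> lattice_vec ` (- {0})"
    then obtain n where n: "y = lattice_vec n" "n \<noteq> 0" by blast
    with y have "y \<in> half_box" by auto
    with half_box_lattice[of y] n have "y = 0" by blast
    with n show False using lattice_vec_eq_iff[of n 0] by simp
  qed
qed

section \<open>T-summability\<close>

lemma has_sum_shift:
  fixes A :: "int^'k::finite \<Rightarrow> 'b::{comm_monoid_add,t2_space}"
  assumes "(A has_sum S) UNIV" shows "((\<lambda>n. A (n - m)) has_sum S) UNIV"
proof -
  have "bij_betw (\<lambda>n. n - m) UNIV (UNIV :: (int^'k) set)"
    by (rule bij_betwI[of _ _ _ "\<lambda>n. n + m"]) auto
  from has_sum_reindex_bij_betw[OF this, of A S] assms show ?thesis by simp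
qed

lemma has_sum_conv:
  assumes "(A has_sum S) UNIV" "finite {m. c m \<noteq> 0}"
  shows "(conv c A has_sum (\<Sum>m | c m \<noteq> 0. c m) * S) UNIV"
proof -
  have "((\<lambda>n. \<Sum>m\<in>F. c m * A (n - m)) has_sum (\<Sum>m\<in>F. c m) * S) UNIV" if "finite F" for F
    using that
  proof (induction F)
    case (insert m F)
    have "((\<lambda>n. c m * A (n - m) + (\<Sum>m\<in>F. c m * A (n - m))) has_sum c m * S + (\<Sum>m\<in>F. c m) * S) UNIV"
      by (intro has_sum_add has_sum_cmult_right has_sum_shift assms insert.IH)
    with insert.hyps show ?case by (simp add: distrib_right)
  qed simp
  from this[OF assms(2)] show ?thesis unfolding conv_def[abs_def] .
qed

lemma conv_commute: "conv c (conv c' a) = conv c' (conv c a)"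
proof
  fix n
  have "conv c (conv c' a) n = (\<Sum>m | c m \<noteq> 0. \<Sum>m' | c' m' \<noteq> 0. c m * (c' m' * a (n - m - m')))"
    by (simp add: conv_def sum_distrib_left)
  also have "\<dots> = (\<Sum>m' | c' m' \<noteq> 0. \<Sum>m | c m \<noteq> 0. c m * (c' m' * a (n - m - m')))"
    by (rule sum.swap)
  also have "\<dots> = conv c' (conv c a) n"
    by (simp add: conv_def sum_distrib_left) (simp add: algebra_simps)
  finally show "conv c (conv c' a) n = conv c' (conv c a) n" .
qed

text \<open>Two witnesses \<open>c\<close> and \<open>c'\<close> give the same value because summing \<open>c * (c' * a) = c' * (c * a)\<close> in both ways
  yields \<open>(\<Sum>c) (\<Sum>c' * a) = (\<Sum>c') (\<Sum>c * a)\<close>.\<close>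

lemma t_sum_eq:
  assumes "t_summing c a"
  shows "t_sum a = infsum (conv c a) UNIV / (\<Sum>m | c m \<noteq> 0. c m)"
  unfolding t_sum_def
proof (rule the_equality)
  show "\<exists>c'. t_summing c' a \<and> infsum (conv c a) UNIV / (\<Sum>m | c m \<noteq> 0. c m)
      = infsum (conv c' a) UNIV / (\<Sum>m | c' m \<noteq> 0. c' m)"
    using assms by blast
next
  fix S assume "\<exists>c'. t_summing c' a \<and> S = infsum (conv c' a) UNIV / (\<Sum>m | c' m \<noteq> 0. c' m)"
  then obtain c' where c': "t_summing c' a" "S = infsum (conv c' a) UNIV / (\<Sum>m | c' m \<noteq> 0. c' m)" by blast
  have hs: "(conv d a has_sum infsum (conv d a) UNIV) UNIV" if "t_summing d a" for d
    using that abs_summable_summable unfolding t_summing_def by (blast intro: has_sum_infsum)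
  have "(conv c (conv c' a) has_sum (\<Sum>m | c m \<noteq> 0. c m) * infsum (conv c' a) UNIV) UNIV"
    using assms c'(1) by (intro has_sum_conv hs) (auto simp: t_summing_def)
  moreover have "(conv c (conv c' a) has_sum (\<Sum>m | c' m \<noteq> 0. c' m) * infsum (conv c a) UNIV) UNIV"
    unfolding conv_commute[of c c'] using assms c'(1) by (intro has_sum_conv hs) (auto simp: t_summing_def)
  ultimately have "(\<Sum>m | c m \<noteq> 0. c m) * infsum (conv c' a) UNIV = (\<Sum>m | c' m \<noteq> 0. c' m) * infsum (conv c a) UNIV"
    by (rule has_sum_unique)
  moreover have nz: "(\<Sum>m | c m \<noteq> 0. c m) \<noteq> 0" "(\<Sum>m | c' m \<noteq> 0. c' m) \<noteq> 0"
    using assms c'(1) by (auto simp: t_summing_def)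
  ultimately show "S = infsum (conv c a) UNIV / (\<Sum>m | c m \<noteq> 0. c m)"
    unfolding c'(2) by (simp add: frac_eq_eq mult.commute)
qed

text \<open>The twisted difference \<open>a(n) - w a(n - e)\<close>; for \<open>w = \<psi>(e, y)\<close> it acts on \<open>f(n) \<psi>(n, y)\<close>
  as the difference of \<open>f\<close>, while its coefficients sum to \<open>1 - w \<noteq> 0\<close>.\<close>

definition twisted_diff :: "complex \<Rightarrow> int^'k::finite \<Rightarrow> (int^'k \<Rightarrow> complex) \<Rightarrow> int^'k \<Rightarrow> complex" where
  "twisted_diff w e a n = a n - w * a (n - e)"

lemma twisted_diff_pow_conv:
  fixes e :: "int^'k::finite"
  shows "\<exists>c. finite {m. c m \<noteq> 0} \<and> (\<Sum>m | c m \<noteq> 0. c m) = (1 - w) ^ N \<and>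
    (\<forall>a. conv c a = (twisted_diff w e ^^ N) a)"
proof (induction N)
  case 0
  have "{m. (if m = 0 then 1 else 0::complex) \<noteq> 0} = {0::int^'k}" by auto
  then show ?case
    by (intro exI[of _ "\<lambda>m. if m = 0 then 1 else 0"]) (simp add: conv_def fun_eq_iff)
next
  case (Suc N)
  then obtain c where c: "finite {m. c m \<noteq> 0}" "(\<Sum>m | c m \<noteq> 0. c m) = (1 - w) ^ N"
    "\<And>a. conv c a = (twisted_diff w e ^^ N) a" by blast
  define c' where "c' = twisted_diff w e c"
  have as_infsum: "(\<Sum>m | d m \<noteq> 0. d m * h m) = (\<Sum>\<^sub>\<infinity>m. d m * h m)" "(\<lambda>m. d m * h m) summable_on UNIV"
    if "finite {m. d m \<noteq> 0}" for d h :: "int^'k \<Rightarrow> complex"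
  proof -
    show "(\<Sum>m | d m \<noteq> 0. d m * h m) = (\<Sum>\<^sub>\<infinity>m. d m * h m)"
      unfolding infsum_finite[OF that, symmetric] by (rule infsum_cong_neutral) auto
    show "(\<lambda>m. d m * h m) summable_on UNIV"
      by (rule finite_nonzero_values_imp_summable_on, rule finite_subset[OF _ that]) auto
  qed
  have fin_shift: "finite {m. c (m - e) \<noteq> 0}"
  proof -
    have "{m. c (m - e) \<noteq> 0} = (\<lambda>m. m + e) ` {m. c m \<noteq> 0}"
      by (auto simp: image_iff intro!: exI[of _ "_ - e"])
    then show ?thesis using c(1) by simp
  qed
  have fin': "finite {m. c' m \<noteq> 0}"
    by (rule finite_subset[OF _ finite_UnI[OF c(1) fin_shift]]) (auto simp: c'_def twisted_diff_def)
  have main: "(\<Sum>m | c' m \<noteq> 0. c' m * h m) = (\<Sum>m | c m \<noteq> 0. c m * h m) - w * (\<Sum>m | c m \<noteq> 0. c m * h (m + e))" for h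
  proof -
    have "(\<Sum>m | c' m \<noteq> 0. c' m * h m) = (\<Sum>\<^sub>\<infinity>m. c m * h m + (- w) * (c (m - e) * h m))"
      unfolding as_infsum(1)[OF fin'] by (simp add: c'_def twisted_diff_def algebra_simps)
    also have "\<dots> = (\<Sum>\<^sub>\<infinity>m. c m * h m) + (\<Sum>\<^sub>\<infinity>m. (- w) * (c (m - e) * h m))"
      by (intro infsum_add summable_on_cmult_right as_infsum(2) c(1) fin_shift)
    also have "(\<Sum>\<^sub>\<infinity>m. (- w) * (c (m - e) * h m)) = (- w) * (\<Sum>\<^sub>\<infinity>m. (\<lambda>m. c m * h (m + e)) (m - e))"
      by (simp only: infsum_cmult_right' diff_add_cancel)
    also have "(\<Sum>\<^sub>\<infinity>m. (\<lambda>m. c m * h (m + e)) (m - e)) = (\<Sum>m | c m \<noteq> 0. c m * h (m + e))"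
      using infsum_shift[of "\<lambda>m. c m * h (m + e)" e] as_infsum(1)[OF c(1), of "\<lambda>m. h (m + e)"] by simp
    finally show ?thesis by (simp add: as_infsum(1)[OF c(1)])
  qed
  have "(\<Sum>m | c' m \<noteq> 0. c' m) = (1 - w) ^ Suc N"
    using main[of "\<lambda>_. 1"] by (simp add: c(2) algebra_simps)
  moreover have "conv c' a = (twisted_diff w e ^^ Suc N) a" for a
  proof
    fix n
    have "conv c' a n = conv c a n - w * conv c a (n - e)"
      unfolding conv_def main by (simp add: diff_diff_eq add.commute)
    then show "conv c' a n = (twisted_diff w e ^^ Suc N) a n"
      by (simp add: c(3) twisted_diff_def[of _ _ _ n])
  qed
  ultimately show ?case using fin' by blast
qed

lemma twisted_diff_psi:
  "twisted_diff (psi (axis c 1) y) (axis c 1) (\<lambda>n. g (lattice_vec n) * psi (lattice_vec n) y)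
     = (\<lambda>n. diffop c g (lattice_vec n) * psi (lattice_vec n) y)"
proof
  fix n :: "int^'a"
  have "psi (axis c 1) y * psi (lattice_vec n - axis c 1) y = psi (lattice_vec n) y"
    by (simp flip: psi_add_left)
  then show "twisted_diff (psi (axis c 1) y) (axis c 1) (\<lambda>n. g (lattice_vec n) * psi (lattice_vec n) y) n
     = diffop c g (lattice_vec n) * psi (lattice_vec n) y"
    by (simp add: twisted_diff_def diffop_def lattice_vec_diff lattice_vec_axis left_diff_distrib mult.left_commute)
qed

lemma twisted_diff_pow_psi:
  "(twisted_diff (psi (axis c 1) y) (axis c 1) ^^ N) (\<lambda>n. g (lattice_vec n) * psi (lattice_vec n) y)
     = (\<lambda>n. (diffop c ^^ N) g (lattice_vec n) * psi (lattice_vec n) y)"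
  by (induction N) (simp_all add: twisted_diff_psi)

lemma twisted_diff_pow_has_sum:
  fixes a :: "'i \<Rightarrow> int^'k::finite \<Rightarrow> complex"
  assumes "\<And>n. ((\<lambda>i. a i n) has_sum b n) UNIV"
  shows "((\<lambda>i. (twisted_diff w e ^^ N) (a i) n) has_sum (twisted_diff w e ^^ N) b n) UNIV"
proof (induction N arbitrary: n)
  case (Suc N)
  have "((\<lambda>i. (twisted_diff w e ^^ N) (a i) n + (- w) * (twisted_diff w e ^^ N) (a i) (n - e)) has_sum
     (twisted_diff w e ^^ N) b n + (- w) * (twisted_diff w e ^^ N) b (n - e)) UNIV"
    by (intro has_sum_add has_sum_cmult_right Suc)
  then show ?case by (simp add: twisted_diff_def[of _ _ _ n])
qed (use assms in simp)

lemma diffop_pow_cmult: "(diffop c ^^ N) (\<lambda>x. \<alpha> * Q x) = (\<lambda>x. \<alpha> * (diffop c ^^ N) Q x)"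
  by (induction N) (simp_all add: diffop_def fun_eq_iff right_diff_distrib)

lemma monomial_torus_exp: "monomial (torus_exp y) n = psi (lattice_vec n) y"
proof -
  have "monomial (torus_exp y) n = (\<Prod>i\<in>UNIV. exp (of_int (n $ i) * (2 * of_real pi * \<i> * of_real (y $ i))))"
    by (simp add: monomial_def torus_exp_def exp_power_int)
  also have "\<dots> = psi (lattice_vec n) y"
    by (simp add: psi_def inner_eq_sum_coords flip: exp_sum) (simp add: sum_distrib_left mult_ac)
  finally show ?thesis .
qed

section \<open>Dyadic decomposition of a homogeneous function\<close>

text \<open>Vanishing outside the open unit ball makes a cutoff disappear at all nonzero lattice points.\<close>

definition cutoff :: "(real^'k::finite \<Rightarrow> complex) \<Rightarrow> bool" where
  "cutoff \<omega> \<longleftrightarrow> \<omega> \<in> test_fns \<and> (\<exists>d>0. \<forall>x. norm x < d \<longrightarrow> \<omega> x = 1) \<and> (\<forall>x. norm x \<ge> 1 \<longrightarrow> \<omega> x = 0)"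

lemma annulus_test_off_0:
  fixes \<omega> :: "real^'k::finite \<Rightarrow> complex"
  assumes "\<omega> \<in> test_fns" "\<exists>d>0. \<forall>x. norm x < d \<longrightarrow> \<omega> x = 1" "a > 0" "b > 0"
  shows "(\<lambda>x. \<omega> (a *\<^sub>R x) - \<omega> (b *\<^sub>R x)) \<in> test_off_0"
proof -
  obtain d where d: "d > 0" "\<And>x. norm x < d \<Longrightarrow> \<omega> x = 1" using assms(2) by blast
  have "\<omega> (a *\<^sub>R x) - \<omega> (b *\<^sub>R x) = 0" if "norm x < min (d / a) (d / b)" for x
    using that assms(3,4) by (simp add: d(2) field_simps)
  moreover have "min (d / a) (d / b) > 0" using d assms by simp
  ultimately show ?thesis
    unfolding test_off_0_iff using assms(3,4)
    by (intro conjI test_fns_diff test_fns_scaleR assms(1) exI[of _ "min (d / a) (d / b)"]) auto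
qed

lemma exists_even_cutoff:
  obtains \<eta> :: "real^'k::finite \<Rightarrow> complex" where "cutoff \<eta>" "\<And>x. \<eta> (- x) = \<eta> x"
proof -
  obtain \<eta> :: "real^'k \<Rightarrow> complex" where \<eta>: "smooth_on UNIV \<eta>" "\<And>x. norm x \<le> 1/4 \<Longrightarrow> \<eta> x = 1"
    "\<And>x. norm x \<ge> 1/2 \<Longrightarrow> \<eta> x = 0" "\<And>x. \<eta> (- x) = \<eta> x" using exists_cutoff by blast
  have "\<eta> \<in> test_fns" by (rule test_fnsI[of _ "1/2"]) (use \<eta> in auto)
  then have "cutoff \<eta>" unfolding cutoff_def using \<eta>(2,3) by (auto intro!: exI[of _ "1/4"])
  with \<eta>(4) that show ?thesis by blast
qed

text \<open>The part of \<open>f\<close> near \<open>\<bar>x\<bar> = 2\<^sup>i\<close>. The parts at small scales, where \<open>i\<close> is negative, are the inner shells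
  below: inner shell \<open>j\<close> belongs to \<open>i = -(j+1)\<close>.\<close>

definition shell ::
    "(real^'k::finite \<Rightarrow> complex) \<Rightarrow> (real^'k \<Rightarrow> complex) \<Rightarrow> nat \<Rightarrow> real^'k \<Rightarrow> complex" where
  "shell f \<omega> i x = f x * (\<omega> ((1 / 2 ^ Suc i) *\<^sub>R x) - \<omega> ((1 / 2 ^ i) *\<^sub>R x))"

lemma sum_shell: "(\<Sum>i<J. shell f \<omega> i x) = f x * (\<omega> ((1 / 2 ^ J) *\<^sub>R x) - \<omega> x)"
  by (induction J) (simp_all add: shell_def algebra_simps)

definition inner_shell ::
    "(real^'k::finite \<Rightarrow> complex) \<Rightarrow> (real^'k \<Rightarrow> complex) \<Rightarrow> nat \<Rightarrow> real^'k \<Rightarrow> complex" where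
  "inner_shell f \<omega> j x = f x * (\<omega> (2 ^ j *\<^sub>R x) - \<omega> (2 ^ Suc j *\<^sub>R x))"

lemma sum_inner_shell: "(\<Sum>j<J. inner_shell f \<omega> j x) = f x * (\<omega> x - \<omega> (2 ^ J *\<^sub>R x))"
  by (induction J) (simp_all add: inner_shell_def algebra_simps)

locale homogeneous_fn =
  fixes f :: "real^'k::finite \<Rightarrow> complex" and s \<epsilon> :: complex
  assumes eps: "\<epsilon> \<in> {1, - 1}"
    and smooth: "smooth_on (- {0}) f"
    and hom: "homogeneous (- s) \<epsilon> f"
begin

lemma f_scaleR: "x \<noteq> 0 \<Longrightarrow> t > 0 \<Longrightarrow> f (t *\<^sub>R x) = of_real t powr (- s) * f x"
  using hom by (simp add: homogeneous_def)

lemma f_minus: "x \<noteq> 0 \<Longrightarrow> f (- x) = \<epsilon> * f x"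
  using hom by (simp add: homogeneous_def)

lemma shell_test_off_0:
  assumes "cutoff \<omega>" shows "shell f \<omega> i \<in> test_off_0"
  unfolding shell_def[abs_def] using assms
  by (intro test_off_0_mult smooth annulus_test_off_0) (auto simp: cutoff_def)

lemma shell_test_fns: "cutoff \<omega> \<Longrightarrow> shell f \<omega> i \<in> test_fns"
  using shell_test_off_0 test_off_0_iff by blast

lemma shell_eq: "shell f \<omega> i x = of_real (2 ^ i) powr (- s) * shell f \<omega> 0 ((1 / 2 ^ i) *\<^sub>R x)"
proof (cases "x = 0")
  case False
  have "f x = of_real (2 ^ i) powr (- s) * f ((1 / 2 ^ i) *\<^sub>R x)"
    using f_scaleR[of "(1 / 2 ^ i) *\<^sub>R x" "2 ^ i"] False by simp
  then show ?thesis by (simp add: shell_def)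
qed (simp add: shell_def)

lemma weight_shell_eq:
  "weight is x * shell f \<omega> i x
     = of_real (2 ^ i) powr (- s) * of_real (2 ^ i) ^ length is * (\<lambda>x. weight is x * shell f \<omega> 0 x) ((1 / 2 ^ i) *\<^sub>R x)"
  by (subst shell_eq) (simp add: weight_scaleR power_divide)

lemma weight_shell_fun:
  "(\<lambda>x. weight is x * shell f \<omega> i x) = (\<lambda>x. of_real (2 ^ i) powr (- s) * of_real (2 ^ i) ^ length is *
     (\<lambda>x. weight is x * shell f \<omega> 0 x) ((1 / 2 ^ i) *\<^sub>R x))"
  by (rule ext) (rule weight_shell_eq)

text \<open>The ratio of the geometric series that bounds \<open>l\<close>-th derivatives of the outer pieces when \<open>N\<close> orders of decay are spent:
  each doubling of the scale contributes \<open>2\<^sup>-\<^sup>s\<close> by homogeneity, \<open>2\<^sup>l\<close> by the weight, \<open>2\<^sup>k\<close> by the volume and \<open>2\<^sup>-\<^sup>N\<close> by the decay.\<close>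

definition gain :: "nat \<Rightarrow> nat \<Rightarrow> real" where
  "gain l N = 2 powr (real CARD('k) + real l - Re s - real N)"

lemma norm_gain:
  "norm (of_real (2 ^ i) powr (- s) * of_real (2 ^ i) ^ l :: complex) * ((2 ^ i) ^ CARD('k) / (2 ^ i) ^ N) = gain l N ^ i"
proof -
  have "norm (of_real r powr (- s) :: complex) = r powr (- Re s)" if "r > 0" for r :: real
    using that by (subst norm_powr_real_powr) auto
  from this[of "2 ^ i"] have "norm (of_real (2 ^ i) powr (- s) :: complex) = (2 ^ i) powr (- Re s)" by simp
  also have "\<dots> = (2 powr (- Re s)) ^ i"
    by (simp add: powr_realpow[symmetric] powr_powr mult.commute)
  finally have 1: "norm (of_real (2 ^ i) powr (- s) :: complex) = (2 powr (- Re s)) ^ i" .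
  have "gain l N = 2 powr (- Re s) * 2 ^ l * 2 ^ CARD('k) / 2 ^ N"
    unfolding gain_def by (simp add: powr_diff powr_add powr_minus powr_realpow field_simps)
  then have "gain l N ^ i = (2 powr (- Re s)) ^ i * (2 ^ l) ^ i * ((2 ^ CARD('k)) ^ i / (2 ^ N) ^ i)"
    by (simp add: power_mult_distrib power_divide)
  then show ?thesis
    unfolding norm_mult 1 by (simp add: norm_power power_mult[symmetric] mult.commute)
qed

lemma exists_gain_less_1: "\<exists>N. \<forall>M\<ge>N. gain l M < 1"
proof -
  obtain N where N: "real N > real CARD('k) + real l - Re s" using reals_Archimedean2 by blast
  have "gain l M < 1" if "M \<ge> N" for M
  proof -
    have "real CARD('k) + real l - Re s - real M < 0" using N that by linarith
    then show ?thesis unfolding gain_def by (simp add: powr_less_one)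
  qed
  then show ?thesis by blast
qed

lemma gain_nonneg: "gain l N \<ge> 0"
  by (simp add: gain_def)

lemma shell_has_sum:
  assumes \<omega>: "cutoff \<omega>" and x: "norm x \<ge> 1"
  shows "((\<lambda>i. shell f \<omega> i x) has_sum f x) UNIV"
proof -
  obtain d where d: "d > 0" "\<And>x. norm x < d \<Longrightarrow> \<omega> x = 1" using \<omega> unfolding cutoff_def by blast
  obtain J where J: "norm x / d < 2 ^ J" using real_arch_pow[of 2] by auto
  have near: "\<omega> ((1 / 2 ^ i) *\<^sub>R x) = 1" if "i \<ge> J" for i
  proof (rule d(2))
    have "norm x / d < 2 ^ i" using J that by (meson less_le_trans one_le_numeral power_increasing)
    then show "norm ((1 / 2 ^ i) *\<^sub>R x) < d" using d(1) by (simp add: field_simps)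
  qed
  have zero: "shell f \<omega> i x = 0" if "i \<ge> J" for i
    using near[of i] near[of "Suc i"] that by (simp add: shell_def)
  have "infsum (\<lambda>i. shell f \<omega> i x) UNIV = (\<Sum>i<J. shell f \<omega> i x)"
    unfolding infsum_finite[OF finite_lessThan, symmetric] by (rule infsum_cong_neutral) (auto intro: zero)
  also have "\<dots> = f x" using near[of J] \<omega> x by (simp add: sum_shell cutoff_def)
  finally have "infsum (\<lambda>i. shell f \<omega> i x) UNIV = f x" .
  moreover have "(\<lambda>i. shell f \<omega> i x) summable_on UNIV"
    by (rule finite_nonzero_values_imp_summable_on, rule finite_subset[of _ "{..<J}"])
      (auto intro: zero simp: not_le[symmetric])
  ultimately show ?thesis using has_sum_infsum by metis
qed

text \<open>The witness of t-summability is an \<open>N\<close>-fold twisted difference in a direction in which \<open>y\<close> is not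
  integral. It turns the double series over shells and lattice points into an absolutely convergent
  one, so the order of summation can be exchanged; on each single shell the sum is finite and the
  twisted difference just multiplies it by \<open>(1 - w)\<^sup>N\<close>.\<close>

lemma lattice_series_dyadic:
  fixes y :: "real^'k"
  assumes \<omega>: "cutoff \<omega>" and y: "y \<notin> range lattice_vec"
  shows "summable (\<lambda>i. norm (latsum (shell f \<omega> i) y))"
    and "lattice_series f 0 (torus_exp y) = (\<Sum>i. latsum (shell f \<omega> i) y)"
proof -
  obtain c where c: "psi (axis c 1) y \<noteq> 1" using off_lattice_coord[OF y] .
  define w where "w = psi (axis c 1) y"
  obtain N where N: "gain 0 N < 1" using exists_gain_less_1[of 0] by blast
  define a where "a = (\<lambda>n. if n = 0 then 0 else f (0 + lattice_vec n) * monomial (torus_exp y) n)"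
  define b where "b = (\<lambda>i n. shell f \<omega> i (lattice_vec n) * psi (lattice_vec n) y)"
  define T where "T = (twisted_diff w (axis c 1) ^^ N :: (int^'k \<Rightarrow> complex) \<Rightarrow> _)"
  have b_sum: "((\<lambda>i. b i n) has_sum a n) UNIV" for n
  proof (cases "n = 0")
    case True
    then show ?thesis by (simp add: a_def b_def shell_def)
  next
    case False
    have "((\<lambda>i. b i n) has_sum f (lattice_vec n) * psi (lattice_vec n) y) UNIV"
      unfolding b_def by (intro has_sum_cmult_left shell_has_sum \<omega> norm_lattice_vec_ge_1 False)
    with False show ?thesis by (simp add: a_def monomial_torus_exp)
  qed
  have Tb: "T (b i) n = (diffop c ^^ N) (shell f \<omega> i) (lattice_vec n) * psi (lattice_vec n) y" for i n
    unfolding T_def b_def w_def twisted_diff_pow_psi ..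
  have T_sum: "((\<lambda>i. T (b i) n) has_sum T a n) UNIV" for n
    unfolding T_def by (rule twisted_diff_pow_has_sum[OF b_sum])
  obtain C where C: "C \<ge> 0"
    "\<And>i. (\<lambda>n. norm ((diffop c ^^ N) (\<lambda>x. shell f \<omega> 0 ((1 / 2 ^ i) *\<^sub>R x)) (lattice_vec n))) summable_on UNIV"
    "\<And>i. (\<Sum>\<^sub>\<infinity>n. norm ((diffop c ^^ N) (\<lambda>x. shell f \<omega> 0 ((1 / 2 ^ i) *\<^sub>R x)) (lattice_vec n))) \<le> C * (2 ^ i) ^ CARD('k) / (2 ^ i) ^ N"
    using diffop_pow_scaled_bound[OF shell_test_fns[OF \<omega>], of N 0] by blast
  have nTb: "norm (T (b i) n) = norm (of_real (2 ^ i) powr (- s) :: complex) *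
      norm ((diffop c ^^ N) (\<lambda>x. shell f \<omega> 0 ((1 / 2 ^ i) *\<^sub>R x)) (lattice_vec n))" for i n
  proof -
    have "shell f \<omega> i = (\<lambda>x. of_real (2 ^ i) powr (- s) * shell f \<omega> 0 ((1 / 2 ^ i) *\<^sub>R x))"
      using shell_eq by blast
    then show ?thesis by (simp add: Tb diffop_pow_cmult norm_mult)
  qed
  have abs1: "(\<lambda>n. norm (T (b i) n)) summable_on UNIV" for i
    unfolding nTb by (intro summable_on_cmult_right C(2))
  have bd: "(\<Sum>\<^sub>\<infinity>n. norm (T (b i) n)) \<le> C * gain 0 N ^ i" for i
  proof -
    have "(\<Sum>\<^sub>\<infinity>n. norm (T (b i) n)) \<le> norm (of_real (2 ^ i) powr (- s) :: complex) * (C * (2 ^ i) ^ CARD('k) / (2 ^ i) ^ N)"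
      unfolding nTb infsum_cmult_right' by (intro mult_left_mono C(3)) auto
    also have "\<dots> = C * (norm (of_real (2 ^ i) powr (- s) * of_real (2 ^ i) ^ 0 :: complex) * ((2 ^ i) ^ CARD('k) / (2 ^ i) ^ N))"
      by simp
    also have "\<dots> = C * gain 0 N ^ i" unfolding norm_gain ..
    finally show ?thesis .
  qed
  have geo: "summable (\<lambda>i. C * gain 0 N ^ i)"
    using N gain_nonneg[of 0 N] by (intro summable_mult summable_geometric) auto
  have nn: "(\<Sum>\<^sub>\<infinity>n. norm (T (b i) n)) \<ge> 0" for i by (intro infsum_nonneg) auto
  have sm: "summable (\<lambda>i. \<Sum>\<^sub>\<infinity>n. norm (T (b i) n))"
    by (rule summable_comparison_test'[OF geo, of 0]) (use bd nn in auto)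
  have prod: "(\<lambda>p. norm ((\<lambda>(i, n). T (b i) n) p)) summable_on UNIV \<times> UNIV"
    unfolding Infinite_Sum.abs_summable_on_Sigma_iff
    using abs1 sm nn by (simp add: summable_on_UNIV_nonneg_real_iff)
  have prod': "(\<lambda>p. norm ((\<lambda>(n, i). T (b i) n) p)) summable_on UNIV \<times> UNIV"
  proof -
    have "bij_betw prod.swap (UNIV \<times> UNIV) (UNIV \<times> UNIV :: (nat \<times> (int^'k)) set)" by simp
    from summable_on_reindex_bij_betw[OF this, of "\<lambda>p. norm ((\<lambda>(i, n). T (b i) n) p)"] prod
    show ?thesis by (simp add: case_prod_unfold)
  qed
  have absT: "(\<lambda>n. norm (T a n)) summable_on UNIV"
  proof (rule summable_on_comparison_test)
    show "(\<lambda>n. \<Sum>\<^sub>\<infinity>i. norm (T (b i) n)) summable_on UNIV"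
      using prod' infsum_nonneg[of UNIV "\<lambda>i. norm (T (b i) _)"] unfolding Infinite_Sum.abs_summable_on_Sigma_iff by simp
    show "norm (T a n) \<le> (\<Sum>\<^sub>\<infinity>i. norm (T (b i) n))" for n
      using T_sum[of n] norm_infsum_bound[of "\<lambda>i. T (b i) n" UNIV] prod'
      unfolding Infinite_Sum.abs_summable_on_Sigma_iff by (auto simp: infsumI)
  qed auto
  have inner: "(\<Sum>\<^sub>\<infinity>n. T (b i) n) = (1 - w) ^ N * latsum (shell f \<omega> i) y" for i
  proof -
    obtain R where R: "R > 0" "\<And>x. norm x > R \<Longrightarrow> shell f \<omega> i x = 0"
      using test_fns_support[OF shell_test_fns[OF \<omega>]] by blast
    then show ?thesis
      using latsum_diffop_pow[of R "shell f \<omega> i", where c = c and N = N and z = y] by (simp add: Tb latsum_def w_def)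
  qed
  have w1: "(1 - w) ^ N \<noteq> 0" using c by (simp add: w_def)
  have le: "norm ((1 - w) ^ N * latsum (shell f \<omega> i) y) \<le> C * gain 0 N ^ i" for i
    unfolding inner[symmetric] using order_trans[OF norm_infsum_bound[OF abs1] bd] .
  have "summable (\<lambda>i. norm ((1 - w) ^ N * latsum (shell f \<omega> i) y))"
    by (rule summable_comparison_test'[OF geo, of 0]) (use le in auto)
  then have "summable (\<lambda>i. norm ((1 - w) ^ N) * norm (latsum (shell f \<omega> i) y))" by (simp add: norm_mult)
  then show summ: "summable (\<lambda>i. norm (latsum (shell f \<omega> i) y))"
    using c by (simp add: summable_cmult_iff w_def)
  have "infsum (T a) UNIV = (\<Sum>\<^sub>\<infinity>n. \<Sum>\<^sub>\<infinity>i. T (b i) n)"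
    by (intro infsum_cong infsumI[symmetric] T_sum)
  also have "\<dots> = (\<Sum>\<^sub>\<infinity>i. \<Sum>\<^sub>\<infinity>n. T (b i) n)"
    by (rule infsum_swap_banach) (rule abs_summable_summable[OF prod'])
  also have "\<dots> = (1 - w) ^ N * (\<Sum>\<^sub>\<infinity>i. latsum (shell f \<omega> i) y)"
    unfolding inner by (rule infsum_cmult_right')
  also have "(\<Sum>\<^sub>\<infinity>i. latsum (shell f \<omega> i) y) = (\<Sum>i. latsum (shell f \<omega> i) y)"
    using norm_summable_imp_has_sum[OF summ summable_sums[OF summable_norm_cancel[OF summ]]] by (rule infsumI)
  finally have total: "infsum (T a) UNIV = (1 - w) ^ N * (\<Sum>i. latsum (shell f \<omega> i) y)" .
  obtain cc where cc: "finite {m. cc m \<noteq> 0}" "(\<Sum>m | cc m \<noteq> 0. cc m) = (1 - w) ^ N" "\<And>a. conv cc a = T a"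
    using twisted_diff_pow_conv[of w N "axis c 1"] unfolding T_def by blast
  have "t_summing cc a" unfolding t_summing_def using cc w1 absT by simp
  from t_sum_eq[OF this] have "t_sum a = (\<Sum>i. latsum (shell f \<omega> i) y)"
    using total c by (simp add: cc w_def)
  then show "lattice_series f 0 (torus_exp y) = (\<Sum>i. latsum (shell f \<omega> i) y)"
    by (simp add: lattice_series_def a_def)
qed

lemma geometric_gain_summable:
  "gain l N < 1 \<Longrightarrow> summable (\<lambda>i. C * gain l N ^ i)"
  using gain_nonneg[of l N] by (intro summable_mult summable_geometric) auto

lemma smooth_on_latsum_series:
  assumes \<omega>: "cutoff \<omega>"
  shows "smooth_on (- range lattice_vec) (\<lambda>y. \<Sum>i. latsum (shell f \<omega> i) y)"
proof (rule smooth_on_suminf[OF open_off_lattice])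
  show "smooth_on (- range lattice_vec) (latsum (shell f \<omega> i))" for i
    by (rule smooth_on_subset[OF smooth_on_latsum(1)[OF shell_test_fns[OF \<omega>]]]) auto
next
  fix "is" :: "'k list" and y :: "real^'k" assume "y \<in> - range lattice_vec"
  then obtain c where c: "psi (axis c 1) y \<noteq> 1" using off_lattice_coord[of y] by auto
  define \<delta> where "\<delta> = norm (1 - psi (axis c 1) y) / 2"
  have \<delta>: "\<delta> > 0" using c by (simp add: \<delta>_def)
  have "continuous (at y) (\<lambda>z. norm (1 - psi (axis c 1) z))"
  proof -
    have "continuous_on UNIV (\<lambda>z. norm (1 - psi (axis c 1) z))" by (intro continuous_intros)
    then show ?thesis using continuous_on_eq_continuous_at by blast
  qed
  then obtain e where e: "e > 0" "\<And>z. dist z y < e \<Longrightarrow> dist (norm (1 - psi (axis c 1) z)) (norm (1 - psi (axis c 1) y)) < \<delta>"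
    using \<delta> unfolding continuous_at_eps_delta dist_norm by (metis dist_norm)
  obtain N where N: "gain (length is) N < 1" using exists_gain_less_1[of "length is"] by blast
  obtain C where C: "C \<ge> 0" "\<And>i z. norm (1 - psi (axis c 1) z) ^ N *
      norm (latsum (\<lambda>x. (\<lambda>x. weight is x * shell f \<omega> 0 x) ((1 / 2 ^ i) *\<^sub>R x)) z) \<le> C * (2 ^ i) ^ CARD('k) / (2 ^ i) ^ N"
    using latsum_scaled_decay[OF test_fns_weight[OF shell_test_fns[OF \<omega>]], of N "is" 0] by blast
  have "norm (partials is (latsum (shell f \<omega> i)) z) \<le> C / \<delta> ^ N * gain (length is) N ^ i" if "z \<in> ball y e" for i z
  proof -
    let ?q = "\<lambda>x. weight is x * shell f \<omega> 0 x"
    have "\<delta> \<le> norm (1 - psi (axis c 1) z)"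
    proof -
      have "dist z y < e" using that by (simp add: dist_commute)
      from e(2)[OF this] show ?thesis unfolding dist_real_def \<delta>_def abs_less_iff by linarith
    qed
    then have "\<delta> ^ N * norm (latsum (\<lambda>x. ?q ((1 / 2 ^ i) *\<^sub>R x)) z) \<le> C * (2 ^ i) ^ CARD('k) / (2 ^ i) ^ N"
      using \<delta> by (intro order_trans[OF mult_right_mono C(2)] power_mono) auto
    then have le: "norm (latsum (\<lambda>x. ?q ((1 / 2 ^ i) *\<^sub>R x)) z) \<le> C / \<delta> ^ N * ((2 ^ i) ^ CARD('k) / (2 ^ i) ^ N)"
      using \<delta> by (simp add: field_simps)
    have "norm (partials is (latsum (shell f \<omega> i)) z)
       = norm (of_real (2 ^ i) powr (- s) * of_real (2 ^ i) ^ length is :: complex) * norm (latsum (\<lambda>x. ?q ((1 / 2 ^ i) *\<^sub>R x)) z)"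
      unfolding partials_latsum[OF shell_test_fns[OF \<omega>]] weight_shell_fun[of "is" \<omega> i] latsum_cmult norm_mult ..
    also have "\<dots> \<le> norm (of_real (2 ^ i) powr (- s) * of_real (2 ^ i) ^ length is :: complex) * (C / \<delta> ^ N * ((2 ^ i) ^ CARD('k) / (2 ^ i) ^ N))"
      by (intro mult_left_mono le) auto
    also have "\<dots> = C / \<delta> ^ N * gain (length is) N ^ i"
      unfolding norm_gain[of i "length is" N, symmetric] by (simp only: mult_ac)
    finally show ?thesis .
  qed
  then show "\<exists>e>0. \<exists>B. summable B \<and> (\<forall>i. \<forall>z\<in>ball y e \<inter> - range lattice_vec. norm (partials is (latsum (shell f \<omega> i)) z) \<le> B i)"
    using e(1) geometric_gain_summable[OF N, of "C / \<delta> ^ N"] by blast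
qed

end

section \<open>Vanishing moments\<close>

text \<open>Vanishing moments give vanishing at the origin without any Taylor expansion: a partial derivative of
  the combination is a combination of the same kind, for \<open>c\<^sub>l a\<^sub>l\<close> in place of \<open>c\<^sub>l\<close>, with one vanishing moment
  less, and the estimate is integrated along the segment from \<open>0\<close> to \<open>x\<close>.\<close>

lemma norm_dilation_combination_le:
  fixes \<phi> :: "real^'k::finite \<Rightarrow> complex" and c :: "nat \<Rightarrow> complex" and a :: "nat \<Rightarrow> real"
  assumes "smooth_on UNIV \<phi>"
    and "\<And>d. d < n \<Longrightarrow> (\<Sum>l<L. c l * of_real (a l) ^ d) = 0"
    and "\<And>js x. length js = n \<Longrightarrow> norm (partials js \<phi> x) \<le> B"
  shows "norm (\<Sum>l<L. c l * \<phi> (a l *\<^sub>R x)) \<le> (\<Sum>l<L. norm (c l) * \<bar>a l\<bar> ^ n) * real CARD('k) ^ n * B * norm x ^ n"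
  using assms
proof (induction n arbitrary: c \<phi> x)
  case 0
  have "norm (\<Sum>l<L. c l * \<phi> (a l *\<^sub>R x)) \<le> (\<Sum>l<L. norm (c l) * B)"
  proof (rule sum_norm_le)
    fix l show "norm (c l * \<phi> (a l *\<^sub>R x)) \<le> norm (c l) * B"
      using 0(3)[of "[]" "a l *\<^sub>R x"] by (simp add: norm_mult mult_left_mono)
  qed
  then show ?case by (simp add: sum_distrib_right)
next
  case (Suc n)
  define S where "S = (\<lambda>x. \<Sum>l<L. c l * \<phi> (a l *\<^sub>R x))"
  define K where "K = (\<Sum>l<L. norm (c l) * \<bar>a l\<bar> ^ Suc n) * real CARD('k) ^ n * B"
  have B0: "B \<ge> 0"
    using order_trans[OF norm_ge_zero Suc.prems(3)[of "replicate (Suc n) undefined"]] by simp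
  have K0: "K \<ge> 0" unfolding K_def using B0 by (intro mult_nonneg_nonneg sum_nonneg) auto
  have smS: "smooth_on UNIV S"
    unfolding S_def by (intro smooth_on_sum smooth_on_cmult smooth_on_scaleR Suc.prems(1) open_UNIV)
  have pS: "norm (partial j S z) \<le> K * norm z ^ n" for j z
  proof -
    have "partial j S z = (\<Sum>l<L. partials [j] (\<lambda>x. c l * \<phi> (a l *\<^sub>R x)) z)"
      unfolding S_def
      using partials_sum[of UNIV "{..<L}" "\<lambda>l x. c l * \<phi> (a l *\<^sub>R x)" z "[j]"] Suc.prems(1)
      by (simp add: smooth_on_cmult smooth_on_scaleR)
    also have "\<dots> = (\<Sum>l<L. (c l * of_real (a l)) * partial j \<phi> (a l *\<^sub>R z))"
    proof (rule sum.cong[OF refl])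
      fix l
      show "partials [j] (\<lambda>x. c l * \<phi> (a l *\<^sub>R x)) z = c l * of_real (a l) * partial j \<phi> (a l *\<^sub>R z)"
        using partials_cmult[OF open_UNIV smooth_on_scaleR[OF Suc.prems(1)], of z "[j]" "c l" "a l"]
          partials_scaleR[OF Suc.prems(1), of "[j]" "a l" z] by simp
    qed
    also have "norm \<dots> \<le> (\<Sum>l<L. norm (c l * of_real (a l)) * \<bar>a l\<bar> ^ n) * real CARD('k) ^ n * B * norm z ^ n"
    proof (rule Suc.IH[OF smooth_on_partial[OF Suc.prems(1)]])
      fix d assume "d < n"
      then show "(\<Sum>l<L. c l * of_real (a l) * of_real (a l) ^ d) = 0"
        using Suc.prems(2)[of "Suc d"] by (simp add: mult.assoc)
    next
      fix js :: "'k list" and x assume "length js = n"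
      then show "norm (partials js (partial j \<phi>) x) \<le> B"
        using Suc.prems(3)[of "js @ [j]" x] by (simp add: partials_append)
    qed
    also have "\<dots> = K * norm z ^ n" by (simp add: K_def norm_mult mult.assoc)
    finally show ?thesis .
  qed
  have S0: "S 0 = 0" using Suc.prems(2)[of 0] by (simp add: S_def sum_distrib_right[symmetric])
  have "norm (S (x + 0) - S 0) \<le> real CARD('k) * (norm x * (K * norm x ^ n))"
  proof (rule norm_increment_le[OF smS])
    fix t :: real assume t: "0 \<le> t" "t \<le> 1"
    have "norm (\<Sum>j\<in>UNIV. of_real (x $ j) * partial j S (t *\<^sub>R x + 0)) \<le> (\<Sum>j\<in>(UNIV::'k set). norm x * (K * norm x ^ n))"
    proof (rule sum_norm_le)
      fix j
      have "norm (partial j S (t *\<^sub>R x)) \<le> K * norm (t *\<^sub>R x) ^ n" by (rule pS)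
      also have "\<dots> \<le> K * norm x ^ n"
        using t K0 mult_right_mono[of t 1 "norm x"] by (intro mult_left_mono power_mono) auto
      finally show "norm (of_real (x $ j) * partial j S (t *\<^sub>R x + 0)) \<le> norm x * (K * norm x ^ n)"
        unfolding norm_mult norm_of_real
        by (intro mult_mono) (auto simp: component_le_norm_cart)
    qed
    then show "norm (\<Sum>j\<in>UNIV. of_real (x $ j) * partial j S (t *\<^sub>R x + 0)) \<le> real CARD('k) * (norm x * (K * norm x ^ n))"
      by simp
  qed
  then have "norm (S x) \<le> real CARD('k) * (norm x * (K * norm x ^ n))" using S0 by simp
  also have "\<dots> = (\<Sum>l<L. norm (c l) * \<bar>a l\<bar> ^ Suc n) * real CARD('k) ^ Suc n * B * norm x ^ Suc n"
    by (simp only: K_def power_Suc mult_ac)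
  finally show ?case by (simp only: S_def)
qed

text \<open>The logarithms of \<open>2\<close> and \<open>3\<close> are incommensurable.\<close>

lemma eq_0_if_2_3_powr_eq_1:
  fixes w :: complex
  assumes "2 powr w = 1" "3 powr w = 1"
  shows "w = 0"
proof -
  have "exp (w * of_real (ln 2)) = 1" "exp (w * of_real (ln 3)) = 1"
    using assms by (simp_all add: powr_def Ln_of_real[symmetric] del: Ln_of_real)
  then obtain m n :: int where *: "Re w * ln 2 = 0" "Im w * ln 2 = of_int (2 * m) * pi" "Im w * ln 3 = of_int (2 * n) * pi"
    unfolding exp_eq_1 by auto
  have Re: "Re w = 0" using *(1) by simp
  have "Im w = 0"
  proof (rule ccontr)
    assume nz: "Im w \<noteq> 0"
    have m: "m \<noteq> 0" using *(2) nz by auto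
    have n: "n \<noteq> 0" using *(3) nz by auto
    have "(of_int m * ln 3) * (2 * pi) = (of_int n * ln 2) * (2 * pi)"
    proof -
      have "(of_int m * ln 3) * (2 * pi) = (of_int (2 * m) * pi) * ln 3" by simp
      also have "\<dots> = (Im w * ln 3) * ln 2" unfolding *(2)[symmetric] by simp
      finally show ?thesis unfolding *(3) by simp
    qed
    then have eq: "of_int m * ln 3 = of_int n * ln (2::real)" by simp
    then have "\<bar>of_int m\<bar> * ln 3 = \<bar>of_int n\<bar> * ln (2::real)"
      by (metis abs_mult abs_of_nonneg ln_ge_zero one_le_numeral)
    then have "real (nat \<bar>m\<bar>) * ln 3 = real (nat \<bar>n\<bar>) * ln 2" by simp
    then have "ln ((3::real) ^ nat \<bar>m\<bar>) = ln (2 ^ nat \<bar>n\<bar>)" by (simp add: ln_realpow)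
    then have "(3::real) ^ nat \<bar>m\<bar> = 2 ^ nat \<bar>n\<bar>" by (subst (asm) ln_inj_iff) auto
    then have "real (3 ^ nat \<bar>m\<bar>) = real (2 ^ nat \<bar>n\<bar>)" by simp
    then have "(3::nat) ^ nat \<bar>m\<bar> = 2 ^ nat \<bar>n\<bar>" by (simp only: of_nat_eq_iff)
    moreover have "odd ((3::nat) ^ nat \<bar>m\<bar>)" by simp
    moreover have "even ((2::nat) ^ nat \<bar>n\<bar>)" using n by simp
    ultimately show False by metis
  qed
  with Re show ?thesis by (simp add: complex_eq_iff)
qed

context homogeneous_fn
begin

text \<open>The quasi-character by which dilations act on the homogeneous extensions of \<open>f\<close>.\<close>

definition chr :: "real \<Rightarrow> complex" where
  "chr a = (if a < 0 then \<epsilon> else 1) * of_real \<bar>a\<bar> powr (s - of_nat CARD('k))"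

lemma eps_sq: "\<epsilon> * \<epsilon> = 1"
  using eps by auto

lemma chr_mult: "a \<noteq> 0 \<Longrightarrow> b \<noteq> 0 \<Longrightarrow> chr (a * b) = chr a * chr b"
proof -
  assume ab: "a \<noteq> 0" "b \<noteq> 0"
  have "of_real \<bar>a * b\<bar> powr w = of_real \<bar>a\<bar> powr w * (of_real \<bar>b\<bar> powr w :: complex)" for w
    by (simp add: abs_mult powr_times_real)
  moreover have "(if a * b < 0 then \<epsilon> else 1) = (if a < 0 then \<epsilon> else 1) * (if b < 0 then \<epsilon> else 1)"
    using ab eps_sq by (auto simp: mult_less_0_iff)
  ultimately show ?thesis by (simp add: chr_def)
qed

lemma f_scale_signed:
  assumes "x \<noteq> 0" "a \<noteq> 0"
  shows "f (a *\<^sub>R x) = (if a < 0 then \<epsilon> else 1) * of_real \<bar>a\<bar> powr (- s) * f x"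
proof (cases "a < 0")
  case True
  have "f (a *\<^sub>R x) = f (- (\<bar>a\<bar> *\<^sub>R x))" using True by simp
  also have "\<dots> = \<epsilon> * f (\<bar>a\<bar> *\<^sub>R x)" using assms by (intro f_minus) auto
  also have "f (\<bar>a\<bar> *\<^sub>R x) = of_real \<bar>a\<bar> powr (- s) * f x" using assms by (intro f_scaleR) auto
  finally show ?thesis by (simp only: True if_True mult.assoc)
next
  case False
  then show ?thesis using assms f_scaleR[of x a] by simp
qed

lemma chr_f:
  assumes "x \<noteq> 0" "a \<noteq> 0"
  shows "chr a * f x = of_real (\<bar>1 / a\<bar>) ^ CARD('k) * f ((1 / a) *\<^sub>R x)"
proof -
  let ?r = "of_real \<bar>a\<bar> :: complex"
  have r: "?r \<noteq> 0" using assms by simp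
  have f: "f x = (if a < 0 then \<epsilon> else 1) * ?r powr (- s) * f ((1 / a) *\<^sub>R x)"
    using f_scale_signed[of "(1 / a) *\<^sub>R x" a] assms by simp
  have "chr a * f x = ((if a < 0 then \<epsilon> else 1) * (if a < 0 then \<epsilon> else 1)) * (?r powr (s - of_nat CARD('k)) * ?r powr (- s)) * f ((1 / a) *\<^sub>R x)"
    unfolding chr_def by (subst f) (simp only: mult_ac)
  also have "(if a < 0 then \<epsilon> else 1) * (if a < 0 then \<epsilon> else 1) = 1" using eps_sq by auto
  also have "?r powr (s - of_nat CARD('k)) * ?r powr (- s) = ?r powr (- of_nat CARD('k))"
    by (simp flip: powr_add)
  also have "\<dots> = of_real (\<bar>1 / a\<bar>) ^ CARD('k)"
    using r by (simp add: powr_minus powr_nat' power_divide divide_inverse power_inverse)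
  finally show ?thesis by simp
qed

text \<open>The set of exceptional \<open>(s, \<epsilon>)\<close> consists of those for which the quasi-character is the monomial \<open>a\<^sup>d\<close>, and the
  subgroup generated by \<open>1/2\<close>, \<open>1/3\<close> and \<open>-1\<close> is large enough to detect this.\<close>

lemma exists_chr_neq_power:
  assumes "(s, \<epsilon>) \<notin> {(of_nat (e + CARD('k)), (- 1) ^ e) | e :: nat. True}"
  shows "\<exists>b\<in>{1/2, 1/3, -1}. chr b \<noteq> of_real b ^ d"
proof (rule ccontr)
  assume "\<not> ?thesis"
  then have eq: "chr (1/2) = of_real (1/2) ^ d" "chr (1/3) = of_real (1/3) ^ d" "chr (-1) = (-1) ^ d" by auto
  define w where "w = of_nat d - (s - of_nat CARD('k))"
  have "of_real r powr w = 1" if "r > 0" "chr (1 / r) = of_real (1 / r) ^ d" for r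
  proof -
    have "of_real (1 / r) powr (s - of_nat CARD('k)) = (of_real r powr (- (s - of_nat CARD('k))) :: complex)"
      using that(1) by (simp add: powr_def Ln_of_real ln_div algebra_simps flip: of_real_divide)
    then have "of_real r powr (- (s - of_nat CARD('k))) = (1 / of_real r :: complex) ^ d"
      using that by (simp add: chr_def)
    moreover have "of_real r powr w = of_real r ^ d * of_real r powr (- (s - of_nat CARD('k)))"
      using that(1) by (simp add: w_def powr_diff powr_add powr_nat' powr_minus field_simps)
    ultimately show ?thesis using that(1) by (simp add: power_divide)
  qed
  from this[of 2] this[of 3] have "w = 0" using eq by (intro eq_0_if_2_3_powr_eq_1) auto
  then have "s = of_nat (d + CARD('k))" by (simp add: w_def)
  moreover have "\<epsilon> = (-1) ^ d" using eq(3) by (simp add: chr_def)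
  ultimately show False using assms by blast
qed

text \<open>Induction on \<open>n\<close>: composing with the difference of the dilations by \<open>b\<close> and \<open>b\<^sup>n\<close> times the identity
  multiplies the \<open>d\<close>-th moment by \<open>b\<^sup>d - b\<^sup>n\<close>, which kills the \<open>n\<close>-th one, and the value on the quasi-character by \<open>chr b - b\<^sup>n\<close>, which
  is nonzero for a suitable \<open>b\<close> and can be divided out. Lists are used because distinct words in the dilations may give the same number.\<close>

lemma exists_moment_list:
  assumes "(s, \<epsilon>) \<notin> {(of_nat (e + CARD('k)), (- 1) ^ e) | e :: nat. True}"
  shows "\<exists>cs::(complex \<times> real) list. (\<forall>(c, a)\<in>set cs. a \<noteq> 0 \<and> \<bar>a\<bar> \<le> 1) \<and>
    (\<forall>d<n. (\<Sum>(c, a)\<leftarrow>cs. c * of_real a ^ d) = 0) \<and> (\<Sum>(c, a)\<leftarrow>cs. c * chr a) = 1"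
proof (induction n)
  case 0
  show ?case by (intro exI[of _ "[(1, 1)]"]) (simp add: chr_def)
next
  case (Suc n)
  then obtain cs :: "(complex \<times> real) list" where cs: "\<And>c a. (c, a) \<in> set cs \<Longrightarrow> a \<noteq> 0 \<and> \<bar>a\<bar> \<le> 1"
    "\<And>d. d < n \<Longrightarrow> (\<Sum>(c, a)\<leftarrow>cs. c * of_real a ^ d) = 0" "(\<Sum>(c, a)\<leftarrow>cs. c * chr a) = 1" by blast
  obtain b :: real where b': "b \<in> {1/2, 1/3, -1}" "chr b \<noteq> of_real b ^ n"
    using exists_chr_neq_power[OF assms, of n] by blast
  then have b: "b \<noteq> 0" "\<bar>b\<bar> \<le> 1" "chr b \<noteq> of_real b ^ n" by auto
  define D where "D = chr b - of_real b ^ n"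
  have D: "D \<noteq> 0" using b by (simp add: D_def)
  define cs' where "cs' = map (\<lambda>(c, a). (c / D, b * a)) cs @ map (\<lambda>(c, a). (- (of_real b ^ n) * c / D, a)) cs"
  have comb: "(\<Sum>(c, a)\<leftarrow>cs'. c * h a) = ((\<Sum>(c, a)\<leftarrow>cs. c * h (b * a)) - of_real b ^ n * (\<Sum>(c, a)\<leftarrow>cs. c * h a)) / D" for h
  proof -
    have "(\<Sum>(c, a)\<leftarrow>cs'. c * h a) = (\<Sum>(c, a)\<leftarrow>cs. (c * h (b * a)) / D) + (\<Sum>(c, a)\<leftarrow>cs. - (of_real b ^ n * (c * h a)) / D)"
      unfolding cs'_def by (simp add: o_def case_prod_unfold mult.assoc)
    moreover have "(\<Sum>(c, a)\<leftarrow>xs. (c * h (b * a)) / D) + (\<Sum>(c, a)\<leftarrow>xs. - (of_real b ^ n * (c * h a)) / D)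
      = ((\<Sum>(c, a)\<leftarrow>xs. c * h (b * a)) - of_real b ^ n * (\<Sum>(c, a)\<leftarrow>xs. c * h a)) / D" for xs
      by (induction xs) (auto simp: add_divide_distrib diff_divide_distrib distrib_left)
    ultimately show ?thesis by simp
  qed
  have range': "a \<noteq> 0 \<and> \<bar>a\<bar> \<le> 1" if "(c, a) \<in> set cs'" for c a
    using that b cs(1) unfolding cs'_def by (auto simp: abs_mult mult_le_one)
  have "(\<Sum>(c, a)\<leftarrow>cs'. c * of_real a ^ d) = 0" if "d < Suc n" for d
  proof -
    have "(\<Sum>(c, a)\<leftarrow>cs. c * of_real (b * a) ^ d) = of_real b ^ d * (\<Sum>(c, a)\<leftarrow>cs. c * of_real a ^ d)"
      by (simp add: sum_list_const_mult[symmetric] case_prod_unfold power_mult_distrib mult.left_commute)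
    then have "(\<Sum>(c, a)\<leftarrow>cs'. c * of_real a ^ d) = (of_real b ^ d - of_real b ^ n) * (\<Sum>(c, a)\<leftarrow>cs. c * of_real a ^ d) / D"
      unfolding comb[of "\<lambda>a. of_real a ^ d"] by (simp add: left_diff_distrib)
    with that show ?thesis using cs(2) by (cases "d = n") auto
  qed
  moreover have "(\<Sum>(c, a)\<leftarrow>cs'. c * chr a) = 1"
  proof -
    have "(\<Sum>(c, a)\<leftarrow>xs. c * chr (b * a)) = chr b * (\<Sum>(c, a)\<leftarrow>xs. c * chr a)"
      if "\<forall>(c, a)\<in>set xs. a \<noteq> 0" for xs
      using that by (induction xs) (auto simp: chr_mult[OF b(1)] distrib_left mult.left_commute)
    from this[of cs] have "(\<Sum>(c, a)\<leftarrow>cs. c * chr (b * a)) = chr b" using cs(1,3) by auto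
    then show ?thesis unfolding comb using cs(3) D by (simp add: D_def)
  qed
  ultimately show ?case using range' by blast
qed

lemma exists_moments:
  assumes "(s, \<epsilon>) \<notin> {(of_nat (e + CARD('k)), (- 1) ^ e) | e :: nat. True}"
  obtains L :: nat and c :: "nat \<Rightarrow> complex" and a :: "nat \<Rightarrow> real"
  where "\<And>l. l < L \<Longrightarrow> a l \<noteq> 0 \<and> \<bar>a l\<bar> \<le> 1" "\<And>d. d < n \<Longrightarrow> (\<Sum>l<L. c l * of_real (a l) ^ d) = 0"
    and "(\<Sum>l<L. c l * chr (a l)) = 1"
proof -
  obtain cs :: "(complex \<times> real) list" where cs: "\<And>c a. (c, a) \<in> set cs \<Longrightarrow> a \<noteq> 0 \<and> \<bar>a\<bar> \<le> 1"
    "\<And>d. d < n \<Longrightarrow> (\<Sum>(c, a)\<leftarrow>cs. c * of_real a ^ d) = 0" "(\<Sum>(c, a)\<leftarrow>cs. c * chr a) = 1"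
    using exists_moment_list[OF assms, of n] by blast
  have idx: "(\<Sum>(c, a)\<leftarrow>cs. c * h a) = (\<Sum>l<length cs. fst (cs ! l) * h (snd (cs ! l)))" for h
    by (simp add: sum_list_sum_nth case_prod_unfold atLeast0LessThan)
  show ?thesis
  proof (rule that[of "length cs" "\<lambda>l. snd (cs ! l)" "\<lambda>l. fst (cs ! l)"])
    show "snd (cs ! l) \<noteq> 0 \<and> \<bar>snd (cs ! l)\<bar> \<le> 1" if "l < length cs" for l
      using cs(1)[of "fst (cs ! l)" "snd (cs ! l)"] that by simp
  qed (use cs(2,3) idx in auto)
qed

section \<open>The Fourier transforms of the dyadic pieces\<close>

lemma partials_fourier_shell:
  assumes \<omega>: "cutoff \<omega>"
  shows "partials is (fourier (shell f \<omega> i)) y = of_real (2 ^ i) powr (- s) * of_real (2 ^ i) ^ length is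
     * ((2 ^ i) ^ CARD('k) * fourier (\<lambda>x. weight is x * shell f \<omega> 0 x) (2 ^ i *\<^sub>R y))"
proof -
  let ?q = "\<lambda>x. weight is x * shell f \<omega> 0 x"
  have "partials is (fourier (shell f \<omega> i)) y
     = of_real (2 ^ i) powr (- s) * of_real (2 ^ i) ^ length is * fourier (\<lambda>x. ?q ((1 / 2 ^ i) *\<^sub>R x)) y"
    unfolding partials_fourier[OF shell_test_fns[OF \<omega>]] weight_shell_fun[of "is" \<omega> i] fourier_cmult ..
  also have "fourier (\<lambda>x. ?q ((1 / 2 ^ i) *\<^sub>R x)) y = (2 ^ i) ^ CARD('k) * fourier ?q (2 ^ i *\<^sub>R y)"
    using fourier_scaleR[OF test_fns_weight[OF shell_test_fns[OF \<omega>]], of "2 ^ i" "is" 0 y]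
    by (simp add: power_divide)
  finally show ?thesis .
qed

text \<open>Off the origin the decay of the Fourier transform of a single shell beats the growth of its dilates.
  The bound is uniform outside a ball, as needed for dominated convergence later on.\<close>

lemma smooth_on_fourier_series:
  assumes \<omega>: "cutoff \<omega>"
  shows "smooth_on (- {0}) (\<lambda>y. \<Sum>i. fourier (shell f \<omega> i) y)"
    and "\<delta> > 0 \<Longrightarrow> \<exists>B. summable B \<and> (\<forall>i z. \<delta> \<le> norm z \<longrightarrow> norm (partials is (fourier (shell f \<omega> i)) z) \<le> B i)"
proof -
  show bd: "\<exists>B. summable B \<and> (\<forall>i z. \<delta> \<le> norm z \<longrightarrow> norm (partials is (fourier (shell f \<omega> i)) z) \<le> B i)"
    if \<delta>: "\<delta> > 0" for "is" \<delta>
  proof -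
    let ?q = "\<lambda>x. weight is x * shell f \<omega> 0 x"
    obtain N where N: "gain (length is) N < 1" using exists_gain_less_1[of "length is"] by blast
    obtain C where C: "C \<ge> 0" "\<And>y. (1 + norm y) ^ N * norm (fourier ?q y) \<le> C"
      using fourier_decay[OF test_fns_weight[OF shell_test_fns[OF \<omega>]], of N "is" 0] by blast
    have "norm (partials is (fourier (shell f \<omega> i)) z) \<le> C / \<delta> ^ N * gain (length is) N ^ i" if "\<delta> \<le> norm z" for i z
    proof -
      from that have "2 ^ i * \<delta> \<le> 1 + norm (2 ^ i *\<^sub>R z)" by (simp add: add_increasing)
      then have "(2 ^ i * \<delta>) ^ N * norm (fourier ?q (2 ^ i *\<^sub>R z)) \<le> C"
        using \<delta> by (intro order_trans[OF mult_right_mono C(2)] power_mono) auto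
      then have le: "norm (fourier ?q (2 ^ i *\<^sub>R z)) \<le> C / \<delta> ^ N * (1 / (2 ^ i) ^ N)"
        using \<delta> by (simp add: field_simps)
      have "norm (partials is (fourier (shell f \<omega> i)) z) = norm (of_real (2 ^ i) powr (- s) * of_real (2 ^ i) ^ length is :: complex)
         * ((2 ^ i) ^ CARD('k) * norm (fourier ?q (2 ^ i *\<^sub>R z)))"
        unfolding partials_fourier_shell[OF \<omega>] by (simp add: norm_mult norm_power)
      also have "\<dots> \<le> norm (of_real (2 ^ i) powr (- s) * of_real (2 ^ i) ^ length is :: complex)
         * ((2 ^ i) ^ CARD('k) * (C / \<delta> ^ N * (1 / (2 ^ i) ^ N)))"
        by (intro mult_left_mono le) auto
      also have "\<dots> = C / \<delta> ^ N * (norm (of_real (2 ^ i) powr (- s) * of_real (2 ^ i) ^ length is :: complex) * ((2 ^ i) ^ CARD('k) / (2 ^ i) ^ N))"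
        by (simp add: mult_ac)
      also have "\<dots> = C / \<delta> ^ N * gain (length is) N ^ i" unfolding norm_gain ..
      finally show ?thesis .
    qed
    then show ?thesis using geometric_gain_summable[OF N, of "C / \<delta> ^ N"] by blast
  qed
  show "smooth_on (- {0}) (\<lambda>y. \<Sum>i. fourier (shell f \<omega> i) y)"
  proof (rule smooth_on_suminf)
    show "smooth_on (- {0}) (fourier (shell f \<omega> i))" for i
      by (rule smooth_on_subset[OF smooth_on_fourier[OF shell_test_fns[OF \<omega>]]]) auto
    show "\<exists>e>0. \<exists>B. summable B \<and> (\<forall>i. \<forall>z\<in>ball y e \<inter> - {0}. norm (partials is (fourier (shell f \<omega> i)) z) \<le> B i)"
      if "y \<in> - {0}" for "is" y
    proof -
      have y: "norm y / 2 > 0" using that by simp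
      have "norm y / 2 \<le> norm z" if "z \<in> ball y (norm y / 2)" for z
        using that norm_triangle_ineq2[of y "y - z"] by (simp add: dist_norm norm_minus_commute)
      then show ?thesis using bd[OF y, of "is"] y by blast
    qed
  qed auto
qed

text \<open>Both terms have the same weight factors as derivatives, so the estimate near \<open>0\<close> applies to every
  derivative.\<close>

lemma smooth_on_lattice_minus_fourier:
  assumes \<omega>: "cutoff \<omega>"
  shows "smooth_on half_box (\<lambda>y. \<Sum>i. latsum (shell f \<omega> i) y - fourier (shell f \<omega> i) y)"
proof (rule smooth_on_suminf[OF open_half_box])
  have sm: "smooth_on UNIV (latsum (shell f \<omega> i))" "smooth_on UNIV (fourier (shell f \<omega> i))" for i
    by (rule smooth_on_latsum smooth_on_fourier; rule shell_test_fns[OF \<omega>])+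
  show "smooth_on half_box (\<lambda>y. latsum (shell f \<omega> i) y - fourier (shell f \<omega> i) y)" for i
    by (rule smooth_on_subset[OF smooth_on_diff[OF open_UNIV sm]]) auto
  fix "is" :: "'k list" and y :: "real^'k" assume y: "y \<in> half_box"
  let ?q = "\<lambda>x. weight is x * shell f \<omega> 0 x"
  obtain N where N: "gain (length is) N < 1" using exists_gain_less_1[of "length is"] by blast
  obtain C where C: "C \<ge> 0" "\<And>i y. (\<forall>c. \<bar>y $ c\<bar> \<le> 1/2) \<Longrightarrow>
    norm (latsum (\<lambda>x. ?q ((1 / 2 ^ i) *\<^sub>R x)) y - (2 ^ i) ^ CARD('k) * fourier ?q (2 ^ i *\<^sub>R y)) \<le> C / (2 ^ i) ^ N"
    using latsum_near_0[OF test_fns_weight[OF shell_test_fns[OF \<omega>]], of "is" 0 N] by blast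
  have "norm (partials is (\<lambda>y. latsum (shell f \<omega> i) y - fourier (shell f \<omega> i) y) z) \<le> C * gain (length is) N ^ i"
    if z: "z \<in> half_box" for i z
  proof -
    let ?\<beta> = "of_real (2 ^ i) powr (- s) * of_real (2 ^ i) ^ length is :: complex"
    have "partials is (latsum (shell f \<omega> i)) z = ?\<beta> * latsum (\<lambda>x. ?q ((1 / 2 ^ i) *\<^sub>R x)) z"
      unfolding partials_latsum[OF shell_test_fns[OF \<omega>]] weight_shell_fun[of "is" \<omega> i] latsum_cmult ..
    then have "partials is (\<lambda>y. latsum (shell f \<omega> i) y - fourier (shell f \<omega> i) y) z
      = ?\<beta> * (latsum (\<lambda>x. ?q ((1 / 2 ^ i) *\<^sub>R x)) z - (2 ^ i) ^ CARD('k) * fourier ?q (2 ^ i *\<^sub>R z))"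
      unfolding partials_diff[OF open_UNIV sm UNIV_I] partials_fourier_shell[OF \<omega>] by (simp only: right_diff_distrib)
    then have "norm (partials is (\<lambda>y. latsum (shell f \<omega> i) y - fourier (shell f \<omega> i) y) z) \<le> norm ?\<beta> * (C / (2 ^ i) ^ N)"
      using C(2)[of z i] z by (simp only: norm_mult) (intro mult_left_mono, auto intro: less_imp_le)
    also have "\<dots> \<le> norm ?\<beta> * (C / (2 ^ i) ^ N * (2 ^ i) ^ CARD('k))"
      using C(1) mult_left_mono[of 1 "(2 ^ i) ^ CARD('k) :: real" "C / (2 ^ i) ^ N"] by (intro mult_left_mono) auto
    also have "\<dots> = C * (norm ?\<beta> * ((2 ^ i) ^ CARD('k) / (2 ^ i) ^ N))" by simp
    also have "\<dots> = C * gain (length is) N ^ i" unfolding norm_gain ..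
    finally show ?thesis .
  qed
  then show "\<exists>e>0. \<exists>B. summable B \<and> (\<forall>i. \<forall>z\<in>ball y e \<inter> half_box.
      norm (partials is (\<lambda>y. latsum (shell f \<omega> i) y - fourier (shell f \<omega> i) y) z) \<le> B i)"
    using geometric_gain_summable[OF N, of C] by (intro exI[of _ 1] conjI exI[of _ "\<lambda>i. C * gain (length is) N ^ i"]) auto
qed

lemma inner_shell_test_off_0:
  assumes "cutoff \<omega>" shows "inner_shell f \<omega> j \<in> test_off_0"
  unfolding inner_shell_def[abs_def] using assms
  by (intro test_off_0_mult smooth annulus_test_off_0) (auto simp: cutoff_def)

lemma inner_shell_test_fns: "cutoff \<omega> \<Longrightarrow> inner_shell f \<omega> j \<in> test_fns"
  using inner_shell_test_off_0 test_off_0_iff by blast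

lemma inner_shell_eq:
  "inner_shell f \<omega> j x = of_real (1 / 2 ^ Suc j) powr (- s) * shell f \<omega> 0 (2 ^ Suc j *\<^sub>R x)"
proof (cases "x = 0")
  case False
  have "f x = of_real (1 / 2 ^ Suc j) powr (- s) * f (2 ^ Suc j *\<^sub>R x)"
    using f_scaleR[of "2 ^ Suc j *\<^sub>R x" "1 / 2 ^ Suc j"] False by simp
  then show ?thesis by (simp add: shell_def inner_shell_def)
qed (simp add: shell_def inner_shell_def)

lemma fourier_inner_shell:
  assumes \<omega>: "cutoff \<omega>"
  shows "fourier (inner_shell f \<omega> j) y = of_real (1 / 2 ^ Suc j) powr (- s) * of_real (1 / 2 ^ Suc j) ^ CARD('k)
    * fourier (shell f \<omega> 0) ((1 / 2 ^ Suc j) *\<^sub>R y)"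
proof -
  have "inner_shell f \<omega> j = (\<lambda>x. of_real (1 / 2 ^ Suc j) powr (- s) * shell f \<omega> 0 (2 ^ Suc j *\<^sub>R x))"
    by (rule ext) (rule inner_shell_eq)
  then have "fourier (inner_shell f \<omega> j) y = of_real (1 / 2 ^ Suc j) powr (- s) * fourier (\<lambda>x. shell f \<omega> 0 (2 ^ Suc j *\<^sub>R x)) y"
    by (simp only: fourier_cmult)
  also have "fourier (\<lambda>x. shell f \<omega> 0 (2 ^ Suc j *\<^sub>R x)) y = of_real (1 / 2 ^ Suc j) ^ CARD('k) * fourier (shell f \<omega> 0) ((1 / 2 ^ Suc j) *\<^sub>R y)"
    using fourier_scaleR[OF shell_test_fns[OF \<omega>], of "1 / 2 ^ Suc j" 0 y]
    by (simp add: power_divide del: power_Suc)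
  finally show ?thesis by (simp only: mult.assoc)
qed

text \<open>The pieces at scale \<open>t = 2\<^sup>-\<^sup>(\<^sup>j\<^sup>+\<^sup>1\<^sup>)\<close> carry the factor \<open>t\<^sup>k\<^sup>-\<^sup>s\<close>, which may grow; vanishing to order \<open>n\<close> at the origin
  supplies \<open>t\<^sup>n\<close>. Beyond the order \<open>n\<close> the derivatives need no vanishing, because the chain rule already produces this factor.\<close>

lemma smooth_on_inner_fourier_series:
  assumes \<omega>: "cutoff \<omega>" and n: "Re s < real n + real CARD('k)"
    and van: "\<And>is. length is \<le> n \<Longrightarrow> \<exists>C. \<forall>y. norm (partials is (fourier (shell f \<omega> 0)) y) \<le> C * norm y ^ (n - length is)"
  shows "smooth_on UNIV (\<lambda>y. \<Sum>j. fourier (inner_shell f \<omega> j) y)"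
    and "\<exists>B. summable B \<and> (\<forall>j z. norm z \<le> K \<longrightarrow> norm (partials is (fourier (inner_shell f \<omega> j)) z) \<le> B j)"
proof -
  let ?g = "fourier (shell f \<omega> 0)"
  have smg: "smooth_on UNIV ?g" by (rule smooth_on_fourier[OF shell_test_fns[OF \<omega>]])
  have van': "\<exists>C\<ge>0. \<forall>t z. 0 \<le> t \<longrightarrow> t \<le> 1 \<longrightarrow> norm z \<le> K \<longrightarrow> t ^ length is * norm (partials is ?g (t *\<^sub>R z)) \<le> C * t ^ n"
    if K: "K \<ge> 0" for "is" K
  proof (cases "length is \<le> n")
    case True
    then obtain C where C: "\<And>y. norm (partials is ?g y) \<le> C * norm y ^ (n - length is)" using van by blast
    have "t ^ length is * norm (partials is ?g (t *\<^sub>R z)) \<le> (\<bar>C\<bar> * K ^ (n - length is)) * t ^ n"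
      if t: "0 \<le> t" "t \<le> 1" "norm z \<le> K" for t z
    proof -
      have "norm (partials is ?g (t *\<^sub>R z)) \<le> \<bar>C\<bar> * norm (t *\<^sub>R z) ^ (n - length is)"
        by (rule order_trans[OF C]) (intro mult_right_mono, auto)
      also have "\<dots> \<le> \<bar>C\<bar> * (t * K) ^ (n - length is)"
        using t by (intro mult_left_mono power_mono) (auto intro: mult_left_mono)
      finally have "t ^ length is * norm (partials is ?g (t *\<^sub>R z)) \<le> t ^ length is * (\<bar>C\<bar> * (t * K) ^ (n - length is))"
        using t by (intro mult_left_mono) auto
      also have "\<dots> = \<bar>C\<bar> * K ^ (n - length is) * (t ^ length is * t ^ (n - length is))"
        by (simp add: power_mult_distrib)
      also have "t ^ length is * t ^ (n - length is) = t ^ n" using True by (simp flip: power_add)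
      finally show ?thesis .
    qed
    then show ?thesis using K by (intro exI[of _ "\<bar>C\<bar> * K ^ (n - length is)"]) auto
  next
    case False
    obtain C where C: "C \<ge> 0" "\<And>y. norm (fourier (\<lambda>x. weight is x * shell f \<omega> 0 x) y) \<le> C"
      using fourier_decay[OF test_fns_weight[OF shell_test_fns[OF \<omega>]], of 0 "is" 0] by auto
    have "t ^ length is * norm (partials is ?g (t *\<^sub>R z)) \<le> C * t ^ n" if t: "0 \<le> t" "t \<le> 1" for t z
    proof -
      have "t ^ length is * norm (partials is ?g (t *\<^sub>R z)) \<le> t ^ n * C"
        using t C False unfolding partials_fourier[OF shell_test_fns[OF \<omega>]]
        by (intro mult_mono power_decreasing) auto
      then show ?thesis by (simp add: mult.commute)
    qed
    then show ?thesis using C(1) by blast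
  qed
  define r where "r = (1 / 2 :: real) powr (real n + real CARD('k) - Re s)"
  have r: "0 \<le> r" "r < 1" using n unfolding r_def by (auto simp: powr_def intro!: mult_pos_neg ln_less_zero)
  have bd: "\<exists>B. summable B \<and> (\<forall>j z. norm z \<le> K \<longrightarrow> norm (partials is (fourier (inner_shell f \<omega> j)) z) \<le> B j)" for K "is"
  proof -
    obtain C where C: "C \<ge> 0" "\<And>t z. 0 \<le> t \<Longrightarrow> t \<le> 1 \<Longrightarrow> norm z \<le> max K 0 \<Longrightarrow>
      t ^ length is * norm (partials is ?g (t *\<^sub>R z)) \<le> C * t ^ n"
      using van'[of "max K 0" "is"] by auto
    have "norm (partials is (fourier (inner_shell f \<omega> j)) z) \<le> C * r ^ Suc j" if z: "norm z \<le> K" for j z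
    proof -
      define t where "t = (1 / 2 ^ Suc j :: real)"
      have t: "t > 0" "t \<le> 1" "t = (1 / 2) ^ Suc j" by (auto simp: t_def power_divide field_simps intro: order_trans[OF one_le_power[of 2 j]])
      have eq: "fourier (inner_shell f \<omega> j) = (\<lambda>y. (of_real t powr (- s) * of_real t ^ CARD('k)) * ?g (t *\<^sub>R y))"
        unfolding t_def by (rule ext) (rule fourier_inner_shell[OF \<omega>])
      have "partials is (fourier (inner_shell f \<omega> j)) z = (of_real t powr (- s) * of_real t ^ CARD('k)) * (of_real t ^ length is * partials is ?g (t *\<^sub>R z))"
        unfolding eq partials_cmult[OF open_UNIV smooth_on_scaleR[OF smg] UNIV_I] partials_scaleR[OF smg] ..
      then have "norm (partials is (fourier (inner_shell f \<omega> j)) z) = t powr (- Re s) * t ^ CARD('k) * (t ^ length is * norm (partials is ?g (t *\<^sub>R z)))"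
        using t(1) by (simp add: norm_mult norm_power norm_powr_real_powr)
      also have "\<dots> \<le> t powr (- Re s) * t ^ CARD('k) * (C * t ^ n)"
        using C(2)[of t z] t(1,2) z by (intro mult_left_mono) auto
      also have "\<dots> = C * t powr (real n + real CARD('k) - Re s)"
        using t(1) by (simp add: powr_add powr_diff powr_minus powr_realpow field_simps)
      also have "t powr (real n + real CARD('k) - Re s) = r ^ Suc j"
        unfolding r_def t(3) by (simp only: powr_realpow[symmetric] powr_powr powr_gt_zero half_gt_zero_iff zero_less_one mult.commute)
      finally show ?thesis .
    qed
    moreover have "summable (\<lambda>j. C * r ^ Suc j)"
      using r by (subst summable_Suc_iff[of "\<lambda>j. C * r ^ j"]) (intro summable_mult summable_geometric, auto)
    ultimately show ?thesis by blast
  qed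
  then show "\<exists>B. summable B \<and> (\<forall>j z. norm z \<le> K \<longrightarrow> norm (partials is (fourier (inner_shell f \<omega> j)) z) \<le> B j)" .
  show "smooth_on UNIV (\<lambda>y. \<Sum>j. fourier (inner_shell f \<omega> j) y)"
  proof (rule smooth_on_suminf[OF open_UNIV smooth_on_fourier[OF inner_shell_test_fns[OF \<omega>]]])
    fix "is" :: "'k list" and y :: "real^'k"
    have "norm z \<le> norm y + 1" if "z \<in> ball y 1" for z
      using that norm_triangle_sub[of z y] by (simp add: dist_norm norm_minus_commute)
    then show "\<exists>e>0. \<exists>B. summable B \<and> (\<forall>j. \<forall>z\<in>ball y e \<inter> UNIV. norm (partials is (fourier (inner_shell f \<omega> j)) z) \<le> B j)"
      using bd[of "norm y + 1" "is"] by (intro exI[of _ 1]) auto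
  qed
qed

end

section \<open>Cutoffs adapted to the homogeneity\<close>

text \<open>The combination \<open>\<Sum>c\<^sub>l \<delta>(a\<^sub>l)\<close> of dilations acts as the identity on homogeneous distributions and annihilates
  polynomials of degree less than \<open>n\<close>. The bound \<open>\<bar>a\<^sub>l\<bar> \<le> 1\<close> keeps the support of the new cutoff in the unit ball.\<close>

locale moment_cutoff = homogeneous_fn f s \<epsilon>
  for f :: "real^'k::finite \<Rightarrow> complex" and s \<epsilon> +
  fixes n L :: nat and c :: "nat \<Rightarrow> complex" and a :: "nat \<Rightarrow> real" and \<eta> :: "real^'k \<Rightarrow> complex"
  assumes a: "\<And>l. l < L \<Longrightarrow> a l \<noteq> 0 \<and> \<bar>a l\<bar> \<le> 1"
    and moments: "\<And>d. d < n \<Longrightarrow> (\<Sum>l<L. c l * of_real (a l) ^ d) = 0"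
    and chr_sum: "(\<Sum>l<L. c l * chr (a l)) = 1"
    and cutoff_\<eta>: "cutoff \<eta>"
begin

text \<open>The weights \<open>c\<^sub>l chr(a\<^sub>l)\<close> have total \<open>1\<close>, so this is again a cutoff. They are chosen such that the shells of \<open>\<omega>\<close>
  are obtained from those of \<open>\<eta>\<close> by the dual of the combination of dilations.\<close>

definition \<omega> :: "real^'k \<Rightarrow> complex" where
  "\<omega> x = (\<Sum>l<L. c l * chr (a l) * \<eta> ((1 / a l) *\<^sub>R x))"

lemma \<eta>_test_fns: "\<eta> \<in> test_fns"
  using cutoff_\<eta> by (simp add: cutoff_def)

lemma cutoff_\<omega>: "cutoff \<omega>"
  unfolding cutoff_def
proof (intro conjI allI impI)
  show "\<omega> \<in> test_fns"
    unfolding \<omega>_def[abs_def] using a by (intro test_fns_sum test_fns_cmult test_fns_scaleR \<eta>_test_fns) auto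
  obtain e where e: "e > 0" "\<And>x. norm x < e \<Longrightarrow> \<eta> x = 1" using cutoff_\<eta> unfolding cutoff_def by blast
  define d where "d = Min (insert 1 ((\<lambda>l. \<bar>a l\<bar> * e) ` {..<L}))"
  have d: "d > 0" unfolding d_def using a e(1) by (subst Min_gr_iff) auto
  have "\<omega> x = 1" if x: "norm x < d" for x
  proof -
    have "\<eta> ((1 / a l) *\<^sub>R x) = 1" if l: "l < L" for l
    proof (rule e(2))
      have "d \<le> \<bar>a l\<bar> * e" unfolding d_def using l by (intro Min_le) auto
      then have "norm x < \<bar>a l\<bar> * e" using x by linarith
      then show "norm ((1 / a l) *\<^sub>R x) < e" using a[OF l] by (simp add: field_simps)
    qed
    then show ?thesis using chr_sum by (simp add: \<omega>_def)
  qed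
  with d show "\<exists>d>0. \<forall>x. norm x < d \<longrightarrow> \<omega> x = 1" by blast
  fix x :: "real^'k" assume x: "1 \<le> norm x"
  have "\<eta> ((1 / a l) *\<^sub>R x) = 0" if l: "l < L" for l
  proof -
    have "\<bar>a l\<bar> \<le> norm x" using a[OF l] x by linarith
    then have "1 \<le> norm ((1 / a l) *\<^sub>R x)" using a[OF l] by (simp add: field_simps)
    then show ?thesis using cutoff_\<eta> by (simp only: cutoff_def)
  qed
  then show "\<omega> x = 0" by (simp add: \<omega>_def)
qed

lemma shell_\<omega>: "shell f \<omega> 0 x = (\<Sum>l<L. c l * (of_real (\<bar>1 / a l\<bar>) ^ CARD('k) * shell f \<eta> 0 ((1 / a l) *\<^sub>R x)))"
proof (cases "x = 0")
  case False
  have "shell f \<omega> 0 x = (\<Sum>l<L. c l * ((chr (a l) * f x) * (\<eta> ((1 / a l) *\<^sub>R ((1 / 2) *\<^sub>R x)) - \<eta> ((1 / a l) *\<^sub>R x))))"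
    unfolding shell_def \<omega>_def
    by (simp add: sum_distrib_left right_diff_distrib sum_subtractf[symmetric] mult_ac)
  also have "\<dots> = (\<Sum>l<L. c l * (of_real (\<bar>1 / a l\<bar>) ^ CARD('k) * shell f \<eta> 0 ((1 / a l) *\<^sub>R x)))"
  proof (intro sum.cong refl)
    fix l assume "l \<in> {..<L}"
    then have "chr (a l) * f x = of_real (\<bar>1 / a l\<bar>) ^ CARD('k) * f ((1 / a l) *\<^sub>R x)"
      using False a by (intro chr_f) auto
    then show "c l * ((chr (a l) * f x) * (\<eta> ((1 / a l) *\<^sub>R ((1 / 2) *\<^sub>R x)) - \<eta> ((1 / a l) *\<^sub>R x)))
       = c l * (of_real (\<bar>1 / a l\<bar>) ^ CARD('k) * shell f \<eta> 0 ((1 / a l) *\<^sub>R x))"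
      by (simp add: shell_def mult.assoc mult.commute[of "2::real"])
  qed
  finally show ?thesis .
qed (simp add: shell_def)

lemma fourier_shell_\<omega>: "fourier (shell f \<omega> 0) y = (\<Sum>l<L. c l * fourier (shell f \<eta> 0) (a l *\<^sub>R y))"
proof -
  have "fourier (shell f \<omega> 0) y
     = fourier (\<lambda>x. \<Sum>l<L. c l * (of_real (\<bar>1 / a l\<bar>) ^ CARD('k) * shell f \<eta> 0 ((1 / a l) *\<^sub>R x))) y"
    by (rule arg_cong[where f = "\<lambda>g. fourier g y"]) (rule ext, rule shell_\<omega>)
  also have "\<dots> = (\<Sum>l<L. c l * (of_real (\<bar>1 / a l\<bar>) ^ CARD('k) * fourier (\<lambda>x. shell f \<eta> 0 ((1 / a l) *\<^sub>R x)) y))"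
    unfolding fourier_cmult[symmetric]
    by (intro fourier_sum test_fns_cmult test_fns_scaleR shell_test_fns cutoff_\<eta>) (use a in auto)
  also have "\<dots> = (\<Sum>l<L. c l * fourier (shell f \<eta> 0) (a l *\<^sub>R y))"
    by (intro sum.cong refl) (use a fourier_scaleR[OF shell_test_fns[OF cutoff_\<eta>]] in simp)
  finally show ?thesis .
qed

text \<open>On the Fourier side the combination of dilations acts directly, and all derivatives of the Fourier transform of a test function are bounded.\<close>

lemma fourier_shell_vanishing:
  assumes "length is \<le> n"
  shows "\<exists>C. \<forall>y. norm (partials is (fourier (shell f \<omega> 0)) y) \<le> C * norm y ^ (n - length is)"
proof -
  let ?h = "fourier (shell f \<eta> 0)"
  define m where "m = n - length is"
  have smh: "smooth_on UNIV ?h" by (rule smooth_on_fourier[OF shell_test_fns[OF cutoff_\<eta>]])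
  have "\<exists>C. \<forall>y. norm (partials js (partials is ?h) y) \<le> C" for js
    using fourier_decay[OF test_fns_weight[OF shell_test_fns[OF cutoff_\<eta>]], of 0 "js @ is" 0]
    by (auto simp: partials_append[symmetric] partials_fourier[OF shell_test_fns[OF cutoff_\<eta>]])
  then obtain B where B: "\<And>js y. norm (partials js (partials is ?h) y) \<le> B js" by metis
  define B' where "B' = Max (B ` {js. length js = m})"
  have fin: "finite {js::'k list. length js = m}" using finite_lists_length_eq[of "UNIV::'k set" m] by simp
  have B': "norm (partials js (partials is ?h) y) \<le> B'" if "length js = m" for js y
    using B[of js y] Max_ge[OF finite_imageI[OF fin], of "B js" B] that unfolding B'_def by force
  have eq: "partials is (fourier (shell f \<omega> 0)) y = (\<Sum>l<L. (c l * of_real (a l) ^ length is) * partials is ?h (a l *\<^sub>R y))" for y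
  proof -
    have "partials is (fourier (shell f \<omega> 0)) y = partials is (\<lambda>y. \<Sum>l<L. c l * ?h (a l *\<^sub>R y)) y"
      by (rule arg_cong[where f = "\<lambda>g. partials is g y"]) (rule ext, rule fourier_shell_\<omega>)
    then show ?thesis
      by (simp add: partials_sum[OF open_UNIV] partials_cmult[OF open_UNIV] partials_scaleR[OF smh]
          smooth_on_cmult smooth_on_scaleR smh mult.assoc)
  qed
  have "norm (partials is (fourier (shell f \<omega> 0)) y)
      \<le> (\<Sum>l<L. norm (c l * of_real (a l) ^ length is) * \<bar>a l\<bar> ^ m) * real CARD('k) ^ m * B' * norm y ^ m" for y
    unfolding eq
  proof (rule norm_dilation_combination_le[OF smooth_on_partials[OF smh]])
    show "(\<Sum>l<L. c l * of_real (a l) ^ length is * of_real (a l) ^ d) = 0" if "d < m" for d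
      using moments[of "length is + d"] that assms by (simp add: m_def power_add mult.assoc)
  qed (rule B')
  then show ?thesis unfolding m_def by blast
qed

end

section \<open>Schwartz functions\<close>

lemma schwartz_smooth: "\<phi> \<in> schwartz \<Longrightarrow> smooth_on UNIV \<phi>"
  by (simp add: schwartz_def)

lemma finite_short_lists: "finite {is :: 'k::finite list. length is \<le> N}"
  using finite_lists_length_le[of "UNIV :: 'k set" N] by simp

lemma schwartz_bound:
  fixes \<phi> :: "real^'k::finite \<Rightarrow> complex"
  assumes "\<phi> \<in> schwartz"
  obtains C where "C \<ge> 0" "\<And>is x. length is \<le> m \<Longrightarrow> (1 + norm x) ^ N * norm (partials is \<phi> x) \<le> C"
proof -
  have "\<exists>C. \<forall>x. (1 + norm x) ^ N * norm (partials is \<phi> x) \<le> C" for "is"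
  proof -
    have "bounded (range (\<lambda>x. (1 + norm x) ^ N * norm (partials is \<phi> x)))"
      using assms by (simp add: schwartz_def)
    then obtain C where "\<forall>y\<in>range (\<lambda>x. (1 + norm x) ^ N * norm (partials is \<phi> x)). norm y \<le> C"
      unfolding bounded_iff by blast
    then have "\<forall>x. (1 + norm x) ^ N * norm (partials is \<phi> x) \<le> C" by auto
    then show ?thesis by blast
  qed
  then obtain C where C: "\<And>is x. (1 + norm x) ^ N * norm (partials is \<phi> x) \<le> C is" by metis
  have C0: "C is \<ge> 0" for "is" by (rule order_trans[OF _ C[of 0]]) simp
  show ?thesis
  proof (rule that[of "\<Sum>is\<in>{is. length is \<le> m}. C is"])
    fix "is" :: "'k list" and x :: "real^'k" assume "length is \<le> m"
    then have "C is \<le> (\<Sum>is\<in>{is. length is \<le> m}. C is)"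
      by (intro member_le_sum) (auto simp: C0 finite_short_lists)
    then show "(1 + norm x) ^ N * norm (partials is \<phi> x) \<le> (\<Sum>is\<in>{is. length is \<le> m}. C is)"
      using C order_trans by blast
  qed (simp add: sum_nonneg C0)
qed

lemma schwartzI:
  assumes "smooth_on UNIV \<phi>" "\<And>is N. \<exists>C. \<forall>x. (1 + norm x) ^ N * norm (partials is \<phi> x) \<le> C"
  shows "\<phi> \<in> schwartz"
proof -
  have "bounded (range (\<lambda>x. (1 + norm x) ^ N * norm (partials is \<phi> x)))" for "is" N
  proof -
    obtain C where "\<And>x. (1 + norm x) ^ N * norm (partials is \<phi> x) \<le> C" using assms(2) by metis
    then show ?thesis unfolding bounded_iff by (intro exI[of _ C]) auto
  qed
  then show ?thesis using assms(1) by (simp add: schwartz_def)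
qed

lemma schwartz_seminorm_upper:
  fixes \<phi> :: "real^'k::finite \<Rightarrow> complex"
  assumes "\<phi> \<in> schwartz" "length is \<le> N"
  shows "(1 + norm x) ^ N * norm (partials is \<phi> x) \<le> schwartz_seminorm N \<phi>"
proof -
  obtain C where C: "\<And>is x. length is \<le> N \<Longrightarrow> (1 + norm x) ^ N * norm (partials is \<phi> x) \<le> C"
    using schwartz_bound[OF assms(1), of N N] by metis
  have "(\<lambda>(is, x). (1 + norm x) ^ N * norm (partials is \<phi> x)) (is, x) \<le> schwartz_seminorm N \<phi>"
    unfolding schwartz_seminorm_def
  proof (rule cSUP_upper)
    show "bdd_above ((\<lambda>(is, x). (1 + norm x) ^ N * norm (partials is \<phi> x)) ` ({is. length is \<le> N} \<times> UNIV))"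
      using C by (intro bdd_aboveI[of _ C]) auto
  qed (use assms in auto)
  then show ?thesis by simp
qed

lemma schwartz_seminorm_le:
  fixes \<phi> :: "real^'k::finite \<Rightarrow> complex"
  assumes "\<And>is x. length is \<le> N \<Longrightarrow> (1 + norm x) ^ N * norm (partials is \<phi> x) \<le> B"
  shows "schwartz_seminorm N \<phi> \<le> B"
  unfolding schwartz_seminorm_def
proof (rule cSUP_least)
  have "([], 0) \<in> {is :: 'k list. length is \<le> N} \<times> (UNIV :: (real^'k) set)" by simp
  then show "{is :: 'k list. length is \<le> N} \<times> (UNIV :: (real^'k) set) \<noteq> {}" by blast
qed (use assms in auto)

lemma schwartz_zero: "(\<lambda>x. 0) \<in> schwartz"
  by (rule schwartzI) auto

lemma schwartz_add:
  assumes "\<phi> \<in> schwartz" "\<theta> \<in> schwartz" shows "(\<lambda>x. \<phi> x + \<theta> x) \<in> schwartz"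
proof (rule schwartzI)
  show "smooth_on UNIV (\<lambda>x. \<phi> x + \<theta> x)" by (intro smooth_on_add schwartz_smooth assms open_UNIV)
  fix "is" N
  obtain C D where C: "\<And>x. (1 + norm x) ^ N * norm (partials is \<phi> x) \<le> C" and D: "\<And>x. (1 + norm x) ^ N * norm (partials is \<theta> x) \<le> D"
    using schwartz_bound[OF assms(1), of "length is" N] schwartz_bound[OF assms(2), of "length is" N] by (metis order_refl)
  have "(1 + norm x) ^ N * norm (partials is (\<lambda>x. \<phi> x + \<theta> x) x) \<le> C + D" for x
  proof -
    have "(1 + norm x) ^ N * norm (partials is (\<lambda>x. \<phi> x + \<theta> x) x)
       \<le> (1 + norm x) ^ N * (norm (partials is \<phi> x) + norm (partials is \<theta> x))"
      by (intro mult_left_mono) (simp_all add: partials_add[OF open_UNIV] schwartz_smooth assms norm_triangle_ineq)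
    also have "\<dots> \<le> C + D" using C[of x] D[of x] by (simp add: distrib_left)
    finally show ?thesis .
  qed
  then show "\<exists>C. \<forall>x. (1 + norm x) ^ N * norm (partials is (\<lambda>x. \<phi> x + \<theta> x) x) \<le> C" by blast
qed

lemma schwartz_cmult:
  assumes "\<phi> \<in> schwartz" shows "(\<lambda>x. c * \<phi> x) \<in> schwartz"
proof (rule schwartzI)
  show "smooth_on UNIV (\<lambda>x. c * \<phi> x)" by (intro smooth_on_cmult schwartz_smooth assms open_UNIV)
  fix "is" N
  obtain C where C: "\<And>x. (1 + norm x) ^ N * norm (partials is \<phi> x) \<le> C"
    using schwartz_bound[OF assms, of "length is" N] by (metis order_refl)
  have "(1 + norm x) ^ N * norm (partials is (\<lambda>x. c * \<phi> x) x) \<le> norm c * C" for x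
    using mult_left_mono[OF C[of x], of "norm c"]
    by (simp add: partials_cmult[OF open_UNIV] schwartz_smooth assms norm_mult mult_ac)
  then show "\<exists>C. \<forall>x. (1 + norm x) ^ N * norm (partials is (\<lambda>x. c * \<phi> x) x) \<le> C" by blast
qed

lemma schwartz_sum: "(\<And>l. l \<in> A \<Longrightarrow> \<phi> l \<in> schwartz) \<Longrightarrow> (\<lambda>x. \<Sum>l\<in>A. \<phi> l x) \<in> schwartz"
  by (induction A rule: infinite_finite_induct) (auto intro: schwartz_zero schwartz_add)

lemma schwartz_scaleR:
  assumes "\<phi> \<in> schwartz" "a \<noteq> 0" shows "(\<lambda>x. \<phi> (a *\<^sub>R x)) \<in> schwartz"
proof (rule schwartzI)
  show "smooth_on UNIV (\<lambda>x. \<phi> (a *\<^sub>R x))" by (intro smooth_on_scaleR schwartz_smooth assms)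
  fix "is" N
  obtain C where C: "C \<ge> 0" "\<And>x. (1 + norm x) ^ N * norm (partials is \<phi> x) \<le> C"
    using schwartz_bound[OF assms(1), of "length is" N] by (metis order_refl)
  define m where "m = max 1 (1 / \<bar>a\<bar>)"
  have m: "m > 0" by (simp add: m_def)
  have "(1 + norm x) ^ N * norm (partials is (\<lambda>x. \<phi> (a *\<^sub>R x)) x) \<le> m ^ N * \<bar>a\<bar> ^ length is * C" for x
  proof -
    have "norm x = (1 / \<bar>a\<bar>) * norm (a *\<^sub>R x)" using assms(2) by simp
    also have "\<dots> \<le> m * norm (a *\<^sub>R x)" by (intro mult_right_mono) (auto simp: m_def)
    finally have "1 + norm x \<le> m * (1 + norm (a *\<^sub>R x))"
      unfolding distrib_left by (intro add_mono) (auto simp: m_def)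
    then have "(1 + norm x) ^ N \<le> (m * (1 + norm (a *\<^sub>R x))) ^ N" by (intro power_mono) auto
    then have "(1 + norm x) ^ N * norm (partials is (\<lambda>x. \<phi> (a *\<^sub>R x)) x)
       \<le> (m * (1 + norm (a *\<^sub>R x))) ^ N * (\<bar>a\<bar> ^ length is * norm (partials is \<phi> (a *\<^sub>R x)))"
      using m by (intro mult_mono)
        (auto simp: partials_scaleR[OF schwartz_smooth[OF assms(1)]] norm_mult norm_power
          intro!: zero_le_power mult_nonneg_nonneg add_nonneg_nonneg)
    also have "\<dots> = m ^ N * \<bar>a\<bar> ^ length is * ((1 + norm (a *\<^sub>R x)) ^ N * norm (partials is \<phi> (a *\<^sub>R x)))"
      by (simp only: power_mult_distrib mult_ac)
    also have "\<dots> \<le> m ^ N * \<bar>a\<bar> ^ length is * C" using m by (intro mult_left_mono C) auto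
    finally show ?thesis .
  qed
  then show "\<exists>C. \<forall>x. (1 + norm x) ^ N * norm (partials is (\<lambda>x. \<phi> (a *\<^sub>R x)) x) \<le> C" by blast
qed

lemma test_fns_schwartz: 
  assumes "q \<in> test_fns" shows "q \<in> schwartz"
proof (rule schwartzI[OF test_fns_smooth[OF assms]])
  fix "is" N
  obtain R where R: "R > 0" "\<forall>x. R < norm x \<longrightarrow> partials is q x = 0"
    using test_fns_support[OF test_fns_partials[OF assms]] by blast
  obtain A where A: "A > 0" "\<And>x. norm (partials is q x) \<le> A" using test_fns_bounded[OF test_fns_partials[OF assms]] by metis
  have "(1 + norm x) ^ N * norm (partials is q x) \<le> (1 + R) ^ N * A" for x
  proof (cases "norm x \<le> R")
    case True
    then show ?thesis using A R by (intro mult_mono power_mono) auto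
  next
    case False
    with R A show ?thesis by simp
  qed
  then show "\<exists>C. \<forall>x. (1 + norm x) ^ N * norm (partials is q x) \<le> C" by blast
qed

lemma test_fns_partials_bound:
  fixes q :: "real^'k::finite \<Rightarrow> complex"
  assumes "q \<in> test_fns"
  obtains A where "A \<ge> 0" "\<And>is x. length is \<le> m \<Longrightarrow> norm (partials is q x) \<le> A"
  using schwartz_bound[OF test_fns_schwartz[OF assms], of m 0] by (metis mult_1 power_0)

lemma schwartz_mult:
  fixes g :: "real^'k::finite \<Rightarrow> complex"
  assumes g: "smooth_on UNIV g" "\<And>m. \<exists>A. \<forall>is x. length is \<le> m \<longrightarrow> norm (partials is g x) \<le> A" and \<phi>: "\<phi> \<in> schwartz"
  shows "(\<lambda>x. g x * \<phi> x) \<in> schwartz"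
proof (rule schwartzI)
  show "smooth_on UNIV (\<lambda>x. g x * \<phi> x)" by (intro smooth_on_mult g schwartz_smooth \<phi> open_UNIV)
  fix "is" :: "'k list" and N
  obtain C where C: "C \<ge> 0" "\<And>js x. length js \<le> length is \<Longrightarrow> (1 + norm x) ^ N * norm (partials js \<phi> x) \<le> C"
    using schwartz_bound[OF \<phi>, of "length is" N] by metis
  obtain A where A: "\<And>js x. length js \<le> length is \<Longrightarrow> norm (partials js g x) \<le> A" using g(2) by metis
  have "(1 + norm x) ^ N * norm (partials is (\<lambda>x. g x * \<phi> x) x) \<le> 2 ^ length is * (A * C)" for x
  proof -
    have p: "(1 + norm x) ^ N > 0" by (intro zero_less_power) (simp add: add_pos_nonneg)
    have "norm (partials is (\<lambda>x. g x * \<phi> x) x) \<le> 2 ^ length is * (A * (C / (1 + norm x) ^ N))"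
      by (rule norm_partials_mult_le) (use g(1) schwartz_smooth[OF \<phi>] A C(2)[of _ x] p in \<open>auto simp: field_simps\<close>)
    then have "(1 + norm x) ^ N * norm (partials is (\<lambda>x. g x * \<phi> x) x)
       \<le> (1 + norm x) ^ N * (2 ^ length is * (A * (C / (1 + norm x) ^ N)))"
      using p by (intro mult_left_mono) auto
    also have "\<dots> = 2 ^ length is * (A * C)"
    proof -
      have "P * (2 ^ length is * (A * (C / P))) = 2 ^ length is * (A * C)" if "P > 0" for P :: real
        using that by simp
      from this[OF p] show ?thesis .
    qed
    finally show ?thesis .
  qed
  then show "\<exists>C. \<forall>x. (1 + norm x) ^ N * norm (partials is (\<lambda>x. g x * \<phi> x) x) \<le> C" by blast
qed

lemma schwartz_test_fns_mult:
  assumes "q \<in> test_fns" "\<phi> \<in> schwartz" shows "(\<lambda>x. q x * \<phi> x) \<in> schwartz"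
proof (rule schwartz_mult[OF test_fns_smooth[OF assms(1)] _ assms(2)])
  show "\<exists>A. \<forall>is x. length is \<le> m \<longrightarrow> norm (partials is q x) \<le> A" for m
    using test_fns_partials_bound[OF assms(1), of m] by metis
qed

lemma tempered_linear:
  assumes "tempered u" "\<phi> \<in> schwartz" "\<theta> \<in> schwartz"
  shows "u (\<lambda>x. a * \<phi> x + b * \<theta> x) = a * u \<phi> + b * u \<theta>"
  using assms by (simp add: tempered_def)

lemma tempered_sum:
  assumes u: "tempered u" and "\<And>l. l \<in> A \<Longrightarrow> \<phi> l \<in> schwartz" "finite A"
  shows "u (\<lambda>x. \<Sum>l\<in>A. c l * \<phi> l x) = (\<Sum>l\<in>A. c l * u (\<phi> l))"
  using assms(3,2)
proof (induction A)
  case empty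
  show ?case using tempered_linear[OF u schwartz_zero schwartz_zero, of 0 0] by simp
next
  case (insert l A)
  have "u (\<lambda>x. c l * \<phi> l x + 1 * (\<Sum>l\<in>A. c l * \<phi> l x)) = c l * u (\<phi> l) + 1 * u (\<lambda>x. \<Sum>l\<in>A. c l * \<phi> l x)"
    using insert.prems by (intro tempered_linear[OF u] schwartz_sum schwartz_cmult) auto
  then show ?case using insert by simp
qed

lemma tempered_add:
  assumes "tempered u" "\<phi> \<in> schwartz" "\<theta> \<in> schwartz"
  shows "u (\<lambda>x. \<phi> x + \<theta> x) = u \<phi> + u \<theta>"
  using tempered_linear[OF assms, of 1 1] by simp

lemma tempered_cmult:
  assumes "tempered u" "\<phi> \<in> schwartz" shows "u (\<lambda>x. c * \<phi> x) = c * u \<phi>"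
  using tempered_sum[OF assms(1), of "{()}" "\<lambda>_. \<phi>" "\<lambda>_. c"] assms(2) by simp

lemma tempered_tendsto_0:
  assumes u: "\<And>\<phi>. \<phi> \<in> schwartz \<Longrightarrow> norm (u \<phi>) \<le> C * schwartz_seminorm M \<phi>"
    and p: "\<And>J. p J \<in> schwartz" and sem: "\<And>J. schwartz_seminorm M (p J) \<le> K * (1 / 2) ^ J"
  shows "(\<lambda>J. u (p J)) \<longlonglongrightarrow> 0"
proof (rule Lim_null_comparison)
  show "\<forall>\<^sub>F J in sequentially. norm (u (p J)) \<le> (\<bar>C\<bar> * K) * (1 / 2) ^ J"
  proof (intro always_eventually allI)
    fix J
    have "schwartz_seminorm M (p J) \<ge> 0"
      by (rule order_trans[OF _ schwartz_seminorm_upper[OF p, of "[]" _ 0]]) auto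
    then have "norm (u (p J)) \<le> \<bar>C\<bar> * schwartz_seminorm M (p J)"
      by (intro order_trans[OF u[OF p]] mult_right_mono) auto
    also have "\<dots> \<le> \<bar>C\<bar> * (K * (1 / 2) ^ J)" by (intro mult_left_mono sem) auto
    finally show "norm (u (p J)) \<le> (\<bar>C\<bar> * K) * (1 / 2) ^ J" by (simp only: mult.assoc)
  qed
  have "(\<lambda>J. (1 / 2 :: real) ^ J) \<longlonglongrightarrow> 0" by (intro LIMSEQ_realpow_zero) auto
  from tendsto_mult[OF tendsto_const[of "\<bar>C\<bar> * K"] this]
  show "(\<lambda>J. (\<bar>C\<bar> * K) * (1 / 2) ^ J) \<longlonglongrightarrow> 0" by (simp only: mult_zero_right)
qed

section \<open>Functions determined by their integrals against test functions\<close>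

lemma integrable_mult_test_off_0:
  fixes g :: "real^'k::finite \<Rightarrow> complex"
  assumes g: "continuous_on (- {0}) g" and \<phi>: "\<phi> \<in> test_off_0"
  shows "integrable lborel (\<lambda>x. g x * \<phi> x)"
proof -
  obtain d where T: "\<phi> \<in> test_fns" and d: "d > 0" "\<And>x. norm x < d \<Longrightarrow> \<phi> x = 0"
    using \<phi> unfolding test_off_0_iff by blast
  obtain R where R: "\<forall>x. R < norm x \<longrightarrow> \<phi> x = 0" using test_fns_support[OF T] by blast
  have "continuous_on (- {0}) (\<lambda>x. g x * \<phi> x)"
    by (intro continuous_on_mult g continuous_on_subset[OF test_fns_continuous[OF T]]) auto
  moreover have "continuous_on (ball 0 d) (\<lambda>x. g x * \<phi> x)"
    by (rule continuous_on_eq[OF continuous_on_const[of _ 0]]) (use d(2) in auto)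
  ultimately have "continuous_on (- {0} \<union> ball 0 d) (\<lambda>x. g x * \<phi> x)"
    by (intro continuous_on_open_Un) auto
  moreover have "- {0} \<union> ball 0 d = (UNIV :: (real^'k) set)" using d(1) by auto
  ultimately show ?thesis using R by (intro integrable_if_continuous_support[of _ R]) auto
qed

text \<open>Test against a bump supported where the real part of \<open>g / g(x\<^sub>0)\<close> is at least \<open>1/2\<close>.\<close>

lemma eq_0_if_integrals_eq_0:
  fixes g :: "real^'k::finite \<Rightarrow> complex"
  assumes g: "continuous_on (- {0}) g" and int: "\<And>\<phi>. \<phi> \<in> test_off_0 \<Longrightarrow> (LINT x|lborel. g x * \<phi> x) = 0"
    and x0: "x0 \<noteq> 0"
  shows "g x0 = 0"
proof (rule ccontr)
  assume nz: "g x0 \<noteq> 0"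
  define h where "h = (\<lambda>x. Re (g x / g x0))"
  have hc: "continuous_on (- {0}) h" unfolding h_def by (intro continuous_intros g) (use nz in auto)
  have "open (- {0::real^'k})" by auto
  then have "isCont h x0" using hc x0 continuous_on_eq_continuous_at by blast
  then obtain e where e: "e > 0" "\<And>x. dist x x0 < e \<Longrightarrow> dist (h x) (h x0) < 1/2"
    unfolding continuous_at_eps_delta dist_norm by (metis half_gt_zero zero_less_one)
  define r where "r = min e (norm x0 / 2)"
  have r: "r > 0" "r \<le> e" "r \<le> norm x0 / 2" using e(1) x0 by (auto simp: r_def)
  have hr: "h x \<ge> 1/2" if "norm (x - x0) < r" for x
  proof -
    have "dist (h x) (h x0) < 1/2" using e(2)[of x] that r(2) by (simp add: dist_norm)
    moreover have "h x0 = 1" using nz by (simp add: h_def)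
    ultimately show ?thesis unfolding dist_real_def by linarith
  qed
  define b where "b = (\<lambda>x. flat 0 (r\<^sup>2 + (-1) * (norm (x - x0))\<^sup>2))"
  have b0: "b x = 0" if "norm (x - x0) \<ge> r" for x
  proof -
    have "r\<^sup>2 \<le> (norm (x - x0))\<^sup>2" by (rule power_mono[OF that]) (use r in simp)
    then have "\<not> 0 < r\<^sup>2 + (-1) * (norm (x - x0))\<^sup>2" by linarith
    then show ?thesis by (simp only: b_def flat_def if_False)
  qed
  have bnn: "b x \<ge> 0" for x by (simp add: b_def flat_nonneg)
  have smb: "smooth_on UNIV (\<lambda>x. of_real (b x) :: complex)"
    unfolding b_def by (rule smooth_on_flat)
  have bT: "(\<lambda>x. of_real (b x) :: complex) \<in> test_fns"
  proof (rule test_fnsI[OF smb, of "norm x0 + r"])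
    fix x :: "real^'k" assume "norm x > norm x0 + r"
    then have "norm (x - x0) \<ge> r" using norm_triangle_ineq2[of x x0] by linarith
    then show "of_real (b x) = (0::complex)" by (simp add: b0)
  qed
  have bO: "(\<lambda>x. of_real (b x) :: complex) \<in> test_off_0"
    unfolding test_off_0_iff
  proof (intro conjI exI[of _ "norm x0 / 2"] allI impI)
    fix x :: "real^'k" assume "norm x < norm x0 / 2"
    then have "norm (x - x0) \<ge> r" using r(3) norm_triangle_ineq2[of x0 x] by (simp add: norm_minus_commute)
    then show "of_real (b x) = (0::complex)" by (simp add: b0)
  qed (use bT x0 in auto)
  have intg: "integrable lborel (\<lambda>x. g x * of_real (b x))" by (rule integrable_mult_test_off_0[OF g bO])
  have hb: "h x * b x = Re (inverse (g x0) * (g x * of_real (b x)))" for x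
  proof -
    have "inverse (g x0) * (g x * of_real (b x)) = (g x / g x0) * of_real (b x)"
      by (simp add: divide_inverse mult_ac)
    moreover have "Re (z * of_real r) = Re z * r" for z r by simp
    ultimately show ?thesis by (simp only: h_def)
  qed
  have ih: "integrable lborel (\<lambda>x. h x * b x)"
    unfolding hb by (intro integrable_Re integrable_mult_right intg)
  have "(LINT x|lborel. h x * b x) = Re (inverse (g x0) * (LINT x|lborel. g x * of_real (b x)))"
    unfolding hb using intg by (simp only: integral_Re integrable_mult_right integral_mult_right_zero)
  then have zero: "(LINT x|lborel. h x * b x) = 0" by (simp add: int[OF bO])
  define m where "m = flat 0 (r\<^sup>2 - (r / 2)\<^sup>2)"
  have m: "m > 0" unfolding m_def flat_pos_iff using r(1) by (simp add: power_divide)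
  have mono: "flat 0 s \<le> flat 0 t" if "s \<le> t" for s t :: real
    using that by (auto simp: flat_def le_imp_inverse_le)
  have "m / 2 * measure lborel (cball x0 (r / 2)) = (LINT x|lborel. m / 2 * indicator (cball x0 (r / 2)) x)"
    by simp
  also have "\<dots> \<le> (LINT x|lborel. h x * b x)"
  proof (rule integral_mono)
    show "integrable lborel (\<lambda>x. m / 2 * indicator (cball x0 (r / 2)) x)"
      using emeasure_lborel_cball_finite[of x0 "r / 2"]
      by (intro integrable_mult_right) (simp add: integrable_indicator_iff)
    fix x
    show "m / 2 * indicator (cball x0 (r / 2)) x \<le> h x * b x"
    proof (cases "norm (x - x0) \<le> r / 2")
      case True
      have "(norm (x - x0))\<^sup>2 \<le> (r / 2)\<^sup>2" using True by (intro power_mono) auto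
      then have "m \<le> b x" unfolding m_def b_def by (intro mono) auto
      moreover have "h x \<ge> 1/2" using True r(1) by (intro hr) auto
      ultimately have "1/2 * m \<le> h x * b x" using m by (intro mult_mono) auto
      then show ?thesis using True by (simp add: dist_norm norm_minus_commute)
    next
      case False
      have "0 \<le> h x * b x"
        by (cases "norm (x - x0) < r") (use hr[of x] bnn[of x] b0[of x] in auto)
      with False show ?thesis by (simp add: dist_norm norm_minus_commute)
    qed
  qed (rule ih)
  finally have "m * measure lborel (cball x0 (r / 2)) \<le> 0" using zero by simp
  moreover have "measure lborel (cball x0 (r / 2)) > 0" using r(1) by simp
  ultimately show False using m by (simp add: mult_le_0_iff)
qed

section \<open>An integrable weight\<close>

text \<open>The sum of the indicators of the balls of radius \<open>2\<^sup>j\<close>, with coefficients \<open>2\<^sup>-\<^sup>j\<^sup>(\<^sup>k\<^sup>+\<^sup>1\<^sup>)\<close> up to a constant.\<close>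

lemma exists_integrable_weight:
  "\<exists>w :: real^'k::finite \<Rightarrow> real. integrable lborel w \<and> (\<forall>x. w x \<ge> 0) \<and>
    (\<forall>x. norm x \<le> 1 \<longrightarrow> 1 \<le> w x) \<and> (\<forall>x. norm x \<ge> 1 \<longrightarrow> 1 / norm x ^ (CARD('k) + 1) \<le> w x)"
proof -
  let ?p = "CARD('k) + 1"
  define F where "F = (\<lambda>(j::nat) (x::real^'k). 2 ^ ?p * (1 / 2 ^ j) ^ ?p * indicator (cball 0 (2 ^ j)) x :: real)"
  have Fnn: "F j x \<ge> 0" for j x by (simp add: F_def)
  have Fint: "integrable lborel (F j)" for j
    unfolding F_def using emeasure_lborel_cball_finite[of "0::real^'k"]
    by (intro integrable_mult_right) (simp add: integrable_indicator_iff)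
  define V where "V = unit_ball_vol (real CARD('k))"
  have Fval: "(LINT x|lborel. norm (F j x)) = 2 ^ ?p * V * (1 / 2) ^ j" for j
  proof -
    have "(LINT x|lborel. norm (F j x)) = 2 ^ ?p * (1 / 2 ^ j) ^ ?p * measure lborel (cball (0::real^'k) (2 ^ j))"
      using Fnn[of j] by (simp add: F_def)
    also have "measure lborel (cball (0::real^'k) (2 ^ j)) = V * (2 ^ j) ^ CARD('k)"
      by (simp add: content_cball V_def)
    finally show ?thesis by (simp add: power_divide)
  qed
  have Fle: "F j x \<le> 2 ^ ?p * (1 / 2) ^ j" for j x
  proof -
    have "(1 / 2 ^ j :: real) ^ ?p \<le> (1 / 2 ^ j) ^ 1" by (rule power_decreasing) auto
    then have "2 ^ ?p * (1 / 2 ^ j :: real) ^ ?p \<le> 2 ^ ?p * (1 / 2) ^ j"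
      by (intro mult_left_mono) (auto simp: power_divide)
    moreover have "F j x \<le> 2 ^ ?p * (1 / 2 ^ j) ^ ?p" by (simp add: F_def indicator_def)
    ultimately show ?thesis by linarith
  qed
  have Fsum: "summable (\<lambda>j. F j x)" for x
    by (rule summable_comparison_test'[of "\<lambda>j. 2 ^ ?p * (1 / 2) ^ j" 0])
      (use Fle Fnn in \<open>auto intro!: summable_mult summable_geometric\<close>)
  define w where "w = (\<lambda>x. \<Sum>j. F j x)"
  have "integrable lborel w" unfolding w_def
  proof (rule integrable_suminf[OF Fint])
    show "AE x in lborel. summable (\<lambda>j. norm (F j x))" using Fsum Fnn by simp
    show "summable (\<lambda>j. LINT x|lborel. norm (F j x))"
      unfolding Fval by (intro summable_mult summable_geometric) auto
  qed
  moreover have wF: "F j x \<le> w x" for j x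
    unfolding w_def using sum_le_suminf[OF Fsum, of "{j}" x] Fnn by auto
  moreover have "w x \<ge> 0" for x using Fnn[of 0 x] wF[of 0 x] by linarith
  moreover have "1 \<le> w x" if "norm x \<le> 1" for x
  proof -
    have "1 \<le> (2::real) ^ ?p" by (rule one_le_power) simp
    also have "\<dots> = F 0 x" using that by (simp add: F_def)
    finally show ?thesis using wF[of 0 x] by linarith
  qed
  moreover have "1 / norm x ^ ?p \<le> w x" if x: "norm x \<ge> 1" for x
  proof -
    define j where "j = (LEAST j. norm x \<le> 2 ^ j)"
    have ex: "\<exists>j. norm x \<le> 2 ^ j" using real_arch_pow[of 2 "norm x"] by (auto intro: less_imp_le)
    then have j: "norm x \<le> 2 ^ j" unfolding j_def by (rule LeastI_ex)
    have "2 ^ j \<le> 2 * norm x"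
    proof (cases j)
      case (Suc i)
      then have "\<not> norm x \<le> 2 ^ i" unfolding j_def using not_less_Least by (metis lessI)
      with Suc show ?thesis by simp
    qed (use x in simp)
    moreover have "norm x > 0" using x by linarith
    ultimately have "1 / norm x \<le> 2 / 2 ^ j" by (simp add: field_simps)
    then have "(1 / norm x) ^ ?p \<le> (2 / 2 ^ j) ^ ?p" using x by (intro power_mono) auto
    also have "\<dots> = F j x" using j by (simp add: F_def power_divide)
    finally show ?thesis using wF[of j x] by (simp add: power_one_over)
  qed
  ultimately show ?thesis by blast
qed

section \<open>Homogeneous distributions\<close>

context homogeneous_fn
begin

lemma homogeneous_distr_scaleR:
  fixes u :: "(real^'k \<Rightarrow> complex) \<Rightarrow> complex"
  assumes u: "homogeneous_distr (- s) \<epsilon> u" and \<psi>: "\<psi> \<in> schwartz" and a: "a \<noteq> 0"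
  shows "u (\<lambda>x. \<psi> (a *\<^sub>R x)) = chr a * u \<psi>"
proof -
  have pos: "u (\<lambda>x. \<psi> (r *\<^sub>R x)) = of_real r powr (s - of_nat CARD('k)) * u \<psi>" if "r > 0" for r
  proof -
    have "u (\<lambda>x. \<psi> ((1 / (1 / r)) *\<^sub>R x)) = of_real (1 / r) powr (of_nat CARD('k) + - s) * u \<psi>"
      by (rule u[unfolded homogeneous_distr_def, THEN conjunct1, rule_format, OF \<psi>]) (use that in simp)
    also have "of_real (1 / r) powr (of_nat CARD('k) + - s) = (of_real r powr (s - of_nat CARD('k)) :: complex)"
      using that by (simp add: powr_def Ln_of_real ln_div algebra_simps flip: of_real_divide)
    finally show ?thesis by simp
  qed
  show ?thesis
  proof (cases "a < 0")
    case True
    have "(\<lambda>x. \<psi> (\<bar>a\<bar> *\<^sub>R x)) \<in> schwartz" using \<psi> a by (intro schwartz_scaleR) auto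
    then have "u (\<lambda>x. \<psi> (\<bar>a\<bar> *\<^sub>R (- x))) = \<epsilon> * u (\<lambda>x. \<psi> (\<bar>a\<bar> *\<^sub>R x))"
      by (rule u[unfolded homogeneous_distr_def, THEN conjunct2, rule_format])
    then show ?thesis using True pos[of "\<bar>a\<bar>"] by (simp add: chr_def)
  next
    case False
    then show ?thesis using pos[of a] a by (simp add: chr_def)
  qed
qed

end

context moment_cutoff
begin

text \<open>The combination of dilations applied to a test function: it leaves the value of homogeneous
  distributions unchanged and makes the test function vanish to order \<open>n\<close> at the origin.\<close>

definition tilde :: "(real^'k \<Rightarrow> complex) \<Rightarrow> real^'k \<Rightarrow> complex" where
  "tilde \<psi> x = (\<Sum>l<L. c l * \<psi> (a l *\<^sub>R x))"

lemma tilde_schwartz: "\<psi> \<in> schwartz \<Longrightarrow> tilde \<psi> \<in> schwartz"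
  unfolding tilde_def[abs_def] using a by (intro schwartz_sum schwartz_cmult schwartz_scaleR) auto

lemma norm_partials_tilde_le:
  assumes \<psi>: "smooth_on UNIV \<psi>" and len: "length is \<le> n"
    and B: "\<And>js x. length js = n \<Longrightarrow> norm (partials js \<psi> x) \<le> B"
  shows "norm (partials is (tilde \<psi>) x) \<le> (\<Sum>l<L. norm (c l) * \<bar>a l\<bar> ^ n) * real CARD('k) ^ (n - length is) * B * norm x ^ (n - length is)"
proof -
  let ?m = "n - length is"
  have eq: "partials is (tilde \<psi>) x = (\<Sum>l<L. (c l * of_real (a l) ^ length is) * partials is \<psi> (a l *\<^sub>R x))"
    unfolding tilde_def[abs_def]
    by (simp add: partials_sum[OF open_UNIV] partials_cmult[OF open_UNIV] partials_scaleR[OF \<psi>]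
          smooth_on_cmult smooth_on_scaleR \<psi> mult.assoc)
  have "norm (partials is (tilde \<psi>) x)
      \<le> (\<Sum>l<L. norm (c l * of_real (a l) ^ length is) * \<bar>a l\<bar> ^ ?m) * real CARD('k) ^ ?m * B * norm x ^ ?m"
    unfolding eq
  proof (rule norm_dilation_combination_le[OF smooth_on_partials[OF \<psi>]])
    show "(\<Sum>l<L. c l * of_real (a l) ^ length is * of_real (a l) ^ d) = 0" if "d < ?m" for d
      using moments[of "length is + d"] that len by (simp add: power_add mult.assoc)
    show "norm (partials js (partials is \<psi>) x) \<le> B" if "length js = ?m" for js x
      using B[of "js @ is" x] that len by (simp add: partials_append)
  qed
  also have "(\<Sum>l<L. norm (c l * of_real (a l) ^ length is) * \<bar>a l\<bar> ^ ?m) = (\<Sum>l<L. norm (c l) * \<bar>a l\<bar> ^ n)"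
    using len by (intro sum.cong refl) (simp add: norm_mult norm_power mult.assoc flip: power_add)
  finally show ?thesis .
qed

text \<open>Each of the at most \<open>M\<close> derivatives of \<open>\<eta>(2\<^sup>J x)\<close> costs a factor \<open>2\<^sup>J\<close>, while the other factor has all
  these derivatives \<open>O(\<bar>x\<bar>\<^sup>M\<^sup>+\<^sup>1)\<close> with \<open>\<bar>x\<bar> \<le> 2\<^sup>-\<^sup>J\<close> on the support. This is why \<open>n > 2M\<close> is required.\<close>

lemma tempered_near_0:
  assumes u: "\<And>\<phi>. \<phi> \<in> schwartz \<Longrightarrow> norm (u \<phi>) \<le> C * schwartz_seminorm M \<phi>" and M: "2 * M < n"
    and \<psi>: "\<psi> \<in> schwartz"
  shows "(\<lambda>J. u (\<lambda>x. \<eta> (2 ^ J *\<^sub>R x) * tilde \<psi> x)) \<longlonglongrightarrow> 0"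
proof -
  let ?p = "\<lambda>J x. \<eta> (2 ^ J *\<^sub>R x) * tilde \<psi> x"
  obtain A where A: "A \<ge> 0" "\<And>js x. length js \<le> M \<Longrightarrow> norm (partials js \<eta> x) \<le> A"
    using test_fns_partials_bound[OF \<eta>_test_fns] by metis
  obtain B where B: "B \<ge> 0" "\<And>js x. length js \<le> n \<Longrightarrow> (1 + norm x) ^ 0 * norm (partials js \<psi> x) \<le> B"
    using schwartz_bound[OF \<psi>, of n 0] by metis
  define K where "K = (\<Sum>l<L. norm (c l) * \<bar>a l\<bar> ^ n) * real CARD('k) ^ n * B"
  have K0: "K \<ge> 0" unfolding K_def using B(1) by (intro mult_nonneg_nonneg sum_nonneg) auto
  have K: "norm (partials js (tilde \<psi>) x) \<le> K * norm x ^ (n - length js)" if "length js \<le> n" for js x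
  proof -
    have "norm (partials js (tilde \<psi>) x) \<le> (\<Sum>l<L. norm (c l) * \<bar>a l\<bar> ^ n) * real CARD('k) ^ (n - length js) * B * norm x ^ (n - length js)"
      by (rule norm_partials_tilde_le[OF schwartz_smooth[OF \<psi>] that]) (use B(2) in auto)
    also have "\<dots> \<le> (\<Sum>l<L. norm (c l) * \<bar>a l\<bar> ^ n) * real CARD('k) ^ n * B * norm x ^ (n - length js)"
      using B(1) by (intro mult_right_mono mult_left_mono power_increasing sum_nonneg) (auto simp: Suc_leI)
    finally show ?thesis by (simp add: K_def)
  qed
  have smT: "smooth_on UNIV (tilde \<psi>)" by (rule schwartz_smooth[OF tilde_schwartz[OF \<psi>]])
  have inS: "(?p J) \<in> schwartz" for J
    by (intro schwartz_test_fns_mult test_fns_scaleR \<eta>_test_fns tilde_schwartz \<psi>) auto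
  have sem: "schwartz_seminorm M (?p J) \<le> 2 ^ M * 2 ^ M * (A * K) * (1 / 2) ^ J" for J
  proof (rule schwartz_seminorm_le)
    fix "is" :: "'k list" and x :: "real^'k" assume len: "length is \<le> M"
    show "(1 + norm x) ^ M * norm (partials is (?p J) x) \<le> 2 ^ M * 2 ^ M * (A * K) * (1 / 2) ^ J"
    proof (cases "norm x \<le> 1 / 2 ^ J")
      case False
      have "partials is (?p J) x = partials is (\<lambda>x. 0) x"
      proof (rule partials_cong[of "{x. norm x > 1 / 2 ^ J}"])
        show "open {x::real^'k. norm x > 1 / 2 ^ J}" by (intro open_Collect_less continuous_intros)
        fix y :: "real^'k" assume "y \<in> {x. norm x > 1 / 2 ^ J}"
        then have "1 \<le> norm (2 ^ J *\<^sub>R y)" by (simp add: field_simps)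
        then have "\<eta> (2 ^ J *\<^sub>R y) = 0" using cutoff_\<eta> unfolding cutoff_def by blast
        then show "\<eta> (2 ^ J *\<^sub>R y) * tilde \<psi> y = 0" by (simp only: mult_zero_left)
      qed (use False in simp)
      then show ?thesis using A(1) K0 by simp
    next
      case True
      have x1: "norm x \<le> 1" using True order_trans[of "norm x" "1 / 2 ^ J" 1] by simp
      have "norm (partials is (?p J) x) \<le> 2 ^ length is * (((2 ^ J) ^ M * A) * (K * (1 / 2 ^ J) ^ (M + 1)))"
      proof (rule norm_partials_mult_le)
        show "smooth_on UNIV (\<lambda>x. \<eta> (2 ^ J *\<^sub>R x))" by (intro smooth_on_scaleR test_fns_smooth[OF \<eta>_test_fns])
        show "smooth_on UNIV (tilde \<psi>)" by (rule smT)
        fix js :: "'k list" assume js: "length js \<le> length is"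
        have "norm (partials js (\<lambda>x. \<eta> (2 ^ J *\<^sub>R x)) x) = (2 ^ J) ^ length js * norm (partials js \<eta> (2 ^ J *\<^sub>R x))"
          by (simp add: partials_scaleR[OF test_fns_smooth[OF \<eta>_test_fns]] norm_mult norm_power)
        also have "\<dots> \<le> (2 ^ J) ^ M * A"
          using js len A by (intro mult_mono power_increasing) auto
        finally show "norm (partials js (\<lambda>x. \<eta> (2 ^ J *\<^sub>R x)) x) \<le> (2 ^ J) ^ M * A" .
        have "norm (partials js (tilde \<psi>) x) \<le> K * norm x ^ (n - length js)" using js len M by (intro K) auto
        also have "\<dots> \<le> K * norm x ^ (M + 1)"
          using js len M K0 x1 by (intro mult_left_mono power_decreasing) auto
        also have "\<dots> \<le> K * (1 / 2 ^ J) ^ (M + 1)"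
          using True K0 by (intro mult_left_mono power_mono) auto
        finally show "norm (partials js (tilde \<psi>) x) \<le> K * (1 / 2 ^ J) ^ (M + 1)" .
      qed
      also have "\<dots> = 2 ^ length is * (A * K * (1 / 2) ^ J)"
        by (simp add: power_divide)
      also have "\<dots> \<le> 2 ^ M * (A * K * (1 / 2) ^ J)"
        using len A(1) K0 by (intro mult_right_mono power_increasing) auto
      finally have "norm (partials is (?p J) x) \<le> 2 ^ M * (A * K * (1 / 2) ^ J)" .
      moreover have "(1 + norm x) ^ M \<le> 2 ^ M" using x1 by (intro power_mono) auto
      ultimately have "(1 + norm x) ^ M * norm (partials is (?p J) x) \<le> 2 ^ M * (2 ^ M * (A * K * (1 / 2) ^ J))"
        by (intro mult_mono) auto
      then show ?thesis by (simp add: mult.assoc)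
    qed
  qed
  from tempered_tendsto_0[OF u inS sem] show ?thesis .
qed

lemma far_cut_schwartz:
  assumes "\<psi> \<in> schwartz" shows "(\<lambda>x. (1 - \<omega> ((1 / 2 ^ J) *\<^sub>R x)) * \<psi> x) \<in> schwartz"
proof -
  have "(\<lambda>x. \<omega> ((1 / 2 ^ J) *\<^sub>R x) * \<psi> x) \<in> schwartz"
    using cutoff_\<omega> by (intro schwartz_test_fns_mult test_fns_scaleR assms) (auto simp: cutoff_def)
  from schwartz_add[OF assms schwartz_cmult[OF this, of "-1"]] show ?thesis by (simp add: left_diff_distrib)
qed

text \<open>One power of decay more than the seminorm asks for is available, and \<open>\<bar>x\<bar>\<close> is at least of order \<open>2\<^sup>J\<close> on the support.\<close>

lemma tempered_far:
  assumes u: "\<And>\<phi>. \<phi> \<in> schwartz \<Longrightarrow> norm (u \<phi>) \<le> C * schwartz_seminorm M \<phi>" and \<psi>: "\<psi> \<in> schwartz"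
  shows "(\<lambda>J. u (\<lambda>x. (1 - \<omega> ((1 / 2 ^ J) *\<^sub>R x)) * \<psi> x)) \<longlonglongrightarrow> 0"
proof -
  let ?p = "\<lambda>J x. (1 - \<omega> ((1 / 2 ^ J) *\<^sub>R x)) * \<psi> x"
  have \<omega>T: "\<omega> \<in> test_fns" using cutoff_\<omega> by (simp add: cutoff_def)
  obtain A where A: "A \<ge> 0" "\<And>js x. length js \<le> M \<Longrightarrow> norm (partials js \<omega> x) \<le> A"
    using test_fns_partials_bound[OF \<omega>T] by metis
  obtain B where B: "B \<ge> 0" "\<And>js x. length js \<le> M \<Longrightarrow> (1 + norm x) ^ (M + 1) * norm (partials js \<psi> x) \<le> B"
    using schwartz_bound[OF \<psi>, of M "M + 1"] by metis
  obtain d where d: "d > 0" "\<And>x. norm x < d \<Longrightarrow> \<omega> x = 1" using cutoff_\<omega> unfolding cutoff_def by blast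
  have inS: "(?p J) \<in> schwartz" for J by (rule far_cut_schwartz[OF \<psi>])
  let ?K = "2 ^ M * ((1 + A) * B) / d"
  have sem: "schwartz_seminorm M (?p J) \<le> ?K * (1 / 2) ^ J" for J
  proof (rule schwartz_seminorm_le)
    fix "is" :: "'k list" and x :: "real^'k" assume len: "length is \<le> M"
    show "(1 + norm x) ^ M * norm (partials is (?p J) x) \<le> ?K * (1 / 2) ^ J"
    proof (cases "norm x < d * 2 ^ J")
      case True
      have "partials is (?p J) x = partials is (\<lambda>x. 0) x"
      proof (rule partials_cong[of "{x. norm x < d * 2 ^ J}"])
        show "open {x::real^'k. norm x < d * 2 ^ J}" by (intro open_Collect_less continuous_intros)
        fix y :: "real^'k" assume "y \<in> {x. norm x < d * 2 ^ J}"
        then have "norm ((1 / 2 ^ J) *\<^sub>R y) < d" by (simp add: field_simps)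
        then show "(1 - \<omega> ((1 / 2 ^ J) *\<^sub>R y)) * \<psi> y = 0" by (simp only: d(2)) simp
      qed (use True in simp)
      then show ?thesis using A(1) B(1) d(1) by simp
    next
      case False
      define P where "P = 1 + norm x"
      have P: "P > 0" "P \<ge> d * 2 ^ J" using False by (auto simp: P_def add_pos_nonneg)
      have "norm (partials is (?p J) x) \<le> 2 ^ length is * ((1 + A) * (B / P ^ (M + 1)))"
      proof (rule norm_partials_mult_le)
        have sm: "smooth_on UNIV (\<lambda>x. \<omega> ((1 / 2 ^ J) *\<^sub>R x))" by (intro smooth_on_scaleR test_fns_smooth[OF \<omega>T])
        then show "smooth_on UNIV (\<lambda>x. 1 - \<omega> ((1 / 2 ^ J) *\<^sub>R x))" by (intro smooth_on_diff) auto
        show "smooth_on UNIV \<psi>" by (rule schwartz_smooth[OF \<psi>])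
        fix js :: "'k list" assume js: "length js \<le> length is"
        have "norm (partials js (\<lambda>x. 1 - \<omega> ((1 / 2 ^ J) *\<^sub>R x)) x)
           \<le> norm (partials js (\<lambda>x::real^'k. 1) x) + norm (partials js (\<lambda>x. \<omega> ((1 / 2 ^ J) *\<^sub>R x)) x)"
          unfolding partials_diff[OF open_UNIV smooth_on_const sm UNIV_I] by (rule norm_triangle_ineq4)
        also have "\<dots> \<le> 1 + A"
        proof (rule add_mono)
          show "norm (partials js (\<lambda>x::real^'k. 1) x) \<le> 1" by (simp add: partials_const)
          have "norm (partials js (\<lambda>x. \<omega> ((1 / 2 ^ J) *\<^sub>R x)) x) = (1 / 2 ^ J) ^ length js * norm (partials js \<omega> ((1 / 2 ^ J) *\<^sub>R x))"
            by (simp add: partials_scaleR[OF test_fns_smooth[OF \<omega>T]] norm_mult norm_power norm_divide)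
          also have "\<dots> \<le> 1 * A" using js len A by (intro mult_mono power_le_one) auto
          finally show "norm (partials js (\<lambda>x. \<omega> ((1 / 2 ^ J) *\<^sub>R x)) x) \<le> A" by simp
        qed
        finally show "norm (partials js (\<lambda>x. 1 - \<omega> ((1 / 2 ^ J) *\<^sub>R x)) x) \<le> 1 + A" .
        have "P ^ (M + 1) * norm (partials js \<psi> x) \<le> B" using B(2)[of js x] js len by (simp add: P_def)
        then show "norm (partials js \<psi> x) \<le> B / P ^ (M + 1)"
          using P(1) by (simp add: pos_le_divide_eq mult.commute)
      qed
      also have "\<dots> \<le> 2 ^ M * ((1 + A) * (B / P ^ (M + 1)))"
        using len A(1) B(1) P(1) by (intro mult_right_mono power_increasing) auto
      finally have "P ^ M * norm (partials is (?p J) x) \<le> P ^ M * (2 ^ M * ((1 + A) * (B / P ^ (M + 1))))"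
        using P(1) by (intro mult_left_mono) auto
      also have "\<dots> = 2 ^ M * ((1 + A) * B) / P" using P(1) by simp
      also have "\<dots> \<le> 2 ^ M * ((1 + A) * B) / (d * 2 ^ J)"
        using P d(1) A(1) B(1) by (intro divide_left_mono) auto
      finally show ?thesis by (simp add: P_def power_divide)
    qed
  qed
  from tempered_tendsto_0[OF u inS sem] show ?thesis .
qed

text \<open>Homogeneity moves the dilations from the cutoff to the test function.\<close>

lemma homogeneous_distr_near_0:
  assumes temp: "tempered u" and hd: "homogeneous_distr (- s) \<epsilon> u" and \<psi>: "\<psi> \<in> schwartz"
  shows "u (\<lambda>x. \<omega> (2 ^ J *\<^sub>R x) * \<psi> x) = u (\<lambda>x. \<eta> (2 ^ J *\<^sub>R x) * tilde \<psi> x)"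
proof -
  define \<Psi> where "\<Psi> = (\<lambda>l x. \<eta> ((2 ^ J / a l) *\<^sub>R x) * \<psi> x)"
  have \<Psi>: "\<Psi> l \<in> schwartz" if "l < L" for l
    unfolding \<Psi>_def using a[OF that] by (intro schwartz_test_fns_mult test_fns_scaleR \<eta>_test_fns \<psi>) auto
  have "u (\<lambda>x. \<omega> (2 ^ J *\<^sub>R x) * \<psi> x) = u (\<lambda>x. \<Sum>l<L. (c l * chr (a l)) * \<Psi> l x)"
    by (simp add: \<omega>_def \<Psi>_def sum_distrib_right mult.assoc)
  also have "\<dots> = (\<Sum>l<L. (c l * chr (a l)) * u (\<Psi> l))"
    using \<Psi> by (intro tempered_sum[OF temp]) auto
  also have "\<dots> = (\<Sum>l<L. c l * u (\<lambda>x. \<Psi> l (a l *\<^sub>R x)))"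
    using a \<Psi> by (intro sum.cong refl) (simp add: homogeneous_distr_scaleR[OF hd])
  also have "\<dots> = u (\<lambda>x. \<Sum>l<L. c l * \<Psi> l (a l *\<^sub>R x))"
    using a \<Psi> by (intro tempered_sum[OF temp, symmetric] schwartz_scaleR) auto
  also have "(\<lambda>x. \<Sum>l<L. c l * \<Psi> l (a l *\<^sub>R x)) = (\<lambda>x. \<eta> (2 ^ J *\<^sub>R x) * tilde \<psi> x)"
    unfolding tilde_def sum_distrib_left
    by (intro ext sum.cong refl) (use a in \<open>simp add: \<Psi>_def\<close>)
  finally show ?thesis .
qed

text \<open>Uniqueness of the homogeneous extension in explicit form: split \<open>\<psi>\<close> into a part far from the origin, a part on an
  annulus, where the distribution is given by \<open>f\<close>, and a part near the origin. The two outer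
  parts are negligible, the last one because of the choice of \<open>\<omega>\<close>.\<close>

lemma homogeneous_distr_limit:
  assumes temp: "tempered u" and hd: "homogeneous_distr (- s) \<epsilon> u" and rep: "represented_off_0 u f"
    and u: "\<And>\<phi>. \<phi> \<in> schwartz \<Longrightarrow> norm (u \<phi>) \<le> C * schwartz_seminorm M \<phi>" and M: "2 * M < n"
    and \<psi>: "\<psi> \<in> schwartz"
  shows "(\<lambda>J. LINT x|lborel. ((\<Sum>i<J. shell f \<omega> i x) + (\<Sum>j<J. inner_shell f \<omega> j x)) * \<psi> x) \<longlonglongrightarrow> u \<psi>"
proof -
  have \<omega>T: "\<omega> \<in> test_fns" "\<exists>d>0. \<forall>x. norm x < d \<longrightarrow> \<omega> x = 1" using cutoff_\<omega> by (auto simp: cutoff_def)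
  have eq: "(LINT x|lborel. ((\<Sum>i<J. shell f \<omega> i x) + (\<Sum>j<J. inner_shell f \<omega> j x)) * \<psi> x)
     = u \<psi> - u (\<lambda>x. (1 - \<omega> ((1 / 2 ^ J) *\<^sub>R x)) * \<psi> x) - u (\<lambda>x. \<eta> (2 ^ J *\<^sub>R x) * tilde \<psi> x)" for J
  proof -
    let ?far = "\<lambda>x. (1 - \<omega> ((1 / 2 ^ J) *\<^sub>R x)) * \<psi> x"
    let ?mid = "\<lambda>x. \<psi> x * (\<omega> ((1 / 2 ^ J) *\<^sub>R x) - \<omega> (2 ^ J *\<^sub>R x))"
    let ?near = "\<lambda>x. \<omega> (2 ^ J *\<^sub>R x) * \<psi> x"
    have mid: "?mid \<in> test_off_0"
      by (rule test_off_0_mult[OF smooth_on_subset[OF schwartz_smooth[OF \<psi>]] annulus_test_off_0[OF \<omega>T]]) auto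
    have midS: "?mid \<in> schwartz" using mid test_fns_schwartz test_off_0_iff by blast
    have nearS: "?near \<in> schwartz" by (intro schwartz_test_fns_mult test_fns_scaleR \<omega>T(1) \<psi>) auto
    have "u (\<lambda>x. ?far x + (?mid x + ?near x)) = u ?far + (u ?mid + u ?near)"
      by (simp only: tempered_add[OF temp far_cut_schwartz[OF \<psi>] schwartz_add[OF midS nearS]] tempered_add[OF temp midS nearS])
    moreover have "(\<lambda>x. ?far x + (?mid x + ?near x)) = \<psi>" by (simp add: fun_eq_iff algebra_simps)
    moreover have "u ?mid = (LINT x|lborel. f x * ?mid x)"
      using rep mid by (simp add: represented_off_0_def)
    moreover have "(\<lambda>x. f x * ?mid x) = (\<lambda>x. ((\<Sum>i<J. shell f \<omega> i x) + (\<Sum>j<J. inner_shell f \<omega> j x)) * \<psi> x)"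
      unfolding sum_shell sum_inner_shell by (rule ext) (simp add: algebra_simps)
    ultimately have "u \<psi> = u ?far + ((LINT x|lborel. ((\<Sum>i<J. shell f \<omega> i x) + (\<Sum>j<J. inner_shell f \<omega> j x)) * \<psi> x) + u ?near)"
      by (simp only:)
    then show ?thesis unfolding homogeneous_distr_near_0[OF temp hd \<psi>, of J] by simp
  qed
  have "(\<lambda>J. u \<psi> - u (\<lambda>x. (1 - \<omega> ((1 / 2 ^ J) *\<^sub>R x)) * \<psi> x) - u (\<lambda>x. \<eta> (2 ^ J *\<^sub>R x) * tilde \<psi> x)) \<longlonglongrightarrow> u \<psi> - 0 - 0"
    by (intro tendsto_diff tendsto_const tempered_far[OF u \<psi>] tempered_near_0[OF u M \<psi>])
  then show ?thesis unfolding eq by simp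
qed

text \<open>The sum of the Fourier transforms of all dyadic pieces; the first series converges off the origin, the second
  one everywhere.\<close>

definition fhat :: "real^'k \<Rightarrow> complex" where
  "fhat y = (\<Sum>i. fourier (shell f \<omega> i) y) + (\<Sum>j. fourier (inner_shell f \<omega> j) y)"

text \<open>For a single piece the Fourier transform moves to the other factor by Fubini. On the support of \<open>\<phi>\<close>, which stays
  away from the origin and from infinity, both series converge uniformly.\<close>

lemma fourier_distr_eq_fhat:
  assumes temp: "tempered u" and hd: "homogeneous_distr (- s) \<epsilon> u" and rep: "represented_off_0 u f"
    and u: "\<And>\<phi>. \<phi> \<in> schwartz \<Longrightarrow> norm (u \<phi>) \<le> C * schwartz_seminorm M \<phi>" and M: "2 * M < n"
    and n: "Re s < real n + real CARD('k)"
  shows "represented_off_0 (fourier_distr u) fhat"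
  unfolding represented_off_0_def fourier_distr_def
proof
  fix \<phi> :: "real^'k \<Rightarrow> complex" assume "\<phi> \<in> test_off_0"
  then obtain d where \<phi>: "\<phi> \<in> test_fns" and d: "d > 0" "\<And>x. norm x < d \<Longrightarrow> \<phi> x = 0" unfolding test_off_0_iff by blast
  obtain R where R: "R > 0" "\<And>x. R < norm x \<Longrightarrow> \<phi> x = 0" using test_fns_support[OF \<phi>] by blast
  define hs where "hs = (\<lambda>J y. (\<Sum>i<J. fourier (shell f \<omega> i) y) + (\<Sum>j<J. fourier (inner_shell f \<omega> j) y))"
  obtain B1 where B1: "summable B1" "\<And>i z. d \<le> norm z \<Longrightarrow> norm (fourier (shell f \<omega> i) z) \<le> B1 i"
    using smooth_on_fourier_series(2)[OF cutoff_\<omega> d(1), of "[]"] by auto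
  obtain B2 where B2: "summable B2" "\<And>j z. norm z \<le> R \<Longrightarrow> norm (fourier (inner_shell f \<omega> j) z) \<le> B2 j"
    using smooth_on_inner_fourier_series(2)[OF cutoff_\<omega> n fourier_shell_vanishing, of R "[]"] by auto
  have int: "(LINT x|lborel. ((\<Sum>i<J. shell f \<omega> i x) + (\<Sum>j<J. inner_shell f \<omega> j x)) * fourier \<phi> x) = (LINT y|lborel. hs J y * \<phi> y)" for J
  proof -
    have i1: "integrable lborel (\<lambda>x. q x * fourier \<phi> x)" if "q \<in> test_fns" for q
      by (rule test_fns_integrable[OF that continuous_on_fourier[OF \<phi>]])
    have i2: "integrable lborel (\<lambda>y. fourier q y * \<phi> y)" if "q \<in> test_fns" for q
      using test_fns_integrable[OF \<phi> continuous_on_fourier[OF that]] by (simp add: mult.commute)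
    have "(LINT x|lborel. ((\<Sum>i<J. shell f \<omega> i x) + (\<Sum>j<J. inner_shell f \<omega> j x)) * fourier \<phi> x)
      = (\<Sum>i<J. LINT x|lborel. shell f \<omega> i x * fourier \<phi> x) + (\<Sum>j<J. LINT x|lborel. inner_shell f \<omega> j x * fourier \<phi> x)"
      unfolding distrib_right sum_distrib_right
      using i1[OF shell_test_fns[OF cutoff_\<omega>]] i1[OF inner_shell_test_fns[OF cutoff_\<omega>]]
      by (subst Bochner_Integration.integral_add) (auto simp: Bochner_Integration.integral_sum)
    also have "\<dots> = (\<Sum>i<J. LINT y|lborel. fourier (shell f \<omega> i) y * \<phi> y) + (\<Sum>j<J. LINT y|lborel. fourier (inner_shell f \<omega> j) y * \<phi> y)"
      by (simp add: fourier_swap[OF shell_test_fns[OF cutoff_\<omega>] \<phi>] fourier_swap[OF inner_shell_test_fns[OF cutoff_\<omega>] \<phi>])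
    also have "\<dots> = (LINT y|lborel. hs J y * \<phi> y)"
      unfolding hs_def distrib_right sum_distrib_right
      using i2[OF shell_test_fns[OF cutoff_\<omega>]] i2[OF inner_shell_test_fns[OF cutoff_\<omega>]]
      by (subst Bochner_Integration.integral_add) (auto simp: Bochner_Integration.integral_sum)
    finally show ?thesis .
  qed
  have hs_lim: "(\<lambda>J. hs J y) \<longlonglongrightarrow> fhat y" if y: "d \<le> norm y" "norm y \<le> R" for y
    unfolding hs_def fhat_def
  proof (intro tendsto_add summable_LIMSEQ)
    show "summable (\<lambda>i. fourier (shell f \<omega> i) y)"
      by (rule summable_comparison_test'[OF B1(1), of 0]) (use B1(2)[OF y(1)] in auto)
    show "summable (\<lambda>j. fourier (inner_shell f \<omega> j) y)"
      by (rule summable_comparison_test'[OF B2(1), of 0]) (use B2(2)[OF y(2)] in auto)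
  qed
  have meas: "hs J \<in> borel_measurable borel" for J
    unfolding hs_def[abs_def]
    by (intro borel_measurable_add borel_measurable_sum borel_measurable_continuous_onI continuous_on_fourier
        shell_test_fns inner_shell_test_fns cutoff_\<omega>)
  have \<phi>m: "\<phi> \<in> borel_measurable borel" by (rule test_fns_borel[OF \<phi>])
  have lim: "(\<lambda>J. hs J y * \<phi> y) \<longlonglongrightarrow> fhat y * \<phi> y" for y
  proof (cases "d \<le> norm y \<and> norm y \<le> R")
    case True
    then show ?thesis by (intro tendsto_mult tendsto_const hs_lim) auto
  next
    case False
    then have "\<phi> y = 0" using d(2) R(2) by force
    then show ?thesis by simp
  qed
  have "(\<lambda>J. LINT y|lborel. hs J y * \<phi> y) \<longlonglongrightarrow> (LINT y|lborel. fhat y * \<phi> y)"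
  proof (rule integral_dominated_convergence[where w = "\<lambda>y. (suminf B1 + suminf B2) * norm (\<phi> y)"])
    show m: "(\<lambda>y. hs J y * \<phi> y) \<in> borel_measurable lborel" for J using meas \<phi>m by simp
    show "(\<lambda>y. fhat y * \<phi> y) \<in> borel_measurable lborel"
      by (rule borel_measurable_LIMSEQ_metric[OF m lim])
    have "integrable lborel \<phi>" using test_fns_integrable[OF \<phi> continuous_on_const[of _ 1]] by simp
    then show "integrable lborel (\<lambda>y. (suminf B1 + suminf B2) * norm (\<phi> y))"
      by (intro integrable_mult_right integrable_norm)
    show "AE y in lborel. (\<lambda>J. hs J y * \<phi> y) \<longlonglongrightarrow> fhat y * \<phi> y" using lim by simp
    show "AE y in lborel. norm (hs J y * \<phi> y) \<le> (suminf B1 + suminf B2) * norm (\<phi> y)" for J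
    proof (intro AE_I2)
      fix y
      show "norm (hs J y * \<phi> y) \<le> (suminf B1 + suminf B2) * norm (\<phi> y)"
      proof (cases "d \<le> norm y \<and> norm y \<le> R")
        case True
        have "norm (\<Sum>i<J. fourier (shell f \<omega> i) y) \<le> (\<Sum>i<J. B1 i)"
          using B1(2) True by (intro sum_norm_le) auto
        also have "\<dots> \<le> suminf B1"
          using order_trans[OF norm_ge_zero B1(2)[of y]] True by (intro sum_le_suminf B1(1)) auto
        finally have b1: "norm (\<Sum>i<J. fourier (shell f \<omega> i) y) \<le> suminf B1" .
        have "norm (\<Sum>j<J. fourier (inner_shell f \<omega> j) y) \<le> (\<Sum>j<J. B2 j)"
          using B2(2) True by (intro sum_norm_le) auto
        also have "\<dots> \<le> suminf B2"
          using order_trans[OF norm_ge_zero B2(2)[of y]] True by (intro sum_le_suminf B2(1)) auto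
        finally have b2: "norm (\<Sum>j<J. fourier (inner_shell f \<omega> j) y) \<le> suminf B2" .
        have "norm (hs J y) \<le> suminf B1 + suminf B2"
          unfolding hs_def by (rule norm_triangle_mono[OF b1 b2])
        then show ?thesis unfolding norm_mult by (intro mult_right_mono) auto
      next
        case False
        then have "\<phi> y = 0" using d(2) R(2) by force
        then show ?thesis by simp
      qed
    qed
  qed
  moreover have "(\<lambda>J. LINT y|lborel. hs J y * \<phi> y) \<longlonglongrightarrow> u (fourier \<phi>)"
    using homogeneous_distr_limit[OF temp hd rep u M fourier_schwartz[OF \<phi>]] unfolding int .
  ultimately show "u (fourier \<phi>) = (LINT y|lborel. fhat y * \<phi> y)" using LIMSEQ_unique by blast
qed

lemma smooth_on_fhat:
  assumes n: "Re s < real n + real CARD('k)"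
  shows "smooth_on (- {0}) fhat"
  unfolding fhat_def[abs_def]
  by (intro smooth_on_add smooth_on_fourier_series(1)[OF cutoff_\<omega>]
      smooth_on_subset[OF smooth_on_inner_fourier_series(1)[OF cutoff_\<omega> n fourier_shell_vanishing]]) auto

lemma f_bound:
  obtains F where "F \<ge> 0" "\<And>x. x \<noteq> 0 \<Longrightarrow> norm (f x) \<le> F * norm x powr (- Re s)"
proof -
  have "compact (f ` sphere 0 1)"
    by (intro compact_continuous_image compact_sphere continuous_on_subset[OF smooth_on_imp_continuous_on[OF smooth]]) auto
  then have "bounded (f ` sphere 0 1)" by (rule compact_imp_bounded)
  then obtain F where F': "F > 0" "\<forall>y\<in>f ` sphere 0 1. norm y \<le> F" unfolding bounded_pos by blast
  then have F: "F > 0" "norm (f x) \<le> F" if "x \<in> sphere 0 1" for x using that by auto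
  have "norm (f x) \<le> F * norm x powr (- Re s)" if x: "x \<noteq> 0" for x
  proof -
    have "f x = of_real (norm x) powr (- s) * f ((1 / norm x) *\<^sub>R x)"
      using f_scaleR[of "(1 / norm x) *\<^sub>R x" "norm x"] x by simp
    then have "norm (f x) = norm x powr (- Re s) * norm (f ((1 / norm x) *\<^sub>R x))"
      using x by (simp add: norm_mult norm_powr_real_powr)
    also have "\<dots> \<le> norm x powr (- Re s) * F" using x by (intro mult_left_mono F(2)) auto
    finally show ?thesis by (simp add: mult.commute)
  qed
  with F'(1) show ?thesis by (intro that[of F]) auto
qed

text \<open>Near the origin \<open>tilde \<phi>\<close> compensates the singularity of \<open>f\<close>, and at infinity \<open>\<phi>\<close> decays rapidly, so \<open>\<phi> \<mapsto> \<integral>f (tilde \<phi>)\<close> is defined and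
  continuous. It is homogeneous by substitution, since dilations commute with \<^const>\<open>tilde\<close>. Off the origin the combination of
  dilations can be moved to \<open>f\<close>, on which it acts as the identity.\<close>

lemma exists_homogeneous_extension:
  assumes n: "Re s \<le> real n" "n > 0"
  shows "\<exists>u. tempered u \<and> homogeneous_distr (- s) \<epsilon> u \<and> represented_off_0 u f"
proof -
  define u where "u = (\<lambda>\<phi>. LINT x|lborel. f x * tilde \<phi> x)"
  obtain F where F: "F \<ge> 0" "\<And>x. x \<noteq> 0 \<Longrightarrow> norm (f x) \<le> F * norm x powr (- Re s)" using f_bound by blast
  obtain w :: "real^'k \<Rightarrow> real" where w: "integrable lborel w" "\<And>x. w x \<ge> 0" "\<And>x. norm x \<le> 1 \<Longrightarrow> 1 \<le> w x"
    "\<And>x. norm x \<ge> 1 \<Longrightarrow> 1 / norm x ^ (CARD('k) + 1) \<le> w x" using exists_integrable_weight by blast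
  obtain Q where Q: "real Q \<ge> real CARD('k) + 1 - Re s" using real_arch_simple by blast
  \<comment> \<open>\<open>n\<close> derivatives control the behaviour at the origin, \<open>Q\<close> powers of decay the behaviour at infinity.\<close>
  define P where "P = max n Q"
  define K1 where "K1 = (\<Sum>l<L. norm (c l) * \<bar>a l\<bar> ^ n) * real CARD('k) ^ n"
  define K2 where "K2 = (\<Sum>l<L. norm (c l) / \<bar>a l\<bar> ^ Q)"
  have K: "K1 \<ge> 0" "K2 \<ge> 0" unfolding K1_def K2_def by (intro mult_nonneg_nonneg sum_nonneg; simp)+
  have sem0: "schwartz_seminorm P \<phi> \<ge> 0" if "\<phi> \<in> schwartz" for \<phi> :: "real^'k \<Rightarrow> complex"
    by (rule order_trans[OF _ schwartz_seminorm_upper[OF that, of "[]" _ 0]]) auto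
  have near: "norm (tilde \<phi> x) \<le> K1 * schwartz_seminorm P \<phi> * norm x ^ n" if \<phi>: "\<phi> \<in> schwartz" for \<phi> x
  proof -
    have "norm (partials [] (tilde \<phi>) x) \<le> (\<Sum>l<L. norm (c l) * \<bar>a l\<bar> ^ n) * real CARD('k) ^ (n - length ([]::'k list))
       * schwartz_seminorm P \<phi> * norm x ^ (n - length ([]::'k list))"
    proof (rule norm_partials_tilde_le[OF schwartz_smooth[OF \<phi>]])
      fix js :: "'k list" and x :: "real^'k" assume "length js = n"
      then have "(1 + norm x) ^ P * norm (partials js \<phi> x) \<le> schwartz_seminorm P \<phi>"
        by (intro schwartz_seminorm_upper \<phi>) (simp add: P_def)
      moreover have "1 * norm (partials js \<phi> x) \<le> (1 + norm x) ^ P * norm (partials js \<phi> x)"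
        by (intro mult_right_mono one_le_power) auto
      ultimately show "norm (partials js \<phi> x) \<le> schwartz_seminorm P \<phi>" by linarith
    qed simp
    then show ?thesis by (simp add: K1_def)
  qed
  have far: "norm (tilde \<phi> x) \<le> K2 * schwartz_seminorm P \<phi> / norm x ^ Q" if \<phi>: "\<phi> \<in> schwartz" and x: "norm x \<ge> 1" for \<phi> x
  proof -
    have xp: "norm x > 0" using x by linarith
    have "norm (tilde \<phi> x) \<le> (\<Sum>l<L. norm (c l) / \<bar>a l\<bar> ^ Q * (schwartz_seminorm P \<phi> / norm x ^ Q))"
      unfolding tilde_def
    proof (rule sum_norm_le)
      fix l assume "l \<in> {..<L}"
      then have al: "\<bar>a l\<bar> > 0" using a by auto
      have "(\<bar>a l\<bar> * norm x) ^ Q \<le> (1 + norm (a l *\<^sub>R x)) ^ Q" by (intro power_mono) auto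
      also have "\<dots> \<le> (1 + norm (a l *\<^sub>R x)) ^ P" by (intro power_increasing) (auto simp: P_def)
      finally have "(\<bar>a l\<bar> * norm x) ^ Q * norm (\<phi> (a l *\<^sub>R x)) \<le> (1 + norm (a l *\<^sub>R x)) ^ P * norm (\<phi> (a l *\<^sub>R x))"
        by (intro mult_right_mono) auto
      also have "\<dots> \<le> schwartz_seminorm P \<phi>" using schwartz_seminorm_upper[OF \<phi>, of "[]" P "a l *\<^sub>R x"] by simp
      finally have "norm (\<phi> (a l *\<^sub>R x)) \<le> schwartz_seminorm P \<phi> / (\<bar>a l\<bar> ^ Q * norm x ^ Q)"
        using al xp by (simp add: pos_le_divide_eq power_mult_distrib mult.commute)
      then have "norm (c l) * norm (\<phi> (a l *\<^sub>R x)) \<le> norm (c l) * (schwartz_seminorm P \<phi> / (\<bar>a l\<bar> ^ Q * norm x ^ Q))"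
        by (intro mult_left_mono) auto
      then show "norm (c l * \<phi> (a l *\<^sub>R x)) \<le> norm (c l) / \<bar>a l\<bar> ^ Q * (schwartz_seminorm P \<phi> / norm x ^ Q)"
        by (simp add: norm_mult)
    qed
    also have "\<dots> = K2 * schwartz_seminorm P \<phi> / norm x ^ Q" by (simp add: K2_def sum_distrib_right sum_divide_distrib)
    finally show ?thesis .
  qed
  define KC where "KC = F * (K1 + K2)"
  have bd: "norm (f x * tilde \<phi> x) \<le> KC * schwartz_seminorm P \<phi> * w x" if \<phi>: "\<phi> \<in> schwartz" for \<phi> x
  proof (cases "norm x \<le> 1")
    case True
    show ?thesis
    proof (cases "x = 0")
      case True
      then have "tilde \<phi> x = 0" using near[OF \<phi>, of 0] n by (simp add: power_0_left)
      then show ?thesis using F(1) K sem0[OF \<phi>] w(2)[of x] by (simp add: KC_def)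
    next
      case x: False
      have "norm (f x * tilde \<phi> x) \<le> (F * norm x powr (- Re s)) * (K1 * schwartz_seminorm P \<phi> * norm x ^ n)"
        unfolding norm_mult using F x near[OF \<phi>, of x] by (intro mult_mono) auto
      also have "\<dots> = F * K1 * schwartz_seminorm P \<phi> * norm x powr (real n - Re s)"
        using x by (simp add: powr_diff powr_minus powr_realpow field_simps)
      also have "\<dots> \<le> F * K1 * schwartz_seminorm P \<phi> * 1"
        using True n F(1) K sem0[OF \<phi>] x by (intro mult_left_mono powr_le1) auto
      also have "\<dots> \<le> KC * schwartz_seminorm P \<phi> * w x"
        unfolding KC_def using w(3)[OF True] F(1) K sem0[OF \<phi>] by (intro mult_mono) (auto simp: algebra_simps)
      finally show ?thesis .
    qed
  next
    case False
    then have x: "norm x \<ge> 1" "x \<noteq> 0" by auto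
    have "norm (f x * tilde \<phi> x) \<le> (F * norm x powr (- Re s)) * (K2 * schwartz_seminorm P \<phi> / norm x ^ Q)"
      unfolding norm_mult using F x far[OF \<phi> x(1)] by (intro mult_mono) auto
    also have "\<dots> = F * K2 * schwartz_seminorm P \<phi> * norm x powr (- (Re s + real Q))"
      using x by (simp add: powr_add powr_diff powr_minus powr_realpow field_simps)
    also have "\<dots> \<le> F * K2 * schwartz_seminorm P \<phi> * norm x powr (- real (CARD('k) + 1))"
      using Q x F(1) K sem0[OF \<phi>] by (intro mult_left_mono powr_mono) auto
    also have "norm x powr (- real (CARD('k) + 1)) = 1 / norm x ^ (CARD('k) + 1)"
      by (subst powr_minus, subst powr_realpow) (use x in \<open>auto simp: divide_inverse\<close>)
    also have "F * K2 * schwartz_seminorm P \<phi> * (1 / norm x ^ (CARD('k) + 1)) \<le> KC * schwartz_seminorm P \<phi> * w x"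
      unfolding KC_def using w(4)[OF x(1)] w(2)[of x] F(1) K sem0[OF \<phi>] by (intro mult_mono) (auto simp: algebra_simps)
    finally show ?thesis .
  qed
  have tilde0: "tilde \<phi> 0 = 0" if "\<phi> \<in> schwartz" for \<phi> using near[OF that, of 0] n by (simp add: power_0_left)
  have meas: "(\<lambda>x. f x * tilde \<phi> x) \<in> borel_measurable borel" if \<phi>: "\<phi> \<in> schwartz" for \<phi>
  proof -
    have "(\<lambda>x. indicator (- {0}) x *\<^sub>R (f x * tilde \<phi> x)) \<in> borel_measurable borel"
      by (intro borel_measurable_continuous_on_indicator continuous_on_mult smooth_on_imp_continuous_on[OF smooth]
          continuous_on_subset[OF smooth_on_imp_continuous_on[OF schwartz_smooth[OF tilde_schwartz[OF \<phi>]]]]) auto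
    also have "(\<lambda>x. indicator (- {0}) x *\<^sub>R (f x * tilde \<phi> x)) = (\<lambda>x. f x * tilde \<phi> x)"
      using tilde0[OF \<phi>] by (auto simp: indicator_def fun_eq_iff)
    finally show ?thesis .
  qed
  have int: "integrable lborel (\<lambda>x. f x * tilde \<phi> x)" if \<phi>: "\<phi> \<in> schwartz" for \<phi>
    by (rule Bochner_Integration.integrable_bound[of _ "\<lambda>x. KC * schwartz_seminorm P \<phi> * w x"])
      (use w(1) meas[OF \<phi>] bd[OF \<phi>] in \<open>auto intro!: AE_I2 order_trans[OF bd[OF \<phi>]]\<close>)
  have scale: "u (\<lambda>x. \<phi> ((1 / t) *\<^sub>R x)) = of_real \<bar>t\<bar> ^ CARD('k) * (LINT x|lborel. f (t *\<^sub>R x) * tilde \<phi> x)"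
    if \<phi>: "\<phi> \<in> schwartz" and t: "t \<noteq> 0" for \<phi> t
  proof -
    have eq: "tilde (\<lambda>x. \<phi> ((1 / t) *\<^sub>R x)) x = tilde \<phi> ((1 / t) *\<^sub>R x)" for x
      by (simp add: tilde_def mult.commute)
    have "(\<lambda>x. \<phi> ((1 / t) *\<^sub>R x)) \<in> schwartz" using t by (intro schwartz_scaleR \<phi>) auto
    from meas[OF this] have "(\<lambda>x. f x * tilde \<phi> ((1 / t) *\<^sub>R x)) \<in> borel_measurable borel" unfolding eq .
    from integral_scaleR[OF t this] show ?thesis unfolding u_def eq using t by simp
  qed
  have "tempered u"
    unfolding tempered_def
  proof (intro conjI ballI allI exI)
    fix \<phi> \<theta> :: "real^'k \<Rightarrow> complex" and p q :: complex assume S: "\<phi> \<in> schwartz" "\<theta> \<in> schwartz"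
    have "tilde (\<lambda>x. p * \<phi> x + q * \<theta> x) x = p * tilde \<phi> x + q * tilde \<theta> x" for x
      by (simp add: tilde_def sum.distrib sum_distrib_left algebra_simps)
    then have "u (\<lambda>x. p * \<phi> x + q * \<theta> x) = (LINT x|lborel. p * (f x * tilde \<phi> x) + q * (f x * tilde \<theta> x))"
      unfolding u_def by (simp add: algebra_simps)
    also have "\<dots> = p * u \<phi> + q * u \<theta>"
      unfolding u_def using int[OF S(1)] int[OF S(2)] by (subst Bochner_Integration.integral_add) auto
    finally show "u (\<lambda>x. p * \<phi> x + q * \<theta> x) = p * u \<phi> + q * u \<theta>" .
  next
    fix \<phi> :: "real^'k \<Rightarrow> complex" assume \<phi>: "\<phi> \<in> schwartz"
    have "norm (u \<phi>) \<le> (LINT x|lborel. KC * schwartz_seminorm P \<phi> * w x)"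
      unfolding u_def by (rule Bochner_Integration.integral_norm_bound_integral)
        (use int[OF \<phi>] w(1) bd[OF \<phi>] in auto)
    also have "\<dots> = (KC * (LINT x|lborel. w x)) * schwartz_seminorm P \<phi>" by simp
    finally show "norm (u \<phi>) \<le> (KC * (LINT x|lborel. w x)) * schwartz_seminorm P \<phi>" .
  qed
  moreover have "homogeneous_distr (- s) \<epsilon> u"
    unfolding homogeneous_distr_def
  proof (intro conjI ballI allI impI)
    fix \<phi> :: "real^'k \<Rightarrow> complex" and t :: real assume \<phi>: "\<phi> \<in> schwartz" and t: "0 < t"
    have "(LINT x|lborel. f (t *\<^sub>R x) * tilde \<phi> x) = (LINT x|lborel. of_real t powr (- s) * (f x * tilde \<phi> x))"
    proof (rule Bochner_Integration.integral_cong[OF refl])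
      fix x show "f (t *\<^sub>R x) * tilde \<phi> x = of_real t powr (- s) * (f x * tilde \<phi> x)"
        using f_scaleR[of x t] t tilde0[OF \<phi>] by (cases "x = 0") auto
    qed
    also have "\<dots> = of_real t powr (- s) * u \<phi>" by (simp add: u_def)
    finally show "u (\<lambda>x. \<phi> ((1 / t) *\<^sub>R x)) = of_real t powr (of_nat CARD('k) + - s) * u \<phi>"
      using scale[OF \<phi>, of t] t by (simp only: powr_add) (simp add: powr_nat')
  next
    fix \<phi> :: "real^'k \<Rightarrow> complex" assume \<phi>: "\<phi> \<in> schwartz"
    have "(LINT x|lborel. f (- x) * tilde \<phi> x) = (LINT x|lborel. \<epsilon> * (f x * tilde \<phi> x))"
    proof (rule Bochner_Integration.integral_cong[OF refl])
      fix x show "f (- x) * tilde \<phi> x = \<epsilon> * (f x * tilde \<phi> x)"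
        using f_minus[of x] tilde0[OF \<phi>] by (cases "x = 0") auto
    qed
    then show "u (\<lambda>x. \<phi> (- x)) = \<epsilon> * u \<phi>"
      using scale[OF \<phi>, of "-1"] by (simp add: u_def)
  qed
  moreover have "represented_off_0 u f"
    unfolding represented_off_0_def
  proof
    fix \<phi> :: "real^'k \<Rightarrow> complex" assume \<phi>: "\<phi> \<in> test_off_0"
    then obtain d where T: "\<phi> \<in> test_fns" and d: "d > 0" "\<And>x. norm x < d \<Longrightarrow> \<phi> x = 0" unfolding test_off_0_iff by blast
    have \<phi>0: "\<phi> 0 = 0" using d by simp
    have O: "(\<lambda>x. \<phi> (b *\<^sub>R x)) \<in> test_off_0" if "b \<noteq> 0" for b
      unfolding test_off_0_iff
    proof (intro conjI exI[of _ "d / \<bar>b\<bar>"] allI impI test_fns_scaleR T that)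
      show "0 < d / \<bar>b\<bar>" using d(1) that by simp
      show "\<phi> (b *\<^sub>R x) = 0" if "norm x < d / \<bar>b\<bar>" for x
        using that \<open>b \<noteq> 0\<close> by (intro d(2)) (simp add: field_simps)
    qed
    have fO: "(\<lambda>x. f x * \<phi> (b *\<^sub>R x)) \<in> test_fns" if "b \<noteq> 0" for b
      using test_off_0_mult[OF smooth O[OF that]] test_off_0_iff by blast
    have "u \<phi> = (LINT x|lborel. (\<Sum>l<L. c l * (f x * \<phi> (a l *\<^sub>R x))))"
      by (simp add: u_def tilde_def sum_distrib_left mult.left_commute)
    also have "\<dots> = (\<Sum>l<L. LINT x|lborel. c l * (f x * \<phi> (a l *\<^sub>R x)))"
    proof (rule Bochner_Integration.integral_sum)
      fix l assume "l \<in> {..<L}"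
      then have "a l \<noteq> 0" using a by auto
      from test_fns_integrable[OF fO[OF this] continuous_on_const[of _ "1 :: complex"]]
      show "integrable lborel (\<lambda>x. c l * (f x * \<phi> (a l *\<^sub>R x)))"
        by (intro integrable_mult_right) simp
    qed
    also have "\<dots> = (\<Sum>l<L. c l * chr (a l) * (LINT x|lborel. f x * \<phi> x))"
    proof (rule sum.cong[OF refl])
      fix l assume "l \<in> {..<L}"
      then have al: "a l \<noteq> 0" using a by auto
      have "(LINT x|lborel. f x * \<phi> (a l *\<^sub>R x)) = of_real \<bar>1 / a l\<bar> ^ CARD('k) * (LINT x|lborel. f ((1 / a l) *\<^sub>R x) * \<phi> (a l *\<^sub>R ((1 / a l) *\<^sub>R x)))"
        using al by (intro integral_scaleR test_fns_borel fO) auto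
      also have "\<dots> = (LINT x|lborel. of_real \<bar>1 / a l\<bar> ^ CARD('k) * (f ((1 / a l) *\<^sub>R x) * \<phi> x))"
        using al by simp
      also have "\<dots> = (LINT x|lborel. chr (a l) * (f x * \<phi> x))"
      proof (rule Bochner_Integration.integral_cong[OF refl])
        fix x show "of_real \<bar>1 / a l\<bar> ^ CARD('k) * (f ((1 / a l) *\<^sub>R x) * \<phi> x) = chr (a l) * (f x * \<phi> x)"
          using chr_f[OF _ al, of x] \<phi>0 by (cases "x = 0") (simp_all flip: mult.assoc)
      qed
      finally show "(LINT x|lborel. c l * (f x * \<phi> (a l *\<^sub>R x))) = c l * chr (a l) * (LINT x|lborel. f x * \<phi> x)"
        by (simp add: mult.assoc)
    qed
    also have "\<dots> = (LINT x|lborel. f x * \<phi> x)" using chr_sum by (simp flip: sum_distrib_right)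
    finally show "u \<phi> = (LINT x|lborel. f x * \<phi> x)" .
  qed
  ultimately show ?thesis by blast
qed

end

section \<open>Symmetries of the lattice series\<close>

context homogeneous_fn
begin

lemma smooth_on_lattice_series:
  "smooth_on (- range lattice_vec) (\<lambda>y. lattice_series f 0 (torus_exp y))"
proof -
  obtain \<eta> :: "real^'k \<Rightarrow> complex" where \<eta>: "cutoff \<eta>" using exists_even_cutoff by blast
  show ?thesis
    by (rule smooth_on_cong[OF open_off_lattice _ smooth_on_latsum_series[OF \<eta>]])
      (use lattice_series_dyadic(2)[OF \<eta>] in auto)
qed

lemma lattice_series_minus:
  assumes y: "y \<notin> range lattice_vec"
  shows "lattice_series f 0 (torus_exp (- y)) = \<epsilon> * lattice_series f 0 (torus_exp y)"
proof -
  obtain \<eta> :: "real^'k \<Rightarrow> complex" where \<eta>: "cutoff \<eta>" "\<And>x. \<eta> (- x) = \<eta> x" using exists_even_cutoff by blast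
  have y': "- y \<notin> range lattice_vec"
  proof
    assume "- y \<in> range lattice_vec"
    then obtain n where "- y = lattice_vec n" by blast
    then have "y = lattice_vec (- n)" by (simp add: lattice_vec_minus) (metis minus_minus)
    with y show False by blast
  qed
  have sh: "shell f \<eta> i (- x) = \<epsilon> * shell f \<eta> i x" for i x
    by (cases "x = 0") (simp_all add: shell_def \<eta>(2) f_minus)
  have ls: "latsum (shell f \<eta> i) (- y) = \<epsilon> * latsum (shell f \<eta> i) y" for i
  proof -
    have b: "bij_betw uminus (UNIV :: (int^'k) set) UNIV" by (rule bij_betwI[of _ _ _ uminus]) auto
    have "latsum (shell f \<eta> i) (- y) = (\<Sum>\<^sub>\<infinity>n. shell f \<eta> i (lattice_vec (- n)) * psi (lattice_vec (- n)) (- y))"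
      unfolding latsum_def by (rule infsum_reindex_bij_betw[OF b, symmetric])
    also have "\<dots> = (\<Sum>\<^sub>\<infinity>n. \<epsilon> * (shell f \<eta> i (lattice_vec n) * psi (lattice_vec n) y))"
      by (simp add: lattice_vec_minus sh psi_minus mult.assoc)
    finally show ?thesis by (simp add: infsum_cmult_right' latsum_def)
  qed
  have "lattice_series f 0 (torus_exp (- y)) = (\<Sum>i. \<epsilon> * latsum (shell f \<eta> i) y)"
    unfolding lattice_series_dyadic(2)[OF \<eta>(1) y'] ls ..
  also have "\<dots> = \<epsilon> * (\<Sum>i. latsum (shell f \<eta> i) y)"
    by (rule suminf_mult[OF summable_norm_cancel[OF lattice_series_dyadic(1)[OF \<eta>(1) y]]])
  finally show ?thesis unfolding lattice_series_dyadic(2)[OF \<eta>(1) y] .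
qed

text \<open>Aliasing turns each shell for the cutoff \<open>\<eta>\<close> into its dilate by \<open>m\<close>, which by homogeneity is a multiple of a
  shell for the cutoff \<open>\<eta>(mx)\<close>. The dyadic series of both cutoffs represent the same lattice series.\<close>

lemma lattice_series_average:
  assumes m: "m > 0" and my: "real m *\<^sub>R y \<notin> range lattice_vec"
  shows "(\<Sum>j\<in>residue_box m. lattice_series f 0 (torus_exp (y + (1 / real m) *\<^sub>R lattice_vec j)))
    = of_nat m powr (of_nat CARD('k) - s) * lattice_series f 0 (torus_exp (real m *\<^sub>R y))"
proof -
  obtain \<eta> :: "real^'k \<Rightarrow> complex" where \<eta>: "cutoff \<eta>" using exists_even_cutoff by blast
  define \<eta>m where "\<eta>m = (\<lambda>x. \<eta> (real m *\<^sub>R x))"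
  have \<eta>m: "cutoff \<eta>m"
    unfolding cutoff_def
  proof (intro conjI allI impI)
    show "\<eta>m \<in> test_fns" unfolding \<eta>m_def using m \<eta> by (intro test_fns_scaleR) (auto simp: cutoff_def)
    obtain d where d: "d > 0" "\<And>x. norm x < d \<Longrightarrow> \<eta> x = 1" using \<eta> unfolding cutoff_def by blast
    show "\<exists>d>0. \<forall>x. norm x < d \<longrightarrow> \<eta>m x = 1"
      using d(1) m by (intro exI[of _ "d / real m"]) (auto simp: \<eta>m_def field_simps intro!: d(2))
    fix x :: "real^'k" assume "1 \<le> norm x"
    then have "1 * 1 \<le> real m * norm x" using m by (intro mult_mono) auto
    then show "\<eta>m x = 0" using \<eta> by (simp add: \<eta>m_def cutoff_def)
  qed
  let ?z = "real m *\<^sub>R y"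
  have pt: "y + (1 / real m) *\<^sub>R lattice_vec j = (1 / real m) *\<^sub>R (?z + lattice_vec j)" for j
    using m by (simp add: scaleR_right_distrib)
  have off: "y + (1 / real m) *\<^sub>R lattice_vec j \<notin> range lattice_vec" for j
  proof
    assume "y + (1 / real m) *\<^sub>R lattice_vec j \<in> range lattice_vec"
    then obtain n where n: "y + (1 / real m) *\<^sub>R lattice_vec j = lattice_vec n" by blast
    have "?z = real m *\<^sub>R (y + (1 / real m) *\<^sub>R lattice_vec j) - lattice_vec j"
      using m by (simp add: scaleR_right_distrib)
    also have "\<dots> = lattice_vec ((\<chi> i. int m * n $ i) - j)"
      unfolding n by (simp add: vec_eq_iff)
    finally show False using my by blast
  qed
  have sc: "shell f \<eta> i (real m *\<^sub>R x) = of_nat m powr (- s) * shell f \<eta>m i x" for i x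
    using f_scaleR[of x "real m"] m by (cases "x = 0") (auto simp: shell_def \<eta>m_def mult.commute)
  have al: "(\<Sum>j\<in>residue_box m. latsum (shell f \<eta> i) ((1 / real m) *\<^sub>R (?z + lattice_vec j)))
     = of_nat m powr (of_nat CARD('k) - s) * latsum (shell f \<eta>m i) ?z" for i
  proof -
    obtain R where R: "R > 0" "\<forall>x. R < norm x \<longrightarrow> shell f \<eta> i x = 0" using test_fns_support[OF shell_test_fns[OF \<eta>]] by blast
    have "(\<Sum>j\<in>residue_box m. latsum (shell f \<eta> i) ((1 / real m) *\<^sub>R (?z + lattice_vec j)))
      = of_nat m ^ CARD('k) * latsum (\<lambda>x. shell f \<eta> i (real m *\<^sub>R x)) ?z"
      by (rule latsum_aliasing[of _ R]) (use m R in auto)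
    also have "\<dots> = (of_nat m ^ CARD('k) * of_nat m powr (- s)) * latsum (shell f \<eta>m i) ?z"
      unfolding sc latsum_cmult by (simp only: mult.assoc)
    also have "of_nat m ^ CARD('k) * of_nat m powr (- s) = (of_nat m powr (of_nat CARD('k) - s) :: complex)"
      using m by (simp add: powr_diff powr_minus powr_nat' divide_inverse)
    finally show ?thesis .
  qed
  have "(\<Sum>j\<in>residue_box m. lattice_series f 0 (torus_exp (y + (1 / real m) *\<^sub>R lattice_vec j)))
     = (\<Sum>j\<in>residue_box m. \<Sum>i. latsum (shell f \<eta> i) (y + (1 / real m) *\<^sub>R lattice_vec j))"
    by (intro sum.cong refl lattice_series_dyadic(2)[OF \<eta> off])
  also have "\<dots> = (\<Sum>i. \<Sum>j\<in>residue_box m. latsum (shell f \<eta> i) (y + (1 / real m) *\<^sub>R lattice_vec j))"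
    by (rule suminf_sum[symmetric]) (rule summable_norm_cancel[OF lattice_series_dyadic(1)[OF \<eta> off]])
  also have "\<dots> = (\<Sum>i. of_nat m powr (of_nat CARD('k) - s) * latsum (shell f \<eta>m i) ?z)"
    unfolding pt al ..
  also have "\<dots> = of_nat m powr (of_nat CARD('k) - s) * (\<Sum>i. latsum (shell f \<eta>m i) ?z)"
    by (rule suminf_mult[OF summable_norm_cancel[OF lattice_series_dyadic(1)[OF \<eta>m my]]])
  also have "(\<Sum>i. latsum (shell f \<eta>m i) ?z) = lattice_series f 0 (torus_exp ?z)"
    by (rule lattice_series_dyadic(2)[OF \<eta>m my, symmetric])
  finally show ?thesis .
qed

text \<open>The Fourier transform intertwines the dilation by \<open>b\<close> with the one by \<open>1/b\<close>, up to the
  Jacobian, which cancels against the one of the substitution in the integral.\<close>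

lemma fourier_transform_homogeneous:
  fixes u :: "(real^'k \<Rightarrow> complex) \<Rightarrow> complex" and h :: "real^'k \<Rightarrow> complex"
  assumes temp: "tempered u" and hd: "homogeneous_distr (- s) \<epsilon> u"
    and h: "smooth_on (- {0}) h" and rep: "represented_off_0 (fourier_distr u) h"
    and b: "b \<noteq> 0" and y: "y \<noteq> 0"
  shows "h (b *\<^sub>R y) = chr b * h y"
proof -
  have rep': "u (fourier \<phi>) = (LINT y|lborel. h y * \<phi> y)" if "\<phi> \<in> test_off_0" for \<phi>
    using rep that by (simp add: represented_off_0_def fourier_distr_def)
  define g where "g = (\<lambda>y. h (b *\<^sub>R y) - chr b * h y)"
  have hc: "continuous_on (- {0}) h" by (rule smooth_on_imp_continuous_on[OF h])
  have hbc: "continuous_on (- {0}) (\<lambda>y. h (b *\<^sub>R y))"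
    by (rule continuous_on_compose2[OF hc]) (use b in \<open>auto intro!: continuous_intros\<close>)
  have "g y = 0"
  proof (rule eq_0_if_integrals_eq_0[OF _ _ y])
    show "continuous_on (- {0}) g" unfolding g_def by (intro continuous_intros hc hbc)
    fix \<phi> :: "real^'k \<Rightarrow> complex" assume \<phi>: "\<phi> \<in> test_off_0"
    then obtain d where T: "\<phi> \<in> test_fns" and d: "d > 0" "\<And>x. norm x < d \<Longrightarrow> \<phi> x = 0" unfolding test_off_0_iff by blast
    define \<phi>b where "\<phi>b = (\<lambda>x. \<phi> ((1 / b) *\<^sub>R x))"
    have \<phi>b: "\<phi>b \<in> test_off_0"
      unfolding test_off_0_iff
    proof (intro conjI exI[of _ "d * \<bar>b\<bar>"] allI impI)
      show "\<phi>b \<in> test_fns" unfolding \<phi>b_def using b by (intro test_fns_scaleR T) auto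
      show "0 < d * \<bar>b\<bar>" using d(1) b by simp
      show "\<phi>b x = 0" if "norm x < d * \<bar>b\<bar>" for x
        unfolding \<phi>b_def using that b by (intro d(2)) (simp add: field_simps)
    qed
    let ?K = "of_real \<bar>b\<bar> ^ CARD('k) :: complex"
    have K: "?K \<noteq> 0" using b by simp
    have "fourier \<phi>b x = ?K * fourier \<phi> (b *\<^sub>R x)" for x
      using fourier_scaleR[OF T b, of x] b by (simp add: \<phi>b_def power_divide)
    then have "u (fourier \<phi>b) = u (\<lambda>x. ?K * fourier \<phi> (b *\<^sub>R x))" by presburger
    also have "\<dots> = ?K * u (\<lambda>x. fourier \<phi> (b *\<^sub>R x))"
      by (rule tempered_cmult[OF temp schwartz_scaleR[OF fourier_schwartz[OF T] b]])
    also have "\<dots> = ?K * (chr b * u (fourier \<phi>))"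
      by (simp only: homogeneous_distr_scaleR[OF hd fourier_schwartz[OF T] b])
    finally have 1: "u (fourier \<phi>b) = ?K * (chr b * (LINT y|lborel. h y * \<phi> y))" by (simp only: rep'[OF \<phi>])
    have "u (fourier \<phi>b) = (LINT y|lborel. h y * \<phi>b y)" by (rule rep'[OF \<phi>b])
    also have "\<dots> = ?K * (LINT y|lborel. h (b *\<^sub>R y) * \<phi>b (b *\<^sub>R y))"
      using test_off_0_mult[OF h \<phi>b] by (intro integral_scaleR b test_fns_borel) (simp add: test_off_0_iff)
    also have "(\<lambda>y. \<phi>b (b *\<^sub>R y)) = \<phi>" using b by (simp add: \<phi>b_def)
    finally have 2: "u (fourier \<phi>b) = ?K * (LINT y|lborel. h (b *\<^sub>R y) * \<phi> y)"
      using b by (simp add: \<phi>b_def)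
    have eq: "(LINT y|lborel. h (b *\<^sub>R y) * \<phi> y) = chr b * (LINT y|lborel. h y * \<phi> y)"
      using 1 2 K by simp
    have "(LINT y|lborel. g y * \<phi> y) = (LINT y|lborel. h (b *\<^sub>R y) * \<phi> y - chr b * (h y * \<phi> y))"
      by (simp add: g_def left_diff_distrib mult.assoc)
    also have "\<dots> = 0"
      using integrable_mult_test_off_0[OF hbc \<phi>] integrable_mult_test_off_0[OF hc \<phi>] eq by (subst Bochner_Integration.integral_diff) auto
    finally show "(LINT y|lborel. g y * \<phi> y) = 0" .
  qed
  then show ?thesis by (simp add: g_def)
qed

end

section \<open>Roots of unity\<close>

lemma torus_exp_bij_betw:
  assumes m: "m > 0"
  shows "bij_betw (\<lambda>j :: int^'k::finite. torus_exp ((1 / real m) *\<^sub>R lattice_vec j))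
    (residue_box m - {0}) {z. z \<noteq> 1 \<and> (\<forall>i. z $ i ^ m = 1)}"
proof -
  let ?E = "\<lambda>j :: int^'k. torus_exp ((1 / real m) *\<^sub>R lattice_vec j)"
  define \<beta> where "\<beta> = (\<lambda>j. cis (2 * pi * real j / real m))"
  have \<beta>: "bij_betw \<beta> {..<m} {z. z ^ m = 1}"
    unfolding \<beta>_def using m by (rule Complex.bij_betw_roots_unity)
  have E: "?E j $ i = \<beta> (nat (j $ i))" if "j \<in> residue_box m" for j i
  proof -
    have "0 \<le> j $ i" using that by (simp add: residue_box_def)
    then have "real (nat (j $ i)) = of_int (j $ i)" by simp
    then show ?thesis by (simp add: torus_exp_def \<beta>_def cis_conv_exp mult_ac)
  qed
  have rng: "nat (j $ i) \<in> {..<m}" if "j \<in> residue_box m" for j :: "int^'k" and i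
    using that by (auto simp: residue_box_def nat_less_iff)
  have b: "bij_betw ?E (residue_box m) {z. \<forall>i. z $ i ^ m = 1}"
    unfolding bij_betw_def
  proof (intro conjI inj_onI equalityI subsetI)
    fix j l :: "int^'k" assume jl: "j \<in> residue_box m" "l \<in> residue_box m" "?E j = ?E l"
    have "nat (j $ i) = nat (l $ i)" for i
    proof (rule inj_onD[OF bij_betw_imp_inj_on[OF \<beta>]])
      show "\<beta> (nat (j $ i)) = \<beta> (nat (l $ i))" using E[OF jl(1), of i] E[OF jl(2), of i] jl(3) by simp
    qed (use rng jl in auto)
    then have "j $ i = l $ i" for i
      using jl(1,2) by (simp add: residue_box_def) (metis eq_nat_nat_iff)
    then show "j = l" by (simp add: vec_eq_iff)
  next
    fix z assume "z \<in> ?E ` residue_box m"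
    then obtain j where j: "j \<in> residue_box m" "z = ?E j" by blast
    have "\<beta> (nat (j $ i)) \<in> {z. z ^ m = 1}" for i
      using bij_betwE[OF \<beta>] rng[OF j(1)] by blast
    then show "z \<in> {z. \<forall>i. z $ i ^ m = 1}" using E[OF j(1)] j(2) by simp
  next
    fix z :: "complex^'k" assume "z \<in> {z. \<forall>i. z $ i ^ m = 1}"
    then have "z $ i \<in> \<beta> ` {..<m}" for i using bij_betw_imp_surj_on[OF \<beta>] by blast
    then have "\<exists>j<m. z $ i = \<beta> j" for i by blast
    then obtain j where j: "\<And>i. j i < m" "\<And>i. z $ i = \<beta> (j i)" by metis
    have J: "(\<chi> i. int (j i)) \<in> residue_box m" using j(1) by (simp add: residue_box_def)
    have "z = ?E (\<chi> i. int (j i))"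
      unfolding vec_eq_iff using E[OF J] j(2) by simp
    with J show "z \<in> ?E ` residue_box m" by blast
  qed
  have E0: "?E 0 = 1" by (simp add: torus_exp_def vec_eq_iff)
  have "(0 :: int^'k) \<in> residue_box m" using m by (simp add: residue_box_def)
  then have "?E ` (residue_box m - {0}) = ?E ` residue_box m - ?E ` {0}"
    by (intro inj_on_image_set_diff[OF bij_betw_imp_inj_on[OF b]]) auto
  also have "\<dots> = {z. \<forall>i. z $ i ^ m = 1} - {1}"
    unfolding bij_betw_imp_surj_on[OF b] using E0 by simp
  finally have "?E ` (residue_box m - {0}) = {z. \<forall>i. z $ i ^ m = 1} - {1}" .
  then have "bij_betw ?E (residue_box m - {0}) ({z. \<forall>i. z $ i ^ m = 1} - {1})"
    using inj_on_subset[OF bij_betw_imp_inj_on[OF b], of "residue_box m - {0}"] by (simp add: bij_betw_def)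
  moreover have "{z :: complex^'k. \<forall>i. z $ i ^ m = 1} - {1} = {z. z \<noteq> 1 \<and> (\<forall>i. z $ i ^ m = 1)}" by auto
  ultimately show ?thesis by simp
qed

section \<open>Extension across the origin\<close>

context moment_cutoff
begin

text \<open>The difference between the lattice series and the Fourier transform, rearranged so that every series converges at \<open>0\<close>.\<close>

definition near_ext :: "real^'k \<Rightarrow> complex" where
  "near_ext y = (\<Sum>i. latsum (shell f \<omega> i) y - fourier (shell f \<omega> i) y) - (\<Sum>j. fourier (inner_shell f \<omega> j) y)"

lemma smooth_on_near_ext:
  assumes n: "Re s < real n + real CARD('k)"
  shows "smooth_on half_box near_ext"
  unfolding near_ext_def[abs_def]
  by (intro smooth_on_diff open_half_box smooth_on_lattice_minus_fourier[OF cutoff_\<omega>]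
      smooth_on_subset[OF smooth_on_inner_fourier_series(1)[OF cutoff_\<omega> n fourier_shell_vanishing]]) auto

lemma near_ext_eq:
  assumes y: "y \<in> half_box" "y \<noteq> 0"
  shows "near_ext y = lattice_series f 0 (torus_exp y) - fhat y"
proof -
  have off: "y \<notin> range lattice_vec" using half_box_lattice y by blast
  have "norm y > 0" using y(2) by simp
  from smooth_on_fourier_series(2)[OF cutoff_\<omega> this, of "[]"]
  obtain B where B: "summable B" "\<And>i z. norm y \<le> norm z \<Longrightarrow> norm (fourier (shell f \<omega> i) z) \<le> B i" by auto
  have s2: "summable (\<lambda>i. fourier (shell f \<omega> i) y)"
    by (rule summable_comparison_test'[OF B(1), of 0]) (use B(2) in auto)
  have s1: "summable (\<lambda>i. latsum (shell f \<omega> i) y)"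
    by (rule summable_norm_cancel[OF lattice_series_dyadic(1)[OF cutoff_\<omega> off]])
  show ?thesis
    unfolding near_ext_def fhat_def lattice_series_dyadic(2)[OF cutoff_\<omega> off] suminf_diff[OF s1 s2, symmetric] by simp
qed

text \<open>The value at \<open>0\<close> is found by approaching \<open>0\<close> along a coordinate axis in the parity relation (for \<open>\<epsilon> = -1\<close>) or in the
  averaging relation over the \<open>m\<close>-torsion points (for \<open>\<epsilon> = 1\<close>). In the latter the contributions of \<open>h\<close> cancel by homogeneity and
  the terms with \<open>j \<noteq> 0\<close> are continuous at \<open>y = 0\<close>.\<close>

lemma extension_across_lattice:
  assumes n: "Re s < real n + real CARD('k)"
    and h: "\<And>y. y \<noteq> 0 \<Longrightarrow> h y = fhat y"
    and hh: "\<And>b y. b \<noteq> 0 \<Longrightarrow> y \<noteq> 0 \<Longrightarrow> h (b *\<^sub>R y) = chr b * h y"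
    and crit: "(s, \<epsilon>) \<noteq> (of_nat CARD('k), 1)"
  shows "\<exists>g. smooth_on punctured_domain g \<and>
      (\<forall>y\<in>punctured_domain - {0}. g y = lattice_series f 0 (torus_exp y) - h y) \<and>
      g 0 = algebraic_sum s \<epsilon> f"
proof -
  define F where "F = (\<lambda>y. lattice_series f 0 (torus_exp y))"
  define g where "g = (\<lambda>y. if y = 0 then near_ext 0 else F y - h y)"
  have sm1: "smooth_on (- range lattice_vec) g"
  proof (rule smooth_on_cong[OF open_off_lattice])
    have sub: "- range lattice_vec \<subseteq> - {0 :: real^'k}" using lattice_vec_0 by (auto intro: range_eqI[of _ _ 0])
    show "smooth_on (- range lattice_vec) (\<lambda>y. F y - fhat y)"
      unfolding F_def
      by (intro smooth_on_diff open_off_lattice smooth_on_lattice_series smooth_on_subset[OF smooth_on_fhat[OF n] sub])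
    show "F y - fhat y = g y" if "y \<in> - range lattice_vec" for y
      using sub that h[of y] by (auto simp: g_def)
  qed
  have g_near: "near_ext y = g y" if "y \<in> half_box" for y
    using near_ext_eq[OF that] h[of y] by (auto simp: g_def F_def)
  have sm2: "smooth_on half_box g"
    by (rule smooth_on_cong[OF open_half_box g_near smooth_on_near_ext[OF n]])
  have "smooth_on punctured_domain g"
    unfolding punctured_domain_eq by (rule smooth_on_Un[OF open_off_lattice open_half_box sm1 sm2])
  moreover have "\<forall>y\<in>punctured_domain - {0}. g y = lattice_series f 0 (torus_exp y) - h y"
    by (simp add: g_def F_def)
  moreover have "g 0 = algebraic_sum s \<epsilon> f"
  proof -
    define v where "v = (axis undefined 1 :: real^'k)"
    have v: "v \<noteq> 0" by (simp add: v_def axis_eq_0_iff)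
    have vc: "\<bar>(t *\<^sub>R v) $ c\<bar> \<le> \<bar>t\<bar>" for t c by (simp add: v_def axis_def)
    define t where "t = (\<lambda>p::nat. 1 / real (Suc p))"
    have t0: "t \<longlonglongrightarrow> 0" unfolding t_def by (rule lim_inverse_n'[THEN LIMSEQ_Suc])
    have tp: "t p > 0" for p by (simp add: t_def)
    have g0: "isCont g 0"
    proof -
      have "(0 :: real^'k) \<in> half_box" by simp
      then show ?thesis
        using smooth_on_imp_continuous_on[OF sm2] continuous_on_eq_continuous_at[OF open_half_box] by blast
    qed
    have lim_g: "(\<lambda>p. g ((b * t p) *\<^sub>R v)) \<longlonglongrightarrow> g 0" for b
    proof -
      have "(\<lambda>p. (b * t p) *\<^sub>R v) \<longlonglongrightarrow> (b * 0) *\<^sub>R v" by (intro tendsto_intros t0)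
      then show ?thesis using isCont_tendsto_compose[OF g0, of "\<lambda>p. (b * t p) *\<^sub>R v" sequentially] by simp
    qed
    have small: "\<forall>\<^sub>F p in sequentially. (b * t p) *\<^sub>R v \<in> half_box" for b
    proof -
      have "(\<lambda>p. \<bar>b * t p\<bar>) \<longlonglongrightarrow> \<bar>b * 0\<bar>" by (intro tendsto_intros t0)
      then have "\<forall>\<^sub>F p in sequentially. \<bar>b * t p\<bar> < 1/2" by (intro order_tendstoD(2)[of _ "\<bar>b * 0\<bar>"]) auto
      then show ?thesis
      proof eventually_elim
        case (elim p)
        show ?case using le_less_trans[OF vc[of "b * t p"] elim] by (simp only: mem_Collect_eq simp_thms)
      qed
    qed
    have ne: "(b * t p) *\<^sub>R v \<noteq> 0" if "b \<noteq> 0" for b p using that tp[of p] v by simp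
    have gval: "F y = g y + h y" if "y \<noteq> 0" for y using that by (simp add: g_def)
    show ?thesis
    proof (cases "\<epsilon> = - 1")
      case True
      have "\<forall>\<^sub>F p in sequentially. g ((- 1 * t p) *\<^sub>R v) = - g ((1 * t p) *\<^sub>R v)"
        using small[of 1]
      proof eventually_elim
        case (elim p)
        let ?y = "(1 * t p) *\<^sub>R v"
        have y0: "?y \<noteq> 0" by (rule ne) simp
        have "F (- ?y) = \<epsilon> * F ?y"
          unfolding F_def using half_box_lattice[OF elim] y0 by (intro lattice_series_minus) blast
        moreover have "h ((- 1) *\<^sub>R ?y) = chr (- 1) * h ?y" by (rule hh) (use y0 in auto)
        moreover have "chr (- 1) = \<epsilon>" by (simp add: chr_def)
        ultimately have "g (- ?y) = - g ?y" using gval[of ?y] gval[of "- ?y"] y0 True by simp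
        then show ?case by simp
      qed
      then have "(\<lambda>p. g ((- 1 * t p) *\<^sub>R v)) \<longlonglongrightarrow> - g 0"
        using tendsto_minus[OF lim_g[of 1]] by (simp add: tendsto_cong)
      with lim_g[of "- 1"] have "g 0 = - g 0" by (rule LIMSEQ_unique)
      then have "g 0 = 0" by (metis add_eq_0_iff2 mult_2 mult_eq_0_iff zero_neq_numeral)
      then show ?thesis using True by (simp add: algebraic_sum_def)
    next
      case False
      then have e1: "\<epsilon> = 1" using eps by simp
      define w where "w = of_nat CARD('k) - s"
      have "w \<noteq> 0" using crit e1 by (auto simp: w_def)
      then have "2 powr w \<noteq> 1 \<or> 3 powr w \<noteq> 1" using eq_0_if_2_3_powr_eq_1 by blast
      then have "\<exists>m::nat. 1 < m \<and> of_nat m powr w \<noteq> 1"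
        by (auto intro: exI[of _ 2] exI[of _ 3])
      define m where "m = (SOME m::nat. 1 < m \<and> of_nat m powr w \<noteq> 1)"
      have m: "1 < m" "of_nat m powr w \<noteq> 1"
        using someI_ex[OF \<open>\<exists>m::nat. 1 < m \<and> of_nat m powr w \<noteq> 1\<close>] unfolding m_def by auto
      let ?J = "residue_box m - {0} :: (int^'k) set"
      have id: "(\<Sum>j\<in>?J. F ((1 * t p) *\<^sub>R v + (1 / real m) *\<^sub>R lattice_vec j))
          = of_nat m powr w * g ((real m * t p) *\<^sub>R v) - g ((1 * t p) *\<^sub>R v)"
        if sm: "(real m * t p) *\<^sub>R v \<in> half_box" for p
      proof -
        let ?y = "(1 * t p) *\<^sub>R v" and ?my = "(real m * t p) *\<^sub>R v"
        have my: "real m *\<^sub>R ?y = ?my" by simp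
        have y0: "?y \<noteq> 0" by (rule ne) simp
        have my0: "?my \<noteq> 0" by (rule ne) (use m in simp)
        have "?my \<notin> range lattice_vec" using half_box_lattice[OF sm] my0 by blast
        then have "(\<Sum>j\<in>residue_box m. F (?y + (1 / real m) *\<^sub>R lattice_vec j)) = of_nat m powr w * F ?my"
          using lattice_series_average[of m ?y] m(1) unfolding F_def w_def my by simp
        moreover have "(\<Sum>j\<in>residue_box m. F (?y + (1 / real m) *\<^sub>R lattice_vec j))
            = F ?y + (\<Sum>j\<in>?J. F (?y + (1 / real m) *\<^sub>R lattice_vec j))"
          using sum.remove[OF finite_residue_box, of "0 :: int^'k" m "\<lambda>j. F (?y + (1 / real m) *\<^sub>R lattice_vec j)"] m(1)
          by (simp add: residue_box_def)
        moreover have "h ?my = of_nat m powr (- w) * h ?y"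
          using hh[of "real m" ?y] m(1) y0 unfolding my by (simp add: chr_def w_def)
        moreover have "of_nat m powr w * of_nat m powr (- w) = (1 :: complex)"
          using m(1) by (simp flip: powr_add)
        ultimately show ?thesis
          unfolding gval[OF y0] gval[OF my0]
          by (simp add: distrib_left mult.assoc[symmetric] algebra_simps)
      qed
      have "(\<lambda>p. \<Sum>j\<in>?J. F ((1 * t p) *\<^sub>R v + (1 / real m) *\<^sub>R lattice_vec j))
          \<longlonglongrightarrow> (\<Sum>j\<in>?J. F ((1 / real m) *\<^sub>R lattice_vec j))"
      proof (rule tendsto_sum)
        fix j :: "int^'k" assume j: "j \<in> ?J"
        let ?x = "(1 / real m) *\<^sub>R lattice_vec j"
        have off: "?x \<in> - range lattice_vec"
        proof
          assume "?x \<in> range lattice_vec"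
          then obtain l where l: "?x = lattice_vec l" by blast
          have "real_of_int (j $ i) = real_of_int (int m * l $ i)" for i
          proof -
            have "?x $ i = lattice_vec l $ i" by (simp only: l)
            then show ?thesis using m(1) by (simp add: field_simps)
          qed
          then have jl: "j $ i = int m * l $ i" for i by (simp only: of_int_eq_iff)
          have "j $ i = 0" for i
          proof -
            have "0 \<le> j $ i \<and> j $ i < int m" using j by (simp add: residue_box_def)
            then have "0 \<le> int m * l $ i" "int m * l $ i < int m * 1" unfolding jl[of i] by auto
            then have "0 \<le> l $ i" "l $ i < 1"
              using m(1) by (auto simp: zero_le_mult_iff dest: mult_left_less_imp_less)
            then show ?thesis using jl[of i] by simp
          qed
          then show False using j by (simp add: vec_eq_iff)
        qed
        have "isCont F ?x"
          using smooth_on_imp_continuous_on[OF smooth_on_lattice_series] off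
            continuous_on_eq_continuous_at[OF open_off_lattice] unfolding F_def by blast
        moreover have "(\<lambda>p. (1 * t p) *\<^sub>R v + ?x) \<longlonglongrightarrow> (1 * 0) *\<^sub>R v + ?x" by (intro tendsto_intros t0)
        ultimately show "(\<lambda>p. F ((1 * t p) *\<^sub>R v + ?x)) \<longlonglongrightarrow> F ?x"
          using isCont_tendsto_compose[of ?x F "\<lambda>p. (1 * t p) *\<^sub>R v + ?x" sequentially] by simp
      qed
      moreover have "(\<lambda>p. \<Sum>j\<in>?J. F ((1 * t p) *\<^sub>R v + (1 / real m) *\<^sub>R lattice_vec j))
          \<longlonglongrightarrow> of_nat m powr w * g 0 - g 0"
      proof (rule Lim_transform_eventually)
        show "(\<lambda>p. of_nat m powr w * g ((real m * t p) *\<^sub>R v) - g ((1 * t p) *\<^sub>R v)) \<longlonglongrightarrow> of_nat m powr w * g 0 - g 0"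
          by (intro tendsto_diff tendsto_mult tendsto_const lim_g)
        show "\<forall>\<^sub>F p in sequentially. of_nat m powr w * g ((real m * t p) *\<^sub>R v) - g ((1 * t p) *\<^sub>R v)
            = (\<Sum>j\<in>?J. F ((1 * t p) *\<^sub>R v + (1 / real m) *\<^sub>R lattice_vec j))"
          using small[of "real m"] by eventually_elim (simp only: id)
      qed
      ultimately have S: "(\<Sum>j\<in>?J. F ((1 / real m) *\<^sub>R lattice_vec j)) = of_nat m powr w * g 0 - g 0"
        by (rule LIMSEQ_unique)
      have "(\<Sum>j\<in>?J. F ((1 / real m) *\<^sub>R lattice_vec j)) = (\<Sum>z | z \<noteq> 1 \<and> (\<forall>i. z $ i ^ m = 1). lattice_series f 0 z)"
        unfolding F_def using m(1) by (intro sum.reindex_bij_betw torus_exp_bij_betw) auto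
      then have "algebraic_sum s \<epsilon> f = - (of_nat m powr w * g 0 - g 0) / (1 - of_nat m powr w)"
        using e1 S unfolding algebraic_sum_def Let_def w_def[symmetric] m_def[symmetric] by simp
      also have "\<dots> = g 0" using m(2) by (simp add: field_simps)
      finally show ?thesis by simp
    qed
  qed
  ultimately show ?thesis by blast
qed

end

theorem corollary1p3:
  fixes f :: "real^'k::finite \<Rightarrow> complex" and s \<epsilon> :: complex
  assumes "\<epsilon> \<in> {1, - 1}"
    and "smooth_on (- {0}) f"
    and "homogeneous (- s) \<epsilon> f"
    and "(s, \<epsilon>) \<notin> {(of_nat (e + CARD('k)), (- 1) ^ e) | e :: nat. True}"
    and "(of_nat CARD('k) - s, \<epsilon>) \<notin> {(of_nat (e + CARD('k)), (- 1) ^ e) | e :: nat. True}"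
  shows "\<exists>g. smooth_on punctured_domain g \<and>
      (\<forall>y\<in>punctured_domain - {0}.
         g y = lattice_series f 0 (torus_exp y) - fourier_homogeneous (- s) \<epsilon> f y) \<and>
      g 0 = algebraic_sum s \<epsilon> f"
proof -
  interpret homogeneous_fn f s \<epsilon> by unfold_locales (use assms in auto)
  obtain \<eta> :: "real^'k \<Rightarrow> complex" where \<eta>: "cutoff \<eta>" using exists_even_cutoff by blast
  define u where "u = homogeneous_extension (- s) \<epsilon> f"
  have u: "tempered u \<and> homogeneous_distr (- s) \<epsilon> u \<and> represented_off_0 u f"
  proof -
    obtain n0 :: nat where n0: "Re s \<le> real n0" "n0 > 0"
    proof -
      obtain n0 :: nat where "real n0 \<ge> max (Re s) 1" using real_arch_simple by blast
      then show ?thesis using that[of n0] by auto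
    qed
    obtain L :: nat and c :: "nat \<Rightarrow> complex" and a :: "nat \<Rightarrow> real" where Lca: "\<And>l. l < L \<Longrightarrow> a l \<noteq> 0 \<and> \<bar>a l\<bar> \<le> 1" "\<And>d. d < n0 \<Longrightarrow> (\<Sum>l<L. c l * of_real (a l) ^ d) = 0"
      "(\<Sum>l<L. c l * chr (a l)) = 1" by (rule exists_moments[OF assms(4), of n0]) blast
    interpret moment_cutoff f s \<epsilon> n0 L c a \<eta> by unfold_locales (use Lca \<eta> in auto)
    from someI_ex[OF exists_homogeneous_extension[OF n0]]
    show ?thesis unfolding u_def homogeneous_extension_def .
  qed
  then obtain M C where MC: "\<And>\<phi>. \<phi> \<in> schwartz \<Longrightarrow> norm (u \<phi>) \<le> C * schwartz_seminorm M \<phi>"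
    unfolding tempered_def by blast
  \<comment> \<open>The number of vanishing moments depends on the order \<open>M\<close> of the chosen extension, so the cutoff can only be fixed now.\<close>
  obtain n :: nat where n: "2 * M < n" "Re s < real n + real CARD('k)"
  proof -
    obtain n :: nat where "real n > max (real (2 * M)) (Re s)" using reals_Archimedean2 by blast
    then show ?thesis using that[of n] by auto
  qed
  obtain L :: nat and c :: "nat \<Rightarrow> complex" and a :: "nat \<Rightarrow> real" where Lca: "\<And>l. l < L \<Longrightarrow> a l \<noteq> 0 \<and> \<bar>a l\<bar> \<le> 1" "\<And>d. d < n \<Longrightarrow> (\<Sum>l<L. c l * of_real (a l) ^ d) = 0"
    "(\<Sum>l<L. c l * chr (a l)) = 1" by (rule exists_moments[OF assms(4), of n]) blast
  interpret moment_cutoff f s \<epsilon> n L c a \<eta> by unfold_locales (use Lca \<eta> in auto)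
  define h where "h = fourier_homogeneous (- s) \<epsilon> f"
  have rep: "represented_off_0 (fourier_distr u) fhat"
    using u MC n by (intro fourier_distr_eq_fhat) auto
  have h: "smooth_on (- {0}) h \<and> represented_off_0 (fourier_distr u) h"
  proof -
    have "\<exists>h. smooth_on (- {0}) h \<and> represented_off_0 (fourier_distr u) h"
      using rep smooth_on_fhat[OF n(2)] by blast
    from someI_ex[OF this] show ?thesis unfolding h_def fourier_homogeneous_def u_def .
  qed
  have h_eq: "h y = fhat y" if y: "y \<noteq> 0" for y
  proof -
    have hc: "continuous_on (- {0}) h" "continuous_on (- {0}) fhat"
      using h smooth_on_fhat[OF n(2)] smooth_on_imp_continuous_on by auto
    have "h y - fhat y = 0"
    proof (rule eq_0_if_integrals_eq_0[OF _ _ y])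
      show "continuous_on (- {0}) (\<lambda>y. h y - fhat y)"
        by (intro continuous_on_diff hc)
      fix \<phi> :: "real^'k \<Rightarrow> complex" assume \<phi>: "\<phi> \<in> test_off_0"
      have "(LINT x|lborel. h x * \<phi> x) = (LINT x|lborel. fhat x * \<phi> x)"
        using h rep \<phi> unfolding represented_off_0_def by metis
      then show "(LINT x|lborel. (h x - fhat x) * \<phi> x) = 0"
        using integrable_mult_test_off_0[OF hc(1) \<phi>] integrable_mult_test_off_0[OF hc(2) \<phi>]
        by (simp add: left_diff_distrib Bochner_Integration.integral_diff)
    qed
    then show ?thesis by simp
  qed
  have hh: "h (b *\<^sub>R y) = chr b * h y" if "b \<noteq> 0" "y \<noteq> 0" for b y
    using fourier_transform_homogeneous[of u h b y] u h that by blast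
  have "(s, \<epsilon>) \<noteq> (of_nat CARD('k), 1)"
  proof
    assume "(s, \<epsilon>) = (of_nat CARD('k), 1)"
    then have "(s, \<epsilon>) = (of_nat (0 + CARD('k)), (- 1) ^ 0)" by simp
    with assms(4) show False by blast
  qed
  from extension_across_lattice[OF n(2) h_eq hh this] show ?thesis unfolding h_def .
qed

end
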